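(* Let $n\ge 3$. Let $\nu\in\mathcal{D}(\mathcal{N}_{1,n})^{H_{1,n}}$ be an $H_{1,n}$-invariant distribution whose support is all of $\mathcal{N}_{1,n}$ (such distributions exist), and let $\delta_0\in\mathcal{D}(\mathcal{N}_{1,n})^{H_{1,n}}$ be given by $\delta_0(f)=f(0)$ for $f\in\mathcal{S}(\mathcal{N}_{1,n})$. Then the space of $P_{1,n}$-invariant distributions on $\mathcal{N}_{1,n}$ is spanned by $\delta_0$ and $\nu$. In particular, $$\mathcal{D}(\mathcal{N}_{1,n})^{P_{1,n}}=\mathcal{D}(\mathcal{N}_{1,n})^{H_{1,n}}.$$
   Context: $F$ is a non-archimedean local field of characteristic $0$. $H_{1,n}=\mathbf{GL}_1(F)\times\mathbf{GL}_{n-1}(F)<\mathbf{GL}_n(F)$ is the subgroup of block-diagonal matrices with blocks of sizes $1$ and $n-1$ (in this order). $\mathbf{P}_n(F)<\mathbf{GL}_n(F)$ is the mirabolic subgroup (matrices with bottom row $(0,\ldots,0,1)$), and $P_{1,n}=H_{1,n}\cap\mathbf{P}_n(F)$. $\mathcal{N}_{1,n}$ is the set of nilpotent $n\times n$ matrices of the form $\left(\begin{array}{cc}0&\overline{v}\\ \overline{w}&0\end{array}\right)$ with $\overline{v}\in\mathbf{M}_{1,n-1}(F)$, $\overline{w}\in\mathbf{M}_{n-1,1}(F)$; the groups act on it by conjugation. For a locally compact totally disconnected space $X$, $\mathcal{S}(X)$ is the space of locally constant compactly supported complex functions and $\mathcal{D}(X)$ its linear dual (distributions); a group $G$ acting continuously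 on $X$ acts on $\mathcal{S}(X)$ by $(g\cdot f)(x)=f(g^{-1}\cdot x)$, dually on $\mathcal{D}(X)$, and $\mathcal{D}(X)^G$ denotes the invariants. The support of a distribution is the complement of the union of all open sets on which it restricts to zero. *)

theory Defs
  imports "HOL-Analysis.Analysis"
begin

section \<open>Non-archimedean local fields of characteristic zero\<close>

text \<open>
  A field of characteristic \<open>0\<close> that is locally compact for the topology of a nontrivial
  non-archimedean absolute value. The absolute value is definite because it is tied to the
  metric by \<open>dist_absv\<close>; completeness and finiteness of the residue field follow from local
  compactness.
\<close>

class nonarch_local_field = field_char_0 + metric_space +
  fixes absv :: "'a \<Rightarrow> real"
  assumes dist_absv: "dist x y = absv (x - y)"
    and absv_mult: "absv (x * y) = absv x * absv y"
    and absv_add_le_max: "absv (x + y) \<le> max (absv x) (absv y)"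
    and absv_nontrivial: "\<exists>x. x \<noteq> 0 \<and> absv x \<noteq> 1"
    and locally_compact_UNIV: "\<exists>U K. open U \<and> compact K \<and> x \<in> U \<and> U \<subseteq> K"


section \<open>Distributions on a subset of a topological space\<close>

text \<open>
  \<open>X\<close> always carries the subspace topology. A complex function on \<open>X\<close> is represented by its
  extension by zero, so that for \<open>U\<close> open in \<open>X\<close> the inclusion of \<open>schwartz U\<close> in
  \<open>schwartz X\<close> is the usual extension by zero.
\<close>

definition locally_constant_on :: "'x::topological_space set \<Rightarrow> ('x \<Rightarrow> 'y) \<Rightarrow> bool" where
  "locally_constant_on X f \<longleftrightarrow>
     (\<forall>x\<in>X. \<exists>U. openin (top_of_set X) U \<and> x \<in> U \<and> (\<forall>y\<in>U. f y = f x))"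

definition schwartz :: "'x::topological_space set \<Rightarrow> ('x \<Rightarrow> complex) set" where
  "schwartz X = {f. (\<forall>x. x \<notin> X \<longrightarrow> f x = 0) \<and> locally_constant_on X f \<and>
     compact (top_of_set X closure_of {x \<in> X. f x \<noteq> 0})}"

text \<open>
  Linear functionals on \<open>schwartz X\<close>. They are given the value \<open>0\<close> outside
  \<open>schwartz X\<close>, so that equality of HOL functions is equality of distributions.
\<close>

definition distributions :: "'x::topological_space set \<Rightarrow> (('x \<Rightarrow> complex) \<Rightarrow> complex) set" where
  "distributions X = {T.
     (\<forall>f\<in>schwartz X. \<forall>g\<in>schwartz X. T (\<lambda>x. f x + g x) = T f + T g) \<and>
     (\<forall>c. \<forall>f\<in>schwartz X. T (\<lambda>x. c * f x) = c * T f) \<and>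
     (\<forall>f. f \<notin> schwartz X \<longrightarrow> T f = 0)}"

definition dist_support ::
    "'x::topological_space set \<Rightarrow> (('x \<Rightarrow> complex) \<Rightarrow> complex) \<Rightarrow> 'x set" where
  "dist_support X T =
     X - \<Union>{U. openin (top_of_set X) U \<and> (\<forall>f\<in>schwartz U. T f = 0)}"

definition delta_dist ::
    "'x::topological_space set \<Rightarrow> 'x \<Rightarrow> ('x \<Rightarrow> complex) \<Rightarrow> complex" where
  "delta_dist X x0 = (\<lambda>f. if f \<in> schwartz X then f x0 else 0)"


section \<open>The conjugation action\<close>

definition conj_mat :: "'f::field^'n^'n \<Rightarrow> 'f^'n^'n \<Rightarrow> 'f^'n^'n" where
  "conj_mat g x = g ** x ** matrix_inv g"

text \<open>\<open>(g \<cdot> f)(x) = f(g\<inverse> \<cdot> x)\<close>, and dually \<open>(g \<cdot> T)(f) = T(g\<inverse> \<cdot> f)\<close>.\<close>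

definition act_fun :: "'f::field^'n^'n \<Rightarrow> ('f^'n^'n \<Rightarrow> complex) \<Rightarrow> ('f^'n^'n \<Rightarrow> complex)" where
  "act_fun g f = (\<lambda>x. f (conj_mat (matrix_inv g) x))"

definition act_dist ::
    "'f::field^'n^'n \<Rightarrow> (('f^'n^'n \<Rightarrow> complex) \<Rightarrow> complex) \<Rightarrow> (('f^'n^'n \<Rightarrow> complex) \<Rightarrow> complex)" where
  "act_dist g T = (\<lambda>f. T (act_fun (matrix_inv g) f))"

definition invariant_distributions ::
    "('f::{field,topological_space}^'n^'n) set \<Rightarrow> ('f^'n^'n) set \<Rightarrow>
     (('f^'n^'n \<Rightarrow> complex) \<Rightarrow> complex) set" where
  "invariant_distributions G X = {T \<in> distributions X. \<forall>g\<in>G. act_dist g T = T}"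


section \<open>The groups and the nilpotent cone\<close>

text \<open>
  The index set \<open>{1,\<dots>,n}\<close> is a finite linearly ordered type of cardinality \<open>n\<close>; its
  least and greatest elements play the roles of \<open>1\<close> and \<open>n\<close>.
\<close>

definition first_idx :: "'n::{finite,linorder}" where
  "first_idx = Min UNIV"

definition last_idx :: "'n::{finite,linorder}" where
  "last_idx = Max UNIV"

definition GL :: "('f::field^'n^'n) set" where
  "GL = {g. invertible g}"

definition H_1n :: "('f::field^'n::{finite,linorder}^'n::{finite,linorder}) set" where
  "H_1n = {g \<in> GL. \<forall>i j. (i = first_idx) \<noteq> (j = first_idx) \<longrightarrow> g $ i $ j = 0}"

definition mirabolic :: "('f::field^'n::{finite,linorder}^'n::{finite,linorder}) set" where
  "mirabolic = {g \<in> GL. \<forall>j. g $ last_idx $ j = (if j = last_idx then 1 else 0)}"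

definition P_1n :: "('f::field^'n::{finite,linorder}^'n::{finite,linorder}) set" where
  "P_1n = H_1n \<inter> mirabolic"

text \<open>
  The class operations \<open>*\<close> and \<open>^\<close> on vectors act entrywise, so powers of a matrix
  are iterates of \<open>**\<close>.
\<close>

definition nilpotent_mat :: "'f::field^'n^'n \<Rightarrow> bool" where
  "nilpotent_mat x \<longleftrightarrow> (\<exists>k. (((**) x) ^^ k) (mat 1) = 0)"

definition N_1n :: "('f::field^'n::{finite,linorder}^'n::{finite,linorder}) set" where
  "N_1n = {x. nilpotent_mat x \<and>
     (\<forall>i j. (i = first_idx) = (j = first_idx) \<longrightarrow> x $ i $ j = 0)}"

end

theory Submission
  imports Defs
begin

text \<open>
  Write an element of the cone as a row \<open>v\<close> and a column \<open>w\<close>; it is nilpotent iff \<open>v \<cdot> w = 0\<close>.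
  A distribution is treated as a finitely additive function on compact open subsets.

  Uniqueness uses only the diagonal matrices and the unipotents of \<open>P\<close> that translate the column by
  multiples of its last entry. Where the last entry of \<open>w\<close> is nonzero, the coordinates
  \<open>v\<^sub>i\<close>, \<open>w\<^sub>i / w\<^sub>n\<close>, \<open>w\<^sub>n\<close> make the cone a product; translations force a Haar measure in
  the \<open>w\<^sub>i / w\<^sub>n\<close>, and the torus then determines everything from the value on one compact open
  set. If that value is zero, the distribution lives on \<open>w\<^sub>n = 0\<close>. There the torus scales
  \<open>v\<^sub>n\<close> alone, so \<open>v\<^sub>n = 0\<close> on the support (the shells of a scaling invariant distribution on the
  line have mass zero); the unipotents move \<open>v\<^sub>n\<close> off zero unless \<open>v = 0\<close>; and finally each
  remaining \<open>w\<^sub>i\<close> is scaled alone. Only a multiple of \<open>\<delta>\<^sub>0\<close> is left.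

  For existence, let \<open>\<nu>\<close> be the limit of \<open>q\<^sup>j\<close> times Haar measure on pairs \<open>(v, w)\<close> restricted to
  \<open>\<bar>v \<cdot> w\<bar> \<le> \<bar>\<pi>\<bar>\<^sup>j\<close>. Away from the origin the sequence is eventually constant, and scaling by
  \<open>\<pi>\<close> gives a contracting recurrence at the origin because \<open>n \<ge> 3\<close>.
\<close>

section \<open>The absolute value and its discs\<close>

text \<open>The uniqueness half never computes a value of T; it only transports vanishing. If T
  kills \<open>test_cyl\<close>, then T is a multiple of the delta at 0. A distribution of full
  support cannot kill \<open>test_cyl\<close>, because such a multiple is supported at the origin;
  so some T - b \<nu> kills it, and this gives the span. The equality of the two invariant spaces
  mentions no \<nu>, so it depends on one existing.

  The obstacle to existence is the origin, where v . w is singular. Dilation by \<pi> multiplies the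
  form by \<pi>^2, which costs a factor q^2, and multiplies Haar measure by q^(-2(n-1)). The product
  q^(4-2n) is 1 for n = 2 and less than 1 from n = 3 on.

  Invariance of Haar measure under H is obtained without determinants. Precomposition with an
  automorphism multiplies the Haar functional by a positive factor, and this factor is
  multiplicative. It is 1 on generators of H: transposition exchanges the action of a diagonal
  matrix with that of its inverse, and the unipotent generators are conjugate to their own squares
  because 2 is invertible.\<close>

lemma absv_zero [simp]: "absv 0 = 0"
  by (metis dist_absv dist_self diff_self)

lemma absv_eq_0_iff [simp]: "absv x = 0 \<longleftrightarrow> x = 0"
  by (metis absv_zero dist_absv diff_zero dist_eq_0_iff)

lemma absv_nonneg [simp]: "0 \<le> absv x"
  by (metis dist_absv diff_zero zero_le_dist)

lemma absv_le_0_iff [simp]: "absv x \<le> 0 \<longleftrightarrow> x = 0"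
  by (metis absv_eq_0_iff absv_nonneg antisym order_refl)

lemma absv_pos_iff [simp]: "0 < absv x \<longleftrightarrow> x \<noteq> 0"
  by (metis absv_le_0_iff not_le)

lemma absv_pos: "x \<noteq> 0 \<Longrightarrow> 0 < absv x"
  by (meson absv_le_0_iff not_le)

lemma absv_one [simp]: "absv (1::'f::nonarch_local_field) = 1"
  using absv_mult[of "1::'f" 1] by (simp del: absv_mult)

lemma absv_minus [simp]: "absv (- x) = absv x"
  by (metis dist_absv dist_commute diff_zero diff_0)

lemma absv_minus_commute: "absv (x - y) = absv (y - x)"
  by (metis dist_absv dist_commute)

lemma absv_add_le: "absv x \<le> r \<Longrightarrow> absv y \<le> r \<Longrightarrow> absv (x + y) \<le> r"
  using absv_add_le_max[of x y] by linarith

lemma absv_diff_le: "absv x \<le> r \<Longrightarrow> absv y \<le> r \<Longrightarrow> absv (x - y) \<le> r"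
  using absv_add_le[of x r "- y"] by simp

lemma absv_trans: "absv (x - y) \<le> r \<Longrightarrow> absv (y - z) \<le> r \<Longrightarrow> absv (x - z) \<le> r"
  using absv_add_le[of "x - y" r "y - z"] by simp

text \<open>Ultrametric triangles are isosceles with the two longest sides equal. Openness of
  conditions on absolute values is always derived from this.\<close>

lemma absv_eqI: "absv (x - y) < absv y \<Longrightarrow> absv x = absv y"
  using absv_add_le_max[of "x - y" y] absv_add_le_max[of x "y - x"] absv_minus_commute[of x y]
  by (auto simp: max_def split: if_splits)

lemma absv_sum_le: "(\<And>i. i \<in> A \<Longrightarrow> absv (g i) \<le> r) \<Longrightarrow> 0 \<le> r \<Longrightarrow> absv (\<Sum>i\<in>A. g i) \<le> r"
  by (induction A rule: infinite_finite_induct) (auto intro: absv_add_le)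

lemma absv_inverse: "absv (inverse x) = inverse (absv x)"
proof (cases "x = 0")
  case False
  then have "absv x * absv (inverse x) = 1" by (metis absv_mult absv_one right_inverse)
  then show ?thesis by (metis inverse_unique)
qed simp

lemma absv_divide: "absv (x / y) = absv x / absv y"
  by (simp add: divide_inverse absv_mult absv_inverse)

lemma absv_power: "absv (x ^ k) = absv x ^ k"
  by (induction k) (auto simp: absv_mult)

lemma ex_absv_gt: "\<exists>x::'f::nonarch_local_field. R < absv x"
proof -
  obtain a :: 'f where a: "1 < absv a"
  proof -
    obtain x :: 'f where "x \<noteq> 0" "absv x \<noteq> 1" using absv_nontrivial by blast
    then have "1 < absv x \<or> 1 < absv (inverse x)"
      by (auto simp: absv_inverse one_less_inverse_iff)
    then show ?thesis using that by blast
  qed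
  then obtain k where "R < absv a ^ k" using real_arch_pow by blast
  then show ?thesis by (metis absv_power)
qed

lemma ex_absv_lt:
  assumes "0 < r" shows "\<exists>x::'f::nonarch_local_field. x \<noteq> 0 \<and> absv x < r"
proof -
  obtain x :: 'f where x: "inverse r < absv x" using ex_absv_gt by blast
  then have "0 < absv x" using assms by (meson inverse_positive_iff_positive less_trans)
  then show ?thesis using x assms
    by (intro exI[of _ "inverse x"]) (auto simp: absv_divide inverse_eq_divide field_simps)
qed

lemma continuous_on_absv_comp:
  fixes f :: "'x::topological_space \<Rightarrow> 'f::nonarch_local_field"
  assumes "continuous_on S f"
  shows "continuous_on S (\<lambda>x. absv (f x))"
  using continuous_on_dist[OF assms continuous_on_const[of S 0]] by (simp add: dist_absv)

text \<open>Local compactness yields one compact ball about 0. Multiplication by a scalar of large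
  absolute value is continuous and stretches that ball over any given one.\<close>

lemma compact_cball_nonarch: "compact (cball (0::'f::nonarch_local_field) R)"
proof -
  obtain U K :: "'f set" where UK: "open U" "compact K" "0 \<in> U" "U \<subseteq> K"
    using locally_compact_UNIV[of "0::'f"] by blast
  obtain e where e: "e > 0" "cball 0 e \<subseteq> U" using UK open_contains_cball by blast
  then have c: "compact (cball (0::'f) e)"
    using compact_Int_closed[OF UK(2) closed_cball[of 0 e]] UK(4) by (metis inf.absorb2 subset_trans)
  obtain a :: 'f where a: "max 1 (\<bar>R\<bar> / e) < absv a" using ex_absv_gt by blast
  then have a1: "1 < absv a" "\<bar>R\<bar> / e < absv a" by auto
  then have a0: "a \<noteq> 0" "0 < absv a" by auto
  have "continuous_on UNIV ((*) a)"
    unfolding continuous_on_iff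
  proof (intro ballI allI impI)
    fix x :: 'f and d :: real assume "d > 0"
    then show "\<exists>\<delta>>0. \<forall>y\<in>UNIV. dist y x < \<delta> \<longrightarrow> dist (a * y) (a * x) < d"
      using a0 \<open>d > 0\<close>
      by (intro exI[of _ "d / absv a"])
         (simp add: dist_absv absv_mult right_diff_distrib[symmetric] pos_less_divide_eq mult.commute[of "absv a"])
  qed
  then have "compact ((*) a ` cball 0 e)"
    using c compact_continuous_image continuous_on_subset by blast
  moreover have "cball 0 R \<subseteq> (*) a ` cball (0::'f) e"
  proof
    fix x :: 'f assume "x \<in> cball 0 R"
    then have "absv x \<le> R" by (simp add: dist_absv)
    moreover have "R \<le> e * absv a" using a1(2) e by (simp add: field_simps)
    ultimately have "absv (x / a) \<le> e" using a0 by (simp add: absv_divide field_simps)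
    then show "x \<in> (*) a ` cball 0 e" using a0 by (intro image_eqI[of _ _ "x / a"]) (auto simp: dist_absv)
  qed
  ultimately show ?thesis by (metis closed_cball compact_Int_closed inf.absorb2)
qed

text \<open>Through the instance for vectors this makes closed bounded sets of matrices compact as
  well, on which \<open>finite_boxes\<close> and \<open>compact_N_1n_bounded\<close> rest.\<close>

instance nonarch_local_field \<subseteq> heine_borel
proof
  fix f :: "nat \<Rightarrow> 'a::nonarch_local_field"
  assume "bounded (range f)"
  then obtain R where "\<forall>x\<in>range f. dist 0 x \<le> R" unfolding bounded_any_center[where a=0] by blast
  then have "\<forall>n. f n \<in> cball 0 R" by auto
  then show "\<exists>l r. strict_mono (r::nat\<Rightarrow>nat) \<and> (f \<circ> r) \<longlonglongrightarrow> l"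
    using compact_cball_nonarch[of R, THEN compact_imp_seq_compact] unfolding seq_compact_def by meson
qed

section \<open>Discs, a uniformizer and the compact open subsets of the field\<close>

definition disc :: "'f::nonarch_local_field \<Rightarrow> real \<Rightarrow> 'f set" where
  "disc c r = {x. absv (x - c) \<le> r}"

text \<open>A uniformizer, characterised by having the largest absolute value below 1.\<close>

definition unif :: "'f::nonarch_local_field" where
  "unif = (SOME p. p \<noteq> 0 \<and> absv p < 1 \<and> (\<forall>x::'f. absv x < 1 \<longrightarrow> absv x \<le> absv p))"

text \<open>The open unit ball is the closed one minus the unit sphere, and the sphere is open. So
  the ball is compact and \<open>absv\<close> attains a maximum on it, which is where discreteness
  of the value group comes from.\<close>

lemma unif:
  shows unif_nonzero [simp]: "(unif::'f::nonarch_local_field) \<noteq> 0"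
    and absv_unif_less_1: "absv (unif::'f) < 1"
    and absv_le_unif: "absv (x::'f) < 1 \<Longrightarrow> absv x \<le> absv (unif::'f)"
proof -
  let ?B = "{x::'f. absv x < 1}"
  have open': "open {x::'f. absv x = 1}"
    unfolding open_dist
  proof (intro ballI exI[of _ 1] conjI allI impI)
    fix x y :: 'f assume "x \<in> {x. absv x = 1}" "dist y x < 1"
    then show "y \<in> {x. absv x = 1}" using absv_eqI[of y x] by (simp add: dist_absv)
  qed simp
  have "?B = cball 0 1 - {x. absv x = 1}" by (auto simp: dist_absv)
  then have "compact ?B" using compact_diff[OF compact_cball_nonarch open'] by metis
  moreover have "?B \<noteq> {}" by (metis (mono_tags, lifting) absv_zero empty_iff mem_Collect_eq zero_less_one)
  moreover have "continuous_on ?B absv" using continuous_on_absv_comp[of ?B "\<lambda>x. x"] by simp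
  ultimately obtain p where p: "p \<in> ?B" "\<forall>x\<in>?B. absv x \<le> absv p"
    using continuous_attains_sup by blast
  obtain y :: 'f where y: "y \<noteq> 0" "absv y < 1" using ex_absv_lt[of 1] by auto
  then have "absv y \<le> absv p" using p(2) by simp
  then have "p \<noteq> 0" using y(1) by auto
  then have "\<exists>p::'f. p \<noteq> 0 \<and> absv p < 1 \<and> (\<forall>x::'f. absv x < 1 \<longrightarrow> absv x \<le> absv p)" using p by auto
  from someI_ex[OF this]
  show "(unif::'f) \<noteq> 0" "absv (unif::'f) < 1" "absv (x::'f) < 1 \<Longrightarrow> absv x \<le> absv (unif::'f)"
    unfolding unif_def by auto
qed

text \<open>These are the compact open subsets of the field, described by one radius that works at
  all points at once.\<close>

definition good_set :: "'f::nonarch_local_field set \<Rightarrow> bool" where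
  "good_set A \<longleftrightarrow> (\<exists>r>0. \<forall>x\<in>A. disc x r \<subseteq> A) \<and> (\<exists>R. A \<subseteq> disc 0 R)"

lemma disc_self [simp]: "0 \<le> r \<Longrightarrow> x \<in> disc x r"
  by (simp add: disc_def)

text \<open>Every point of an ultrametric ball is a centre of it, so two discs of equal radius
  coincide or are disjoint.\<close>

lemma disc_eq: "x \<in> disc c r \<Longrightarrow> disc x r = disc c r"
  unfolding disc_def using absv_trans[of _ x r c] absv_trans[of _ c r x] absv_minus_commute[of x c]
  by auto

lemma good_disc: "0 < r \<Longrightarrow> good_set (disc c r)"
  unfolding good_set_def
proof (intro conjI)
  assume "0 < r"
  show "\<exists>r'>0. \<forall>x\<in>disc c r. disc x r' \<subseteq> disc c r"
    using disc_eq \<open>0 < r\<close> by (intro exI[of _ r]) blast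
next
  show "\<exists>R. disc c r \<subseteq> disc 0 R"
    unfolding disc_def using absv_add_le[of "_ - c" "max r (absv c)" c]
    by (intro exI[of _ "max r (absv c)"]) auto
qed

lemma good_empty: "good_set {}"
  by (auto simp: good_set_def intro: exI[of _ 1])

lemma good_Un: assumes "good_set A" "good_set B" shows "good_set (A \<union> B)"
proof -
  obtain r s R S where h: "r > 0" "s > 0" "\<forall>x\<in>A. disc x r \<subseteq> A" "\<forall>x\<in>B. disc x s \<subseteq> B"
    "A \<subseteq> disc 0 R" "B \<subseteq> disc 0 S"
    using assms unfolding good_set_def by blast
  have "\<forall>x\<in>A\<union>B. disc x (min r s) \<subseteq> A \<union> B" using h(3,4) unfolding disc_def by fastforce
  moreover have "A \<union> B \<subseteq> disc 0 (max R S)" using h(5,6) unfolding disc_def by fastforce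
  ultimately show ?thesis using h(1,2) unfolding good_set_def by (metis min_less_iff_conj)
qed

lemma good_shell:
  fixes z :: "'f::nonarch_local_field"
  assumes "z \<noteq> 0" shows "good_set {x::'f. absv x = absv z}"
  unfolding good_set_def
proof (intro conjI)
  show "\<exists>R. {x::'f. absv x = absv z} \<subseteq> disc 0 R" by (auto simp: disc_def)
  show "\<exists>r>0. \<forall>x\<in>{x::'f. absv x = absv z}. disc x r \<subseteq> {x. absv x = absv z}"
  proof (intro exI[of _ "absv z / 2"] conjI ballI subsetI)
    fix x y :: 'f assume "x \<in> {x. absv x = absv z}" "y \<in> disc x (absv z / 2)"
    moreover have "0 < absv z" using assms by (rule absv_pos)
    ultimately have "absv (y - x) < absv x" by (simp add: disc_def del: absv_pos_iff)
    then show "y \<in> {x. absv x = absv z}"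
      using absv_eqI[of y x] \<open>x \<in> {x. absv x = absv z}\<close> by simp
  qed (use assms in auto)
qed

text \<open>Total boundedness gives a finite net of spacing r; a disc of radius r equals the disc
  about any net point that it contains.\<close>

lemma finite_discs:
  fixes A :: "'f::nonarch_local_field set"
  assumes "A \<subseteq> disc 0 R" "0 < r"
  shows "finite ((\<lambda>x. disc x r) ` A)"
proof -
  have "compact (disc (0::'f) R)"
    using compact_cball_nonarch[of R] by (simp add: disc_def cball_def dist_absv)
  then have "\<forall>e>0. \<exists>k. finite k \<and> k \<subseteq> disc (0::'f) R \<and> disc 0 R \<subseteq> (\<Union>x\<in>k. ball x e)"
    by (intro seq_compact_imp_totally_bounded compact_imp_seq_compact)
  then obtain k where k: "finite k" "disc (0::'f) R \<subseteq> (\<Union>x\<in>k. ball x r)"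
    using assms(2) by meson
  have "(\<lambda>x. disc x r) ` A \<subseteq> (\<lambda>x. disc x r) ` k"
  proof
    fix D assume "D \<in> (\<lambda>x. disc x r) ` A"
    then obtain a where a: "a \<in> A" "D = disc a r" by blast
    then obtain x where "x \<in> k" "a \<in> ball x r" using k(2) assms(1) by blast
    then have "x \<in> k" "a \<in> disc x r" by (auto simp: disc_def dist_absv absv_minus_commute)
    then show "D \<in> (\<lambda>x. disc x r) ` k" using a disc_eq[of a x r] by auto
  qed
  then show ?thesis using k(1) finite_subset by blast
qed

section \<open>Finitely additive functions of compact open subsets of the line\<close>

lemma finite_additive_discs:
  fixes D :: "'f::nonarch_local_field set \<Rightarrow> complex"
  assumes add: "\<And>A B. good_set A \<Longrightarrow> good_set B \<Longrightarrow> A \<subseteq> S \<Longrightarrow> B \<subseteq> S \<Longrightarrow> A \<inter> B = {} \<Longrightarrow> D (A \<union> B) = D A + D B"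
    and fin: "finite \<C>" and C: "\<And>C. C \<in> \<C> \<Longrightarrow> good_set C \<and> C \<subseteq> S" and dj: "pairwise disjnt \<C>"
  shows "D (\<Union>\<C>) = (\<Sum>C\<in>\<C>. D C) \<and> good_set (\<Union>\<C>)"
  using fin C dj
proof (induction \<C>)
  case empty
  have "D {} + D {} = D {}" using add[of "{}" "{}"] good_empty by simp
  then show ?case using good_empty by simp
next
  case (insert C \<C>)
  then have IH: "D (\<Union>\<C>) = (\<Sum>C\<in>\<C>. D C)" "good_set (\<Union>\<C>)" by (auto simp: pairwise_insert)
  have "C \<inter> \<Union>\<C> = {}" using insert.prems(2) insert.hyps(2) unfolding pairwise_insert disjnt_def by blast
  moreover have "\<Union>\<C> \<subseteq> S" using insert.prems(1) by blast
  ultimately show ?case using add[of C "\<Union>\<C>"] IH insert by (auto simp: good_Un)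
qed

lemma pairwise_disjnt_discs: "pairwise disjnt ((\<lambda>x. disc x r) ` A)"
  unfolding pairwise_def disjnt_iff using disc_eq by blast

text \<open>Multiplication by units permutes the finitely many discs of radius r in the shell
  transitively, so all of them have the same value, and the number of discs times this value is the
  value of the shell.\<close>

lemma vanishes_on_disc_of_shell:
  fixes D :: "'f::nonarch_local_field set \<Rightarrow> complex" and z :: 'f
  assumes add: "\<And>A B. good_set A \<Longrightarrow> good_set B \<Longrightarrow> A \<subseteq> {x. absv x = absv z} \<Longrightarrow> B \<subseteq> {x. absv x = absv z} \<Longrightarrow>
      A \<inter> B = {} \<Longrightarrow> D (A \<union> B) = D A + D B"
    and unit: "\<And>u c r. absv u = 1 \<Longrightarrow> absv c = absv z \<Longrightarrow> 0 < r \<Longrightarrow> r < absv z \<Longrightarrow> D (disc (u * c) r) = D (disc c r)"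
    and shell: "D {x. absv x = absv z} = 0" and r: "0 < r" "r < absv z"
  shows "D (disc z r) = 0"
proof -
  let ?S = "{x::'f. absv x = absv z}"
  let ?C = "(\<lambda>x. disc x r) ` ?S"
  have z: "z \<noteq> 0" using r by auto
  have sub: "disc x r \<subseteq> ?S" if "x \<in> ?S" for x
  proof
    fix y assume "y \<in> disc x r"
    then have "absv (y - x) < absv x" using that r by (simp add: disc_def)
    then show "y \<in> ?S" using absv_eqI[of y x] that by simp
  qed
  have fin: "finite ?C" using r by (intro finite_discs[of _ "absv z"]) (auto simp: disc_def)
  have un: "\<Union>?C = ?S"
  proof
    show "\<Union>?C \<subseteq> ?S" using sub by (intro UN_least)
    show "?S \<subseteq> \<Union>?C"
    proof
      fix x assume "x \<in> ?S"
      moreover have "x \<in> disc x r" using r by simp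
      ultimately show "x \<in> \<Union>?C" by (rule UN_I)
    qed
  qed
  have "D (\<Union>?C) = (\<Sum>C\<in>?C. D C)"
    using finite_additive_discs[where S="?S" and D=D and \<C>="?C", OF add fin _ pairwise_disjnt_discs]
      sub good_disc[OF r(1)] by blast
  also have "\<dots> = (\<Sum>C\<in>?C. D (disc z r))"
  proof (intro sum.cong refl)
    fix C assume "C \<in> ?C"
    then obtain x where x: "absv x = absv z" "C = disc x r" by blast
    then show "D C = D (disc z r)" using unit[of "x / z" z r] z r by (simp add: absv_divide)
  qed
  finally have "of_nat (card ?C) * D (disc z r) = 0" using un shell by simp
  moreover have "card ?C \<noteq> 0" using fin by auto
  ultimately show ?thesis by simp
qed

text \<open>A shell is the difference of two consecutive discs about 0, and scaling invariance gives
  these the same value k. So shells have value zero; all the mass k may sit at the point 0.\<close>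

lemma vanishes_on_disc:
  fixes D :: "'f::nonarch_local_field set \<Rightarrow> complex" and z :: 'f
  assumes add: "\<And>A B. good_set A \<Longrightarrow> good_set B \<Longrightarrow> A \<inter> B = {} \<Longrightarrow> D (A \<union> B) = D A + D B"
    and unit: "\<And>u c r. absv u = 1 \<Longrightarrow> 0 < r \<Longrightarrow> r < absv c \<Longrightarrow> D (disc (u * c) r) = D (disc c r)"
    and const: "\<And>a::'f. a \<noteq> 0 \<Longrightarrow> D (disc 0 (absv a)) = k" and r: "0 < r" "r < absv z"
  shows "D (disc z r) = 0"
proof (rule vanishes_on_disc_of_shell)
  have z: "z \<noteq> 0" using r by auto
  \<comment> \<open>No absolute value lies strictly between those of \<open>unif * z\<close> and
    \<open>z\<close>.\<close>
  have eq: "disc (0::'f) (absv z) = disc 0 (absv (unif * z)) \<union> {x. absv x = absv z}"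
  proof -
    have "absv x \<le> absv (unif * z)" if "absv x < absv z" for x :: 'f
      using that absv_le_unif[of "x / z"] absv_pos[OF z] by (simp add: absv_divide absv_mult field_simps)
    moreover have "absv (unif * z) \<le> absv z"
      using absv_unif_less_1[where 'f='f] by (simp add: absv_mult mult_left_le_one_le)
    ultimately show ?thesis unfolding disc_def
      by (intro set_eqI) (auto simp: less_le intro: order_trans)
  qed
  have dj: "disc (0::'f) (absv (unif * z)) \<inter> {x. absv x = absv z} = {}"
    using absv_unif_less_1[where 'f='f] z by (auto simp: disc_def absv_mult)
  have "D (disc 0 (absv z)) = D (disc 0 (absv (unif * z))) + D {x. absv x = absv z}"
    unfolding eq by (rule add) (use dj good_shell[OF z] good_disc[of "absv (unif * z)" "0::'f"] z in auto)
  then show "D {x. absv x = absv z} = 0" using const[of z] const[of "unif * z"] z by simp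
qed (use assms in auto)

section \<open>The nilpotent cone and its test functions\<close>

type_synonym ('f, 'n) sqm = "(('f, 'n) vec, 'n) vec"

definition pattern :: "('f::field, 'n::{finite,linorder}) sqm set" where
  "pattern = {x. \<forall>i j. (i = first_idx) = (j = first_idx) \<longrightarrow> x $ i $ j = 0}"

text \<open>The pairing v . w. Summing over every index is harmless because on
  \<open>pattern\<close> the summand at \<open>first_idx\<close> is zero.\<close>

definition pair_form :: "('f::field, 'n::{finite,linorder}) sqm \<Rightarrow> 'f" where
  "pair_form x = (\<Sum>j\<in>UNIV. x $ first_idx $ j * x $ j $ first_idx)"

definition entries_le :: "real \<Rightarrow> 'f::nonarch_local_field^'n^'n \<Rightarrow> bool" where
  "entries_le r x \<longleftrightarrow> (\<forall>i j. absv (x $ i $ j) \<le> r)"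

definition mat_box :: "'f::nonarch_local_field^'n^'n \<Rightarrow> real \<Rightarrow> ('f^'n^'n) set" where
  "mat_box x r = {y. entries_le r (y - x)}"

lemma matrix_mult_nth: "((A::'f::field^'n^'n) ** B) $ i $ j = (\<Sum>k\<in>UNIV. A $ i $ k * B $ k $ j)"
  by (simp add: matrix_matrix_mult_def)

text \<open>The square of x is block diagonal with blocks v . w and the rank one matrix w v; one
  more factor x turns either block into the scalar v . w times x.\<close>

lemma pattern_cube:
  fixes x :: "('f::field, 'n::{finite,linorder}) sqm"
  assumes x: "x \<in> pattern"
  shows "x ** (x ** x) = (\<chi> i j. pair_form x * x $ i $ j)"
proof -
  have z: "x $ i $ j = 0" if "(i = first_idx) = (j = first_idx)" for i j
    using x that by (auto simp: pattern_def)
  have sq1: "(x ** x) $ first_idx $ j = (if j = first_idx then pair_form x else 0)" for j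
  proof (cases "j = first_idx")
    case False
    have "x $ first_idx $ k * x $ k $ j = 0" for k
      using z[of k j] z[of first_idx k] False by auto
    then show ?thesis using False by (simp only: matrix_mult_nth) simp
  qed (simp add: matrix_mult_nth pair_form_def)
  have sq2: "(x ** x) $ i $ j = x $ i $ first_idx * x $ first_idx $ j" if "i \<noteq> first_idx" for i j
  proof -
    have "(\<Sum>k\<in>UNIV. x $ i $ k * x $ k $ j) = (\<Sum>k\<in>{first_idx}. x $ i $ k * x $ k $ j)"
      using z[of i] that by (intro sum.mono_neutral_right) auto
    then show ?thesis by (simp add: matrix_mult_nth)
  qed
  have "(x ** (x ** x)) $ i $ j = pair_form x * x $ i $ j" for i j
  proof (cases "i = first_idx")
    case True
    have "x $ first_idx $ k * (x ** x) $ k $ j = x $ first_idx $ k * x $ k $ first_idx * x $ first_idx $ j" for k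
      using z[of first_idx first_idx] sq2[of k j] by (cases "k = first_idx") auto
    then have "(\<Sum>k\<in>UNIV. x $ first_idx $ k * (x ** x) $ k $ j) = pair_form x * x $ first_idx $ j"
      unfolding pair_form_def sum_distrib_right by (intro sum.cong refl)
    then show ?thesis using True by (simp only: matrix_mult_nth[of x "x ** x"])
  next
    case False
    have "(x ** (x ** x)) $ i $ j = (\<Sum>k\<in>{first_idx}. x $ i $ k * (x ** x) $ k $ j)"
      unfolding matrix_mult_nth[of x "x ** x"]
      using z[of i] False by (intro sum.mono_neutral_right) auto
    then show ?thesis using z[of i j] False by (auto simp: sq1)
  qed
  then show ?thesis by (simp add: vec_eq_iff)
qed

text \<open>Odd powers are x^(2k+1) = (v . w)^k x. If such a power is zero, then v . w = 0 or x = 0,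
  and the second case implies the first. Conversely v . w = 0 gives x^3 = 0.\<close>

lemma N_1n_eq: "(N_1n :: ('f::field, 'n::{finite,linorder}) sqm set) =
    {x \<in> pattern. pair_form x = 0}"
proof -
  have "nilpotent_mat x \<longleftrightarrow> pair_form x = 0" if x: "x \<in> pattern"
    for x :: "('f, 'n) sqm"
  proof
    let ?p = "\<lambda>k. (((**) x) ^^ k) (mat 1)"
    assume "nilpotent_mat x"
    then obtain k where k: "?p k = 0" by (auto simp: nilpotent_mat_def)
    have "?p (k + i) = 0" for i
      by (induction i) (auto simp: k matrix_mult_nth vec_eq_iff)
    \<comment> \<open>The exponent is raised to the odd number 2k+1, for which \<open>eq\<close> has
      a closed form.\<close>
    from this[of "k + 1"] have p0: "?p (2 * k + 1) = 0" by (simp add: mult_2)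
    have eq: "?p (2 * j + 1) = (\<chi> i l. pair_form x ^ j * x $ i $ l)" for j
    proof (induction j)
      case 0
      then show ?case by (simp add: vec_eq_iff)
    next
      case (Suc j)
      have "?p (2 * Suc j + 1) = x ** (x ** (\<chi> i l. pair_form x ^ j * x $ i $ l))"
        using Suc by simp
      also have "\<dots> = (\<chi> i l. pair_form x ^ j * (x ** (x ** x)) $ i $ l)"
        by (simp add: vec_eq_iff matrix_mult_nth sum_distrib_left mult_ac)
      finally show ?case by (simp add: pattern_cube[OF x] mult_ac)
    qed
    have "(\<chi> i l. pair_form x ^ k * x $ i $ l) = 0" by (rule trans[OF sym[OF eq[of k]] p0])
    then have "pair_form x ^ k * x $ i $ l = 0" for i l by (simp only: vec_eq_iff vec_lambda_beta zero_index)
    then have "pair_form x ^ k = 0 \<or> (\<forall>i l. x $ i $ l = 0)" by auto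
    then show "pair_form x = 0" by (auto simp: pair_form_def)
  next
    assume "pair_form x = 0"
    then have "(((**) x) ^^ 3) (mat 1) = 0"
      by (simp add: numeral_3_eq_3 pattern_cube[OF x] vec_eq_iff)
    then show "nilpotent_mat x" unfolding nilpotent_mat_def by blast
  qed
  then show ?thesis by (auto simp: N_1n_def pattern_def)
qed

lemma zero_in_N_1n [simp]: "0 \<in> N_1n"
  by (simp add: N_1n_eq pattern_def pair_form_def)

lemma entries_le_mono: "entries_le r x \<Longrightarrow> r \<le> s \<Longrightarrow> entries_le s x"
  unfolding entries_le_def using order_trans by blast

lemma entries_le_add: "entries_le r x \<Longrightarrow> entries_le r y \<Longrightarrow> entries_le r (x + y)"
  by (simp add: entries_le_def absv_add_le)

lemma entries_le_minus [simp]: "entries_le r (- x) = entries_le r x"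
  by (simp add: entries_le_def)

lemma entries_le_diff: "entries_le r x \<Longrightarrow> entries_le r y \<Longrightarrow> entries_le r (x - y)"
  by (simp add: entries_le_def absv_diff_le)

lemma entries_le_zero [simp]: "0 \<le> r \<Longrightarrow> entries_le r 0"
  by (simp add: entries_le_def)

lemma entries_le_commute: "entries_le r (x - y) = entries_le r (y - x)"
  by (metis entries_le_minus minus_diff_eq)

lemma entries_le_ex: "\<exists>R>0. entries_le R x"
proof -
  let ?R = "1 + (\<Sum>i\<in>UNIV. \<Sum>j\<in>UNIV. absv (x $ i $ j))"
  have "absv (x $ i $ j) \<le> ?R" for i j
  proof -
    have "absv (x $ i $ j) \<le> (\<Sum>j\<in>UNIV. absv (x $ i $ j))" by (intro member_le_sum) auto
    also have "\<dots> \<le> (\<Sum>i\<in>UNIV. \<Sum>j\<in>UNIV. absv (x $ i $ j))"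
      by (intro member_le_sum[of i UNIV "\<lambda>i. \<Sum>j\<in>UNIV. absv (x $ i $ j)"]) (auto intro: sum_nonneg)
    finally show ?thesis by simp
  qed
  moreover have "0 < ?R" by (intro add_pos_nonneg sum_nonneg) auto
  ultimately show ?thesis unfolding entries_le_def by blast
qed

lemma mat_box_self [simp]: "0 \<le> r \<Longrightarrow> x \<in> mat_box x r"
  by (simp add: mat_box_def)

lemma mat_box_eq: "y \<in> mat_box x r \<Longrightarrow> mat_box y r = mat_box x r"
  unfolding mat_box_def using entries_le_add[of r "_ - y" "y - x"] entries_le_diff[of r "_ - x" "y - x"]
  by auto

lemma mat_box_class: "0 \<le> r \<Longrightarrow> {y \<in> A. mat_box y r = mat_box x r} = {y \<in> A. y \<in> mat_box x r}"
  using mat_box_eq mat_box_self by blast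

lemma dist_le_imp_entries_le:
  assumes "dist y x \<le> r" shows "entries_le r (y - x)"
  unfolding entries_le_def
proof (intro allI)
  fix i j
  have "absv ((y - x) $ i $ j) = dist (y $ i $ j) (x $ i $ j)" by (simp add: dist_absv)
  also have "\<dots> \<le> dist (y $ i) (x $ i)" by (rule dist_vec_nth_le)
  also have "\<dots> \<le> dist y x" by (rule dist_vec_nth_le)
  finally show "absv ((y - x) $ i $ j) \<le> r" using assms by simp
qed

text \<open>The metric on nested vectors is Euclidean and not ultrametric, so uniformity is
  expressed through entrywise bounds. Bounding each Euclidean norm by the sum of its terms shows
  that the two agree up to the square of the matrix size.\<close>

lemma entries_le_imp_dist_le:
  fixes x y :: "'f::nonarch_local_field^'n^'n"
  assumes "entries_le r (y - x)" shows "dist y x \<le> real (CARD('n) * CARD('n)) * r"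
proof -
  have "dist y x \<le> (\<Sum>i\<in>UNIV. dist (y $ i) (x $ i))"
    unfolding dist_vec_def[of y x] by (rule L2_set_le_sum) simp
  also have "\<dots> \<le> (\<Sum>i\<in>(UNIV::'n set). real CARD('n) * r)"
  proof (rule sum_mono)
    fix i
    have "dist (y $ i) (x $ i) \<le> (\<Sum>j\<in>UNIV. dist (y $ i $ j) (x $ i $ j))"
      unfolding dist_vec_def[of "y $ i" "x $ i"] by (rule L2_set_le_sum) simp
    also have "\<dots> \<le> (\<Sum>j\<in>(UNIV::'n set). r)"
      using assms by (intro sum_mono) (auto simp: entries_le_def dist_absv)
    finally show "dist (y $ i) (x $ i) \<le> real CARD('n) * r" by simp
  qed
  finally show ?thesis by (simp add: mult_ac)
qed

lemma bounded_iff_entries_le: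
  fixes S :: "('f::nonarch_local_field^'n^'n) set"
  shows "bounded S \<longleftrightarrow> (\<exists>R. \<forall>x\<in>S. entries_le R x)"
proof
  assume "bounded S"
  then obtain R where "\<forall>x\<in>S. dist 0 x \<le> R" unfolding bounded_any_center[where a=0] by blast
  then have "\<forall>x\<in>S. entries_le R x" using dist_le_imp_entries_le[of _ "0::'f^'n^'n" R] by (simp add: dist_commute)
  then show "\<exists>R. \<forall>x\<in>S. entries_le R x" by blast
next
  assume "\<exists>R. \<forall>x\<in>S. entries_le R x"
  then obtain R where "\<forall>x\<in>S. entries_le R x" by blast
  then have "\<forall>x\<in>S. dist 0 x \<le> real (CARD('n) * CARD('n)) * R"
    using entries_le_imp_dist_le[of R _ "0::'f^'n^'n"] by (simp add: dist_commute)
  then show "bounded S" unfolding bounded_any_center[where a=0] by blast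
qed

lemma finite_boxes:
  fixes S :: "('f::nonarch_local_field^'n^'n) set"
  assumes "\<And>x. x \<in> S \<Longrightarrow> entries_le R x" "0 < r"
  shows "finite ((\<lambda>x. mat_box x r) ` S)"
proof -
  have "bounded S" using assms(1) bounded_iff_entries_le by blast
  then have "compact (closure S)" by simp
  then have "\<forall>e>0. \<exists>k. finite k \<and> k \<subseteq> closure S \<and> closure S \<subseteq> (\<Union>x\<in>k. ball x e)"
    by (intro seq_compact_imp_totally_bounded compact_imp_seq_compact)
  then obtain k where k: "finite k" "closure S \<subseteq> (\<Union>x\<in>k. ball x r)"
    using assms(2) by meson
  have "(\<lambda>x. mat_box x r) ` S \<subseteq> (\<lambda>x. mat_box x r) ` k"
  proof
    fix D assume "D \<in> (\<lambda>x. mat_box x r) ` S"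
    then obtain a where a: "a \<in> S" "D = mat_box a r" by blast
    then obtain x where "x \<in> k" "a \<in> ball x r" using k(2) closure_subset by blast
    then have "x \<in> k" "a \<in> mat_box x r"
      using dist_le_imp_entries_le[of a x r] by (auto simp: mat_box_def dist_commute)
    then show "D \<in> (\<lambda>x. mat_box x r) ` k" using a mat_box_eq[of a x r] by auto
  qed
  then show ?thesis using k(1) finite_subset by blast
qed

text \<open>Bilinearity splits the difference into (v' - v) . w' + v . (w' - w), and each summand
  has size at most R r. The ultrametric inequality removes any factor from the number of
  summands.\<close>

lemma pair_form_diff:
  assumes "entries_le R x" "entries_le r (y - x)" "0 \<le> r" "r \<le> R"
  shows "absv (pair_form y - pair_form x) \<le> R * r"
proof -
  have y: "entries_le R y" using entries_le_add[OF entries_le_mono[OF assms(2,4)] assms(1)] by simp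
  have "pair_form y - pair_form x = (\<Sum>j\<in>UNIV. (y - x) $ first_idx $ j * y $ j $ first_idx +
      x $ first_idx $ j * (y - x) $ j $ first_idx)"
    by (simp add: pair_form_def sum_subtractf[symmetric] algebra_simps)
  also have "absv \<dots> \<le> R * r"
  proof (rule absv_sum_le)
    fix j
    have "absv ((y - x) $ first_idx $ j) * absv (y $ j $ first_idx) \<le> r * R"
      using assms y unfolding entries_le_def by (intro mult_mono) auto
    moreover have "absv (x $ first_idx $ j) * absv ((y - x) $ j $ first_idx) \<le> R * r"
      using assms unfolding entries_le_def by (intro mult_mono) auto
    ultimately show "absv ((y - x) $ first_idx $ j * y $ j $ first_idx +
      x $ first_idx $ j * (y - x) $ j $ first_idx) \<le> R * r"
      by (intro absv_add_le) (simp_all add: absv_mult mult.commute)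
  qed (use assms in auto)
  finally show ?thesis .
qed

lemma closed_N_1n:
  "closed (N_1n :: ('f::nonarch_local_field, 'n::{finite,linorder}) sqm set)"
  unfolding closed_def open_dist
proof (intro ballI)
  fix x :: "('f, 'n) sqm" assume "x \<in> - N_1n"
  then consider (a) i j where "(i = first_idx) = (j = first_idx)" "x $ i $ j \<noteq> 0"
    | (b) "pair_form x \<noteq> 0"
    by (auto simp: N_1n_eq pattern_def)
  then show "\<exists>e>0. \<forall>y. dist y x < e \<longrightarrow> y \<in> - N_1n"
  proof cases
    case a
    have "y \<notin> N_1n" if "dist y x < absv (x $ i $ j)" for y
    proof -
      have "absv (y $ i $ j - x $ i $ j) \<le> dist y x"
        using dist_le_imp_entries_le[OF order_refl, of y x] by (simp add: entries_le_def)
      then have "absv (y $ i $ j) = absv (x $ i $ j)" using that by (intro absv_eqI) simp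
      then have "y $ i $ j \<noteq> 0" using a(2) by (metis absv_eq_0_iff)
      then show ?thesis using a(1) unfolding N_1n_eq pattern_def by blast
    qed
    then show ?thesis using absv_pos[OF a(2)] by blast
  next
    case b
    obtain R where R: "R > 0" "entries_le R x" using entries_le_ex by blast
    \<comment> \<open>With this e the product R e is at most half of the absolute value of
      \<open>pair_form x\<close>, so nearby points have a pairing of the same nonzero size.\<close>
    define e where "e = min R (absv (pair_form x) / (2 * R))"
    have p: "0 < absv (pair_form x)" by (rule absv_pos[OF b])
    have e0: "0 < e" "e \<le> R" "e \<le> absv (pair_form x) / (2 * R)"
      using R(1) p by (auto simp: e_def)
    have "R * e \<le> R * (absv (pair_form x) / (2 * R))" using e0(3) R(1) by (intro mult_left_mono) auto
    then have e: "0 < e" "e \<le> R" "R * e < absv (pair_form x)" using e0 R(1) p by (auto simp del: absv_pos_iff)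
    have "y \<notin> N_1n" if "dist y x < e" for y
    proof -
      have "absv (pair_form y - pair_form x) \<le> R * e"
        using that e R by (intro pair_form_diff dist_le_imp_entries_le) auto
      then have "absv (pair_form y) = absv (pair_form x)" using e by (intro absv_eqI) simp
      then show ?thesis using b by (auto simp: N_1n_eq)
    qed
    then show ?thesis using e by blast
  qed
qed

lemma compact_N_1n_bounded:
  "compact {x \<in> N_1n :: ('f::nonarch_local_field, 'n::{finite,linorder}) sqm set. entries_le R x}"
proof -
  let ?B = "{x :: ('f, 'n) sqm. entries_le R x}"
  have "closed ?B"
    unfolding entries_le_def
    by (intro closed_Collect_all closed_Collect_le continuous_on_absv_comp continuous_on_component
        continuous_on_id continuous_on_const)
  then have "compact ?B"
    unfolding compact_eq_bounded_closed bounded_iff_entries_le by blast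
  then have "compact (?B \<inter> N_1n)" by (rule compact_Int_closed[OF _ closed_N_1n])
  then show ?thesis by (simp add: Int_def conj_commute)
qed

text \<open>Compactness of the support turns local constancy into constancy at one scale r, by a
  Lebesgue number. In the other direction, bounded parts of the cone are compact because the cone is
  closed.\<close>

lemma schwartz_N_1n_iff:
  fixes f :: "('f::nonarch_local_field, 'n::{finite,linorder}) sqm \<Rightarrow> complex"
  shows "f \<in> schwartz N_1n \<longleftrightarrow> (\<forall>x. x \<notin> N_1n \<longrightarrow> f x = 0) \<and>
     (\<exists>r>0. \<forall>x\<in>N_1n. \<forall>y\<in>N_1n. entries_le r (y - x) \<longrightarrow> f y = f x) \<and>
     (\<exists>R. \<forall>x. f x \<noteq> 0 \<longrightarrow> entries_le R x)" (is "_ \<longleftrightarrow> ?A f \<and> ?B f \<and> ?C f")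
proof
  let ?N = "N_1n :: ('f, 'n) sqm set"
  assume f: "f \<in> schwartz N_1n"
  define K where "K = top_of_set ?N closure_of {x \<in> ?N. f x \<noteq> 0}"
  have a: "?A f" and lc: "locally_constant_on ?N f" and K: "compact K"
    using f by (auto simp: schwartz_def K_def)
  have KN: "K \<subseteq> ?N" unfolding K_def using closure_of_subset_topspace[of "top_of_set ?N"] by simp
  have sub: "{x \<in> ?N. f x \<noteq> 0} \<subseteq> K" unfolding K_def by (rule closure_of_subset) auto
  obtain R where R: "\<forall>x\<in>K. entries_le R x" using compact_imp_bounded[OF K] bounded_iff_entries_le by blast
  have c: "?C f" using R sub a by (intro exI[of _ R]) blast
  \<comment> \<open>The open sets on which f is constant along the cone; a Lebesgue number of this
    cover of K supplies the uniform scale.\<close>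
  define G where "G = {U. open U \<and> (\<exists>c. \<forall>y\<in>?N \<inter> U. f y = c)}"
  have "K \<subseteq> \<Union>G"
  proof
    fix x assume "x \<in> K"
    then obtain U where U: "openin (top_of_set ?N) U" "x \<in> U" "\<forall>y\<in>U. f y = f x"
      using lc KN unfolding locally_constant_on_def by blast
    then obtain O' where "open O'" "U = ?N \<inter> O'" by (auto simp: openin_open)
    then have "\<forall>y\<in>?N \<inter> O'. f y = f x" using U(3) by blast
    then have "O' \<in> G" unfolding G_def using \<open>open O'\<close> by blast
    moreover have "x \<in> O'" using U(2) \<open>U = ?N \<inter> O'\<close> by blast
    ultimately show "x \<in> \<Union>G" by blast
  qed
  then obtain e where e: "e > 0" "\<forall>x\<in>K. \<exists>U\<in>G. ball x e \<subseteq> U"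
    using Heine_Borel_lemma[OF K] by (metis (no_types, lifting) G_def mem_Collect_eq)
  \<comment> \<open>The denominator absorbs the factor of \<open>entries_le_imp_dist_le\<close>, and
    the 2 makes the inequality strict.\<close>
  define r where "r = e / (2 * real (CARD('n) * CARD('n)))"
  have n: "0 < real (CARD('n) * CARD('n))" by simp
  have r: "r > 0" using e n by (simp add: r_def)
  have near: "f y = f x" if near: "x \<in> K" "y \<in> ?N" "entries_le r (y - x)" for x y
  proof -
    obtain U where U: "U \<in> G" "ball x e \<subseteq> U" using e(2)[THEN bspec, OF near(1)] by (elim bexE)
    have "dist y x \<le> real (CARD('n) * CARD('n)) * r" by (rule entries_le_imp_dist_le[OF that(3)])
    also have "\<dots> < e" using e n by (simp add: r_def)
    finally have "y \<in> ball x e" by (simp add: dist_commute)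
    then have "y \<in> U" using U(2) by (rule subsetD[rotated])
    moreover have "x \<in> U" using U(2) e(1) by (rule subsetD[OF _ centre_in_ball[THEN iffD2]])
    moreover obtain c where "\<forall>y\<in>?N \<inter> U. f y = c" using U(1) unfolding G_def by (elim CollectE conjE exE)
    ultimately show ?thesis using that(2) subsetD[OF KN that(1)] by simp
  qed
  have "f y = f x" if xy: "x \<in> ?N" "y \<in> ?N" "entries_le r (y - x)" for x y
  proof (cases "f x = 0 \<and> f y = 0")
    case False
    then consider "x \<in> K" | "y \<in> K" using sub xy(1,2) by blast
    then show ?thesis
    proof cases
      case 1
      then show ?thesis using near xy(2,3) by blast
    next
      case 2
      moreover have "entries_le r (x - y)" using xy(3) entries_le_commute by blast
      ultimately have "f x = f y" using near xy(1) by blast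
      then show ?thesis by simp
    qed
  qed simp
  then show "?A f \<and> ?B f \<and> ?C f" using a c r by blast
next
  let ?N = "N_1n :: ('f, 'n) sqm set"
  assume h: "?A f \<and> ?B f \<and> ?C f"
  then obtain r R where r: "r > 0" "\<forall>x\<in>?N. \<forall>y\<in>?N. entries_le r (y - x) \<longrightarrow> f y = f x"
    and R: "\<forall>x. f x \<noteq> 0 \<longrightarrow> entries_le R x" by blast
  have "locally_constant_on ?N f"
    unfolding locally_constant_on_def
  proof
    fix x assume x: "x \<in> ?N"
    have "\<forall>y\<in>?N \<inter> ball x r. f y = f x"
    proof
      fix y assume y: "y \<in> ?N \<inter> ball x r"
      then have "entries_le r (y - x)" by (intro dist_le_imp_entries_le) (simp add: dist_commute)
      then show "f y = f x" using r(2) x y by blast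
    qed
    moreover have "openin (top_of_set ?N) (?N \<inter> ball x r)" "x \<in> ?N \<inter> ball x r" using x r(1) by auto
    ultimately show "\<exists>U. openin (top_of_set ?N) U \<and> x \<in> U \<and> (\<forall>y\<in>U. f y = f x)" by blast
  qed
  moreover have "compact (top_of_set ?N closure_of {x \<in> ?N. f x \<noteq> 0})"
  proof -
    let ?C = "{x \<in> ?N. entries_le R x}"
    have c: "compact ?C" by (rule compact_N_1n_bounded)
    have "?C \<subseteq> ?N" by (rule Collect_restrict)
    then have "closedin (top_of_set ?N) ?C" by (rule closed_subset[OF _ compact_imp_closed[OF c]])
    moreover have "{x \<in> ?N. f x \<noteq> 0} \<subseteq> ?C" using R by blast
    ultimately have "top_of_set ?N closure_of {x \<in> ?N. f x \<noteq> 0} \<subseteq> ?C"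
      by (intro closure_of_minimal)
    moreover have "closed (top_of_set ?N closure_of {x \<in> ?N. f x \<noteq> 0})"
      using closedin_closed_trans[OF closedin_closure_of closed_N_1n] .
    ultimately show ?thesis using compact_Int_closed[OF c] inf.absorb2 by fastforce
  qed
  ultimately show "f \<in> schwartz N_1n" using h unfolding schwartz_def by blast
qed

lemma schwartz_N_1nI:
  fixes f :: "('f::nonarch_local_field, 'n::{finite,linorder}) sqm \<Rightarrow> complex"
  assumes "\<And>x. x \<notin> N_1n \<Longrightarrow> f x = 0" "r > 0"
    "\<And>x y. x \<in> N_1n \<Longrightarrow> y \<in> N_1n \<Longrightarrow> entries_le r (y - x) \<Longrightarrow> f y = f x"
    "\<And>x. f x \<noteq> 0 \<Longrightarrow> entries_le R x"
  shows "f \<in> schwartz N_1n"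
  unfolding schwartz_N_1n_iff
proof (intro conjI)
  show "\<exists>r>0. \<forall>x\<in>N_1n. \<forall>y\<in>N_1n. entries_le r (y - x) \<longrightarrow> f y = f x"
    by (intro exI[of _ r] conjI ballI impI) (rule assms; assumption)+
  show "\<exists>R. \<forall>x. f x \<noteq> 0 \<longrightarrow> entries_le R x"
    by (intro exI[of _ R] allI impI) (rule assms)
  show "\<forall>x. x \<notin> N_1n \<longrightarrow> f x = 0"
    by (intro allI impI) (rule assms)
qed

lemma schwartz_N_1nE:
  fixes f :: "('f::nonarch_local_field, 'n::{finite,linorder}) sqm \<Rightarrow> complex"
  assumes "f \<in> schwartz N_1n"
  obtains r R where "r > 0" "\<forall>x\<in>N_1n. \<forall>y\<in>N_1n. entries_le r (y - x) \<longrightarrow> f y = f x"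
    "\<forall>x. f x \<noteq> 0 \<longrightarrow> entries_le R x"
  using assms unfolding schwartz_N_1n_iff by (elim exE conjE)

lemma schwartz_N_1n_nonzero: "f \<in> schwartz N_1n \<Longrightarrow> f x \<noteq> 0 \<Longrightarrow> x \<in> N_1n"
  by (auto simp: schwartz_def)

section \<open>Compact open subsets of the cone, and distributions as additive functions of
  them\<close>

definition ind :: "'x set \<Rightarrow> 'x \<Rightarrow> complex" where
  "ind S x = (if x \<in> S then 1 else 0)"

text \<open>The analogue of \<open>good_set\<close> on the cone: its compact open subsets, with a
  uniform radius.\<close>

definition nice :: "('f::nonarch_local_field, 'n::{finite,linorder}) sqm set \<Rightarrow> bool" where
  "nice S \<longleftrightarrow> S \<subseteq> N_1n \<and> (\<exists>r>0. \<forall>x\<in>S. \<forall>y\<in>N_1n. entries_le r (y - x) \<longrightarrow> y \<in> S) \<and>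
     (\<exists>R. \<forall>x\<in>S. entries_le R x)"

lemma niceI:
  assumes "\<And>x. x \<in> S \<Longrightarrow> x \<in> N_1n" "r > 0" "\<And>x y. x \<in> S \<Longrightarrow> y \<in> N_1n \<Longrightarrow> entries_le r (y - x) \<Longrightarrow> y \<in> S"
    "\<And>x. x \<in> S \<Longrightarrow> entries_le R x"
  shows "nice S"
  unfolding nice_def
proof (intro conjI)
  show "\<exists>r>0. \<forall>x\<in>S. \<forall>y\<in>N_1n. entries_le r (y - x) \<longrightarrow> y \<in> S"
    using assms(2,3) by (intro exI[of _ r]) simp
  show "\<exists>R. \<forall>x\<in>S. entries_le R x" using assms(4) by (intro exI[of _ R]) simp
qed (use assms(1) in \<open>simp add: subset_iff\<close>)

lemma niceE:
  assumes "nice S"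
  obtains r R where "S \<subseteq> N_1n" "r > 0" "\<forall>x\<in>S. \<forall>y\<in>N_1n. entries_le r (y - x) \<longrightarrow> y \<in> S"
    "\<forall>x\<in>S. entries_le R x"
  using assms unfolding nice_def by (elim exE conjE)

lemma ind_schwartz:
  fixes S :: "('f::nonarch_local_field, 'n::{finite,linorder}) sqm set"
  assumes "nice S" shows "ind S \<in> schwartz N_1n"
proof -
  obtain r R where h: "S \<subseteq> N_1n" "r > 0" "\<forall>x\<in>S. \<forall>y\<in>N_1n. entries_le r (y - x) \<longrightarrow> y \<in> S"
    "\<forall>x\<in>S. entries_le R x" using assms by (rule niceE)
  show ?thesis
  proof (rule schwartz_N_1nI[of _ r R])
    fix x y :: "('f, 'n) sqm" assume a: "x \<in> N_1n" "y \<in> N_1n" "entries_le r (y - x)"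
    then have "x \<in> S \<longleftrightarrow> y \<in> S" using h(3)[rule_format, of x y] h(3)[rule_format, of y x] entries_le_commute[of r x y] by auto
    then show "ind S y = ind S x" by (simp add: ind_def)
  qed (use h in \<open>auto simp: ind_def split: if_splits\<close>)
qed

lemma schwartz_cmult:
  fixes f :: "('f::nonarch_local_field, 'n::{finite,linorder}) sqm \<Rightarrow> complex"
  assumes "f \<in> schwartz N_1n" shows "(\<lambda>x. c * f x) \<in> schwartz N_1n"
proof -
  obtain r R where f: "r > 0" "\<forall>x\<in>N_1n. \<forall>y\<in>N_1n. entries_le r (y - x) \<longrightarrow> f y = f x"
    "\<forall>x. f x \<noteq> 0 \<longrightarrow> entries_le R x" using assms by (rule schwartz_N_1nE)
  show ?thesis
  proof (rule schwartz_N_1nI[of _ r R])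
    fix x y :: "('f, 'n) sqm"
    assume "x \<in> N_1n" "y \<in> N_1n" "entries_le r (y - x)"
    then show "c * f y = c * f x" using f(2)[rule_format, of x y] by simp
  qed (use f(1,3) schwartz_N_1n_nonzero[OF assms] in auto)
qed

lemma schwartz_add:
  fixes f g :: "('f::nonarch_local_field, 'n::{finite,linorder}) sqm \<Rightarrow> complex"
  assumes "f \<in> schwartz N_1n" "g \<in> schwartz N_1n"
  shows "(\<lambda>x. f x + g x) \<in> schwartz N_1n"
proof -
  obtain r R where f: "r > 0" "\<forall>x\<in>N_1n. \<forall>y\<in>N_1n. entries_le r (y - x) \<longrightarrow> f y = f x"
    "\<forall>x. f x \<noteq> 0 \<longrightarrow> entries_le R x" using assms(1) by (rule schwartz_N_1nE)
  obtain s S where g: "s > 0" "\<forall>x\<in>N_1n. \<forall>y\<in>N_1n. entries_le s (y - x) \<longrightarrow> g y = g x"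
    "\<forall>x. g x \<noteq> 0 \<longrightarrow> entries_le S x" using assms(2) by (rule schwartz_N_1nE)
  show ?thesis
  proof (rule schwartz_N_1nI[of _ "min r s" "max R S"])
    fix x y :: "('f, 'n) sqm"
    assume a: "x \<in> N_1n" "y \<in> N_1n" "entries_le (min r s) (y - x)"
    show "f y + g y = f x + g x"
      using f(2)[rule_format, OF a(1,2)] g(2)[rule_format, OF a(1,2)]
        entries_le_mono[OF a(3), of r] entries_le_mono[OF a(3), of s] by simp
  next
    fix x :: "('f, 'n) sqm" assume "f x + g x \<noteq> 0"
    then have "f x \<noteq> 0 \<or> g x \<noteq> 0" by auto
    then show "entries_le (max R S) x"
      using entries_le_mono[OF f(3)[rule_format], of x "max R S"]
        entries_le_mono[OF g(3)[rule_format], of x "max R S"] by auto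
  next
    fix x :: "('f, 'n) sqm" assume "x \<notin> N_1n"
    then show "f x + g x = 0"
      using schwartz_N_1n_nonzero[OF assms(1), of x] schwartz_N_1n_nonzero[OF assms(2), of x]
      by (cases "f x = 0"; cases "g x = 0") auto
  qed (use f(1) g(1) in auto)
qed

lemma schwartz_zero: "(\<lambda>x. 0) \<in> schwartz
    (N_1n :: ('f::nonarch_local_field, 'n::{finite,linorder}) sqm set)"
  by (rule schwartz_N_1nI[of _ 1]) auto

lemma schwartz_sum:
  fixes f :: "'i \<Rightarrow> ('f::nonarch_local_field, 'n::{finite,linorder}) sqm \<Rightarrow> complex"
  assumes "\<And>i. i \<in> I \<Longrightarrow> f i \<in> schwartz N_1n"
  shows "(\<lambda>x. \<Sum>i\<in>I. f i x) \<in> schwartz N_1n"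
  using assms by (induction I rule: infinite_finite_induct) (auto intro: schwartz_add schwartz_zero)

context
  fixes T :: "(('f::nonarch_local_field, 'n::{finite,linorder}) sqm \<Rightarrow> complex) \<Rightarrow> complex"
  assumes T: "T \<in> distributions N_1n"
begin

lemma dist_add: "f \<in> schwartz N_1n \<Longrightarrow> g \<in> schwartz N_1n \<Longrightarrow> T (\<lambda>x. f x + g x) = T f + T g"
  using T by (simp add: distributions_def)

lemma dist_cmult: "f \<in> schwartz N_1n \<Longrightarrow> T (\<lambda>x. c * f x) = c * T f"
  using T by (simp add: distributions_def)

lemma dist_outside: "f \<notin> schwartz N_1n \<Longrightarrow> T f = 0"
  using T by (simp add: distributions_def)

lemma dist_zero: "T (\<lambda>x. 0) = 0"
  using dist_cmult[OF schwartz_zero, of 0] by simp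

lemma dist_sum:
  assumes "\<And>i. i \<in> I \<Longrightarrow> f i \<in> schwartz N_1n"
  shows "T (\<lambda>x. \<Sum>i\<in>I. f i x) = (\<Sum>i\<in>I. T (f i))"
  using assms
  by (induction I rule: infinite_finite_induct) (auto simp: dist_zero dist_add schwartz_sum)

lemma dist_ind_Un:
  assumes "nice A" "nice B" "A \<inter> B = {}"
  shows "T (ind (A \<union> B)) = T (ind A) + T (ind B)"
proof -
  have "ind (A \<union> B) = (\<lambda>x. ind A x + ind B x)" using assms(3) by (auto simp: ind_def fun_eq_iff)
  then show ?thesis using dist_add ind_schwartz assms by metis
qed

text \<open>f is a finite linear combination of indicators of fibres of \<kappa>: it is constant on
  them by \<open>const\<close>, and \<open>cls\<close> makes each fibre that meets the support a
  union of boxes, so finitely many occur. Leaving \<kappa> abstract lets the fibres be boxes in the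
  matrix entries or in other coordinates.\<close>

lemma dist_zero_by_classes:
  assumes f: "f \<in> schwartz N_1n" and \<rho>: "\<rho> > 0"
    and cls: "\<And>x y. f x \<noteq> 0 \<Longrightarrow> y \<in> N_1n \<Longrightarrow> entries_le \<rho> (y - x) \<Longrightarrow> \<kappa> y = \<kappa> x"
    and const: "\<And>x y. f x \<noteq> 0 \<Longrightarrow> y \<in> N_1n \<Longrightarrow> \<kappa> y = \<kappa> x \<Longrightarrow> f y = f x"
    and zero: "\<And>x. f x \<noteq> 0 \<Longrightarrow> x \<in> N_1n \<Longrightarrow> nice {y \<in> N_1n. \<kappa> y = \<kappa> x} \<Longrightarrow> T (ind {y \<in> N_1n. \<kappa> y = \<kappa> x}) = 0"
  shows "T f = 0"
proof -
  obtain r R where R: "\<forall>x. f x \<noteq> 0 \<longrightarrow> entries_le R x" using f by (rule schwartz_N_1nE)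
  have fN: "\<And>x. f x \<noteq> 0 \<Longrightarrow> x \<in> N_1n" using f by (rule schwartz_N_1n_nonzero)
  let ?S = "{x. f x \<noteq> 0}"
  let ?cl = "\<lambda>k. {y \<in> N_1n. \<kappa> y = k}"
  define rep where "rep k = (SOME x. x \<in> ?S \<and> \<kappa> x = k)" for k
  have rep: "rep k \<in> ?S \<and> \<kappa> (rep k) = k" if "k \<in> \<kappa> ` ?S" for k
    unfolding rep_def by (rule someI_ex) (use that in blast)
  \<comment> \<open>On the support \<kappa> factors through the box of radius \<rho>, and only
    finitely many boxes meet a bounded set.\<close>
  define g where "g B = \<kappa> (SOME x. x \<in> ?S \<and> mat_box x \<rho> = B)" for B
  have g: "\<kappa> x = g (mat_box x \<rho>)" if "x \<in> ?S" for x
  proof -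
    let ?y = "SOME y. y \<in> ?S \<and> mat_box y \<rho> = mat_box x \<rho>"
    have y: "?y \<in> ?S \<and> mat_box ?y \<rho> = mat_box x \<rho>" by (rule someI_ex) (use that in blast)
    then have "x \<in> mat_box ?y \<rho>" using mat_box_self[of \<rho> x] \<rho> by simp
    then show ?thesis using cls[of ?y x] y fN[of x] that by (simp add: g_def mat_box_def)
  qed
  have fin: "finite (\<kappa> ` ?S)"
  proof -
    have "\<kappa> ` ?S = g ` (\<lambda>x. mat_box x \<rho>) ` ?S" using g by (auto simp: image_image)
    then show ?thesis using finite_boxes[of ?S R \<rho>] R \<rho> by auto
  qed
  have nc: "nice (?cl k)" if k: "k \<in> \<kappa> ` ?S" for k
  proof -
    have sub: "?cl k \<subseteq> ?S" using const[of "rep k"] rep[OF k] by auto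
    show ?thesis
    proof (rule niceI[of _ \<rho> R])
      fix x y assume "x \<in> ?cl k" "y \<in> N_1n" "entries_le \<rho> (y - x)"
      then show "y \<in> ?cl k" using cls[of x y] sub by auto
    next
      fix x assume "x \<in> ?cl k"
      then show "entries_le R x" using R sub by auto
    qed (use \<rho> in auto)
  qed
  have "f x = (\<Sum>k\<in>\<kappa> ` ?S. f (rep k) * ind (?cl k) x)" for x
  proof (cases "x \<in> N_1n \<and> \<kappa> x \<in> \<kappa> ` ?S")
    case True
    have "(\<Sum>k\<in>\<kappa> ` ?S. f (rep k) * ind (?cl k) x) = (\<Sum>k\<in>{\<kappa> x}. f (rep k) * ind (?cl k) x)"
      using True fin by (intro sum.mono_neutral_right) (auto simp: ind_def)
    also have "\<dots> = f (rep (\<kappa> x))" using True by (simp add: ind_def)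
    also have "\<dots> = f x" using True rep[of "\<kappa> x"] const[of "rep (\<kappa> x)" x] by simp
    finally show ?thesis by simp
  next
    case False
    then have "f x = 0" using fN by blast
    moreover have "(\<Sum>k\<in>\<kappa> ` ?S. f (rep k) * ind (?cl k) x) = 0"
      using False by (intro sum.neutral) (auto simp: ind_def)
    ultimately show ?thesis by simp
  qed
  then have "T f = T (\<lambda>x. \<Sum>k\<in>\<kappa> ` ?S. f (rep k) * ind (?cl k) x)" by (metis (no_types, lifting) ext)
  also have "\<dots> = (\<Sum>k\<in>\<kappa> ` ?S. T (\<lambda>x. f (rep k) * ind (?cl k) x))"
    by (intro dist_sum schwartz_cmult ind_schwartz nc)
  also have "\<dots> = (\<Sum>k\<in>\<kappa> ` ?S. f (rep k) * T (ind (?cl k)))"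
    by (intro sum.cong refl dist_cmult ind_schwartz nc)
  also have "\<dots> = 0"
  proof (rule sum.neutral, rule ballI)
    fix k assume k: "k \<in> \<kappa> ` ?S"
    then have "T (ind (?cl k)) = 0" using zero[of "rep k"] rep[OF k] fN nc[OF k] by simp
    then show "f (rep k) * T (ind (?cl k)) = 0" by simp
  qed
  finally show ?thesis .
qed

text \<open>Boxes may be taken smaller than any prescribed \<delta>. On such a box an entry that is
  at least \<delta> in size at the centre keeps its absolute value.\<close>

lemma dist_zero_by_boxes:
  assumes f: "f \<in> schwartz N_1n" and \<delta>: "0 < \<delta>"
    and zero: "\<And>a x. a \<noteq> 0 \<Longrightarrow> absv (a::'f) < \<delta> \<Longrightarrow> f x \<noteq> 0 \<Longrightarrow>
      nice {y \<in> N_1n. y \<in> mat_box x (absv a)} \<Longrightarrow> T (ind {y \<in> N_1n. y \<in> mat_box x (absv a)}) = 0"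
  shows "T f = 0"
proof -
  obtain r R where f': "r > 0" "\<forall>x\<in>N_1n. \<forall>y\<in>N_1n. entries_le r (y - x) \<longrightarrow> f y = f x"
    "\<forall>x. f x \<noteq> 0 \<longrightarrow> entries_le R x" using f by (rule schwartz_N_1nE)
  have "min r \<delta> > 0" using f'(1) \<delta> by simp
  then obtain a :: 'f where a: "a \<noteq> 0" "absv a < min r \<delta>" using ex_absv_lt by blast
  then have a0: "0 < absv a" by simp
  show ?thesis
  proof (rule dist_zero_by_classes[OF f a0, of "\<lambda>x. mat_box x (absv a)"])
    fix x y assume "f x \<noteq> 0" "y \<in> N_1n" "entries_le (absv a) (y - x)"
    then show "mat_box y (absv a) = mat_box x (absv a)" by (intro mat_box_eq) (simp add: mat_box_def)
  next
    fix x y assume h: "f x \<noteq> 0" "y \<in> N_1n" "mat_box y (absv a) = mat_box x (absv a)"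
    have "y \<in> mat_box x (absv a)" using mat_box_self[of "absv a" y] h(3) by simp
    then have "entries_le (absv a) (y - x)" by (simp add: mat_box_def)
    then have "entries_le r (y - x)" by (rule entries_le_mono) (use a(2) in simp)
    then show "f y = f x" using f'(2) h schwartz_N_1n_nonzero[OF f] by blast
  next
    fix x assume "f x \<noteq> 0" "nice {y \<in> N_1n. mat_box y (absv a) = mat_box x (absv a)}"
    then show "T (ind {y \<in> N_1n. mat_box y (absv a) = mat_box x (absv a)}) = 0"
      using zero[of a x] a unfolding mat_box_class[OF absv_nonneg] by simp
  qed
qed

end

section \<open>The conjugation action on the cone\<close>

lemma matrix_diff_ldistrib: "(A::'f::field^'n^'n) ** (B - C) = A ** B - A ** C"
  by (simp add: vec_eq_iff matrix_mult_nth right_diff_distrib sum_subtractf)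

lemma matrix_diff_rdistrib: "((A::'f::field^'n^'n) - B) ** C = A ** C - B ** C"
  by (simp add: vec_eq_iff matrix_mult_nth left_diff_distrib sum_subtractf)

lemma matrix_add_rdistrib: "((A::'f::field^'n^'n) + B) ** C = A ** C + B ** C"
  by (simp add: vec_eq_iff matrix_mult_nth distrib_right sum.distrib)

lemma matrix_minus_left: "(- (A::'f::field^'n^'n)) ** B = - (A ** B)"
  by (simp add: vec_eq_iff matrix_mult_nth sum_negf)

lemma matrix_minus_right: "(A::'f::field^'n^'n) ** (- B) = - (A ** B)"
  by (simp add: vec_eq_iff matrix_mult_nth sum_negf)

lemma matrix_inv_mult:
  assumes "invertible (g::'f::field^'n^'n)"
  shows "g ** matrix_inv g = mat 1" "matrix_inv g ** g = mat 1"
proof -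
  obtain h where "g ** h = mat 1 \<and> h ** g = mat 1" using assms invertible_def by blast
  then have "g ** matrix_inv g = mat 1 \<and> matrix_inv g ** g = mat 1"
    unfolding matrix_inv_def by (rule someI)
  then show "g ** matrix_inv g = mat 1" "matrix_inv g ** g = mat 1" by auto
qed

lemma matrix_inv_eqI:
  assumes "(g::'f::field^'n^'n) ** h = mat 1" shows "invertible g" "matrix_inv g = h"
proof -
  have hg: "h ** g = mat 1" using assms matrix_left_right_inverse by blast
  then show inv: "invertible g" using assms invertible_def by blast
  have "matrix_inv g = matrix_inv g ** (g ** h)" by (simp add: assms)
  also have "\<dots> = h" by (simp add: matrix_mul_assoc matrix_inv_mult[OF inv])
  finally show "matrix_inv g = h" .
qed

lemma invertible_matrix_inv: "invertible (g::'f::field^'n^'n) \<Longrightarrow> invertible (matrix_inv g)"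
  using matrix_inv_eqI(1)[OF matrix_inv_mult(2)] .

lemma matrix_inv_inv: "invertible (g::'f::field^'n^'n) \<Longrightarrow> matrix_inv (matrix_inv g) = g"
  using matrix_inv_eqI(2)[OF matrix_inv_mult(2)] .

lemma conj_mat_mult:
  assumes g: "invertible (g::'f::field^'n^'n)" and h: "invertible h"
  shows "conj_mat (g ** h) x = conj_mat g (conj_mat h x)"
proof -
  have "(g ** h) ** (matrix_inv h ** matrix_inv g) = g ** (h ** matrix_inv h) ** matrix_inv g"
    by (simp only: matrix_mul_assoc)
  also have "\<dots> = mat 1" by (simp add: matrix_inv_mult[OF g] matrix_inv_mult[OF h])
  finally have "matrix_inv (g ** h) = matrix_inv h ** matrix_inv g" by (rule matrix_inv_eqI)
  then show ?thesis by (simp add: conj_mat_def matrix_mul_assoc)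
qed

lemma conj_mat_one [simp]: "conj_mat (mat 1) x = (x::'f::field^'n^'n)"
  using matrix_inv_eqI(2)[of "mat 1 :: 'f^'n^'n" "mat 1"] by (simp add: conj_mat_def)

lemma conj_mat_inv:
  assumes "invertible (g::'f::field^'n^'n)"
  shows "conj_mat (matrix_inv g) (conj_mat g x) = x" "conj_mat g (conj_mat (matrix_inv g) x) = x"
  using conj_mat_mult[of "matrix_inv g" g x] conj_mat_mult[of g "matrix_inv g" x] assms
  by (simp_all add: matrix_inv_mult invertible_matrix_inv)

lemma conj_mat_diff: "conj_mat g (x - y) = conj_mat g x - conj_mat g y"
  by (simp add: conj_mat_def matrix_diff_ldistrib matrix_diff_rdistrib)

lemma conj_mat_add: "conj_mat g (x + y) = conj_mat g x + conj_mat g y"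
  by (simp add: conj_mat_def matrix_add_ldistrib matrix_add_rdistrib)

lemma conj_mat_zero [simp]: "conj_mat g 0 = 0"
  by (simp add: conj_mat_def)

section \<open>Conjugation by diagonal and by unipotent matrices\<close>

definition diagm :: "('n \<Rightarrow> 'f::field) \<Rightarrow> 'f^'n^'n" where
  "diagm d = (\<chi> i j. if i = j then d i else 0)"

lemma diagm_mult_nth: "(diagm d ** (x::'f::field^'n^'n)) $ i $ j = d i * x $ i $ j"
  by (simp add: matrix_mult_nth diagm_def if_distrib[of "\<lambda>a. a * _"] cong: if_cong)

lemma mult_diagm_nth: "((x::'f::field^'n^'n) ** diagm d) $ i $ j = x $ i $ j * d j"
  by (simp add: matrix_mult_nth diagm_def if_distrib[of "(*) _"] cong: if_cong)

lemma
  assumes "\<And>i. d i \<noteq> (0::'f::field)"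
  shows invertible_diagm: "invertible (diagm d)"
    and matrix_inv_diagm: "matrix_inv (diagm d) = diagm (\<lambda>i. inverse (d i))"
    and conj_diagm_nth: "conj_mat (diagm d) x $ i $ j = d i * x $ i $ j / d j"
proof -
  have "diagm d ** diagm (\<lambda>i. inverse (d i)) = mat 1"
    by (simp add: vec_eq_iff diagm_mult_nth mat_def) (simp add: diagm_def assms)
  then show "invertible (diagm d)" and i: "matrix_inv (diagm d) = diagm (\<lambda>i. inverse (d i))"
    by (rule matrix_inv_eqI)+
  show "conj_mat (diagm d) x $ i $ j = d i * x $ i $ j / d j"
    by (simp add: conj_mat_def i mult_diagm_nth diagm_mult_nth divide_inverse)
qed

lemma unipotent_inverse:
  assumes "E ** E = (0::'f::field^'n^'n)"
  shows "(mat 1 + E) ** (mat 1 - E) = mat 1"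
  by (simp add: matrix_add_rdistrib matrix_diff_ldistrib assms)

lemma conj_unipotent:
  assumes "E ** E = (0::'f::field^'n^'n)"
  shows "conj_mat (mat 1 + E) x = x + E ** x - x ** E - E ** x ** E"
  using matrix_inv_eqI(2)[OF unipotent_inverse[OF assms]]
  by (simp add: conj_mat_def matrix_add_rdistrib matrix_diff_ldistrib)

lemma two_le_card_distinct_ends:
  assumes "CARD('n::{finite,linorder}) \<ge> 2" shows "first_idx \<noteq> (last_idx :: 'n)"
proof
  assume eq: "first_idx = (last_idx :: 'n)"
  have "x = last_idx" for x :: 'n
  proof (rule antisym)
    show "x \<le> last_idx" by (simp add: last_idx_def)
    show "last_idx \<le> x" unfolding eq[symmetric] by (simp add: first_idx_def)
  qed
  then have "(UNIV::'n set) = {last_idx}" by auto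
  then have "card (UNIV::'n set) = card {last_idx::'n}" by (rule arg_cong)
  then show False using assms by simp
qed

text \<open>The involution of the symmetric pair. Invertible matrices commuting with it form
  \<open>H_1n\<close> and matrices anticommuting with it form \<open>pattern\<close>, as 1 and -1
  differ. Stability under products, inverses and conjugation then becomes associativity.\<close>

definition sign_mat :: "('f::field, 'n::{finite,linorder}) sqm" where
  "sign_mat = diagm (\<lambda>i. if i = first_idx then - 1 else 1)"

lemma H_1n_iff_commute:
  "(g :: ('f::field_char_0, 'n::{finite,linorder}) sqm) \<in> H_1n \<longleftrightarrow>
     invertible g \<and> g ** sign_mat = sign_mat ** g"
proof -
  have "(g ** sign_mat = sign_mat ** g) \<longleftrightarrow> (\<forall>i j. (i = first_idx) \<noteq> (j = first_idx) \<longrightarrow> g $ i $ j = 0)"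
    unfolding vec_eq_iff sign_mat_def mult_diagm_nth diagm_mult_nth
    by (auto simp: equation_minus_iff minus_equation_iff)
  then show ?thesis by (auto simp: H_1n_def GL_def)
qed

lemma pattern_iff_anticommute:
  "(x :: ('f::field_char_0, 'n::{finite,linorder}) sqm) \<in> pattern \<longleftrightarrow>
     x ** sign_mat = - (sign_mat ** x)"
proof -
  have a: "a = - a \<longleftrightarrow> a = 0" for a :: 'f
    by (metis add_eq_0_iff add.inverse_neutral mult_2 mult_eq_0_iff zero_neq_numeral)
  show ?thesis
    unfolding pattern_def vec_eq_iff sign_mat_def uminus_vec_def mult_diagm_nth diagm_mult_nth
    using a by (auto simp: mult_diagm_nth diagm_mult_nth)
qed

lemma H_1n_invertible: "g \<in> H_1n \<Longrightarrow> invertible g"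
  by (simp add: H_1n_def GL_def)

lemma H_1n_inv:
  assumes "(g :: ('f::field_char_0, 'n::{finite,linorder}) sqm) \<in> H_1n"
  shows "matrix_inv g \<in> H_1n"
proof -
  let ?h = "matrix_inv g" and ?s = "sign_mat :: ('f, 'n) sqm"
  have g: "invertible g" "g ** ?s = ?s ** g" using assms H_1n_iff_commute by auto
  have "?h ** (g ** ?s) ** ?h = ?h ** (?s ** g) ** ?h" using g(2) by simp
  then have "(?h ** g) ** ?s ** ?h = ?h ** ?s ** (g ** ?h)" by (simp only: matrix_mul_assoc)
  then have "?s ** ?h = ?h ** ?s" by (simp add: matrix_inv_mult[OF g(1)])
  then show ?thesis using H_1n_iff_commute invertible_matrix_inv[OF g(1)] by metis
qed

lemma H_1n_mult:
  assumes "(g :: ('f::field_char_0, 'n::{finite,linorder}) sqm) \<in> H_1n" "h \<in> H_1n"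
  shows "g ** h \<in> H_1n"
  using assms unfolding H_1n_iff_commute
  by (auto simp: invertible_mult) (metis matrix_mul_assoc)

lemma conj_pattern:
  assumes g: "(g :: ('f::field_char_0, 'n::{finite,linorder}) sqm) \<in> H_1n" and x: "x \<in> pattern"
  shows "conj_mat g x \<in> pattern"
proof -
  let ?h = "matrix_inv g" and ?s = "sign_mat :: ('f, 'n) sqm"
  have gs: "g ** ?s = ?s ** g" and hs: "?h ** ?s = ?s ** ?h"
    using g H_1n_inv[OF g] H_1n_iff_commute by auto
  have xs: "x ** ?s = - (?s ** x)" using x pattern_iff_anticommute by blast
  have "conj_mat g x ** ?s = g ** x ** (?h ** ?s)" by (simp add: conj_mat_def matrix_mul_assoc)
  also have "\<dots> = g ** (x ** ?s) ** ?h" by (simp add: hs matrix_mul_assoc)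
  also have "\<dots> = - ((g ** ?s) ** x ** ?h)"
    by (simp add: xs matrix_minus_left matrix_minus_right matrix_mul_assoc)
  also have "\<dots> = - (?s ** conj_mat g x)" by (simp add: gs conj_mat_def matrix_mul_assoc)
  finally show ?thesis using pattern_iff_anticommute by blast
qed

lemma conj_pattern_iff:
  assumes "(g :: ('f::field_char_0, 'n::{finite,linorder}) sqm) \<in> H_1n"
  shows "conj_mat g x \<in> pattern \<longleftrightarrow> x \<in> pattern"
  using conj_pattern[OF assms, of x] conj_pattern[OF H_1n_inv[OF assms], of "conj_mat g x"]
    conj_mat_inv[OF H_1n_invertible[OF assms]] by auto

text \<open>The pairing is the corner entry of x x, at \<open>first_idx\<close> twice. Conjugation
  by a block diagonal g multiplies this entry by the corner entries of g and of its inverse, whose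
  product is 1.\<close>

lemma pair_form_conj:
  assumes g: "(g :: ('f::field_char_0, 'n::{finite,linorder}) sqm) \<in> H_1n"
  shows "pair_form (conj_mat g x) = pair_form x"
proof -
  let ?h = "matrix_inv g" and ?o = "first_idx :: 'n"
  have inv: "invertible g" by (rule H_1n_invertible[OF g])
  have g0: "g $ ?o $ k = 0" if "k \<noteq> ?o" for k using g that by (auto simp: H_1n_def)
  have h0: "?h $ k $ ?o = 0" if "k \<noteq> ?o" for k using H_1n_inv[OF g] that by (auto simp: H_1n_def)
  have pf: "pair_form y = (y ** y) $ ?o $ ?o" for y :: "('f, 'n) sqm"
    by (simp add: pair_form_def matrix_mult_nth)
  have gl: "(g ** y) $ ?o $ j = g $ ?o $ ?o * y $ ?o $ j" for y :: "('f, 'n) sqm" and j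
  proof -
    have "(g ** y) $ ?o $ j = (\<Sum>k\<in>{?o}. g $ ?o $ k * y $ k $ j)"
      unfolding matrix_mult_nth using g0 by (intro sum.mono_neutral_right) auto
    then show ?thesis by simp
  qed
  have hr: "(y ** ?h) $ i $ ?o = y $ i $ ?o * ?h $ ?o $ ?o" for y :: "('f, 'n) sqm" and i
  proof -
    have "(y ** ?h) $ i $ ?o = (\<Sum>k\<in>{?o}. y $ i $ k * ?h $ k $ ?o)"
      unfolding matrix_mult_nth using h0 by (intro sum.mono_neutral_right) auto
    then show ?thesis by simp
  qed
  have "conj_mat g x ** conj_mat g x = g ** x ** (?h ** g) ** x ** ?h"
    by (simp add: conj_mat_def matrix_mul_assoc)
  also have "\<dots> = (g ** (x ** x)) ** ?h" by (simp add: matrix_inv_mult[OF inv] matrix_mul_assoc)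
  finally have "pair_form (conj_mat g x) = g $ ?o $ ?o * pair_form x * ?h $ ?o $ ?o"
    by (simp add: pf hr gl)
  moreover have "g $ ?o $ ?o * ?h $ ?o $ ?o = 1"
    using gl[of ?h ?o] by (simp add: matrix_inv_mult[OF inv] mat_def)
  ultimately show ?thesis by (simp add: mult_ac)
qed

lemma conj_N_1n_iff:
  assumes "(g :: ('f::field_char_0, 'n::{finite,linorder}) sqm) \<in> H_1n"
  shows "conj_mat g x \<in> N_1n \<longleftrightarrow> x \<in> N_1n"
  by (simp add: N_1n_eq conj_pattern_iff[OF assms] pair_form_conj[OF assms])

lemma entries_le_mult:
  assumes "entries_le r x" "entries_le s y" "0 \<le> r" "0 \<le> s"
  shows "entries_le (r * s) (x ** y)"
  unfolding entries_le_def matrix_mult_nth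
  using assms by (intro allI absv_sum_le) (auto simp: absv_mult entries_le_def intro!: mult_mono)

lemma conj_mat_bound:
  obtains C where "C > 0" "\<forall>r x. 0 \<le> r \<longrightarrow> entries_le r x \<longrightarrow> entries_le (C * r) (conj_mat g x)"
proof -
  obtain A where A: "A > 0" "entries_le A g" using entries_le_ex by blast
  obtain B where B: "B > 0" "entries_le B (matrix_inv g)" using entries_le_ex by blast
  have "entries_le (A * B * r) (conj_mat g x)" if r: "0 \<le> r" "entries_le r x" for r x
  proof -
    have "entries_le (A * r * B) (conj_mat g x)"
      unfolding conj_mat_def using A B r by (intro entries_le_mult) auto
    then show ?thesis by (simp add: mult_ac)
  qed
  then show ?thesis using that[of "A * B"] A B by auto
qed

lemma schwartz_conj:
  fixes f :: "('f::nonarch_local_field, 'n::{finite,linorder}) sqm \<Rightarrow> complex"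
  assumes g: "g \<in> H_1n" and f: "f \<in> schwartz N_1n"
  shows "(\<lambda>x. f (conj_mat g x)) \<in> schwartz N_1n"
proof -
  obtain r R where f': "r > 0" "\<forall>x\<in>N_1n. \<forall>y\<in>N_1n. entries_le r (y - x) \<longrightarrow> f y = f x"
    "\<forall>x. f x \<noteq> 0 \<longrightarrow> entries_le R x" using f by (rule schwartz_N_1nE)
  obtain C where C: "C > 0" "\<forall>r x. 0 \<le> r \<longrightarrow> entries_le r x \<longrightarrow> entries_le (C * r) (conj_mat g x)"
    by (rule conj_mat_bound)
  obtain D where D: "D > 0" "\<forall>r x. 0 \<le> r \<longrightarrow> entries_le r x \<longrightarrow> entries_le (D * r) (conj_mat (matrix_inv g) x)"
    by (rule conj_mat_bound)
  show ?thesis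
  proof (rule schwartz_N_1nI[of _ "r / C" "D * max R 0"])
    fix x y :: "('f, 'n) sqm"
    assume a: "x \<in> N_1n" "y \<in> N_1n" "entries_le (r / C) (y - x)"
    have "0 \<le> r / C" using C(1) f'(1) by simp
    then have "entries_le (C * (r / C)) (conj_mat g (y - x))" using C(2) a(3) by blast
    then have "entries_le r (conj_mat g y - conj_mat g x)" using C(1) by (simp add: conj_mat_diff)
    then show "f (conj_mat g y) = f (conj_mat g x)"
      using f'(2) a(1,2) conj_N_1n_iff[OF g] by blast
  next
    fix x :: "('f, 'n) sqm" assume "f (conj_mat g x) \<noteq> 0"
    then have "entries_le R (conj_mat g x)" using f'(3) by blast
    then have "entries_le (max R 0) (conj_mat g x)" by (rule entries_le_mono) simp
    then have "entries_le (D * max R 0) (conj_mat (matrix_inv g) (conj_mat g x))" using D by simp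
    then show "entries_le (D * max R 0) x" by (simp add: conj_mat_inv[OF H_1n_invertible[OF g]])
  next
    fix x :: "('f, 'n) sqm" assume "x \<notin> N_1n"
    then show "f (conj_mat g x) = 0"
      using schwartz_N_1n_nonzero[OF f, of "conj_mat g x"] conj_N_1n_iff[OF g] by blast
  qed (use f'(1) C(1) in simp)
qed

text \<open>The inverses in \<open>act_dist\<close> and \<open>act_fun\<close> cancel, so invariance
  under g means invariance under precomposition with conjugation by g itself.\<close>

lemma invariant_distribution_conj:
  assumes T: "T \<in> invariant_distributions G N_1n" and g: "g \<in> G" "invertible g"
  shows "T (\<lambda>x. f (conj_mat g x)) = T f"
proof -
  have "act_dist g T = T" using T g by (simp add: invariant_distributions_def)
  then have "act_dist g T f = T f" by simp
  then show ?thesis by (simp add: act_dist_def act_fun_def matrix_inv_inv[OF g(2)])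
qed

lemma invariant_distribution_ind:
  fixes g :: "('f::nonarch_local_field, 'n::{finite,linorder}) sqm"
  assumes T: "T \<in> invariant_distributions G N_1n" and g: "g \<in> G" "g \<in> H_1n"
  shows "T (ind {x \<in> N_1n. conj_mat g x \<in> S}) = T (ind {x \<in> N_1n. x \<in> S})"
proof -
  have "ind {x \<in> N_1n. conj_mat g x \<in> S} = (\<lambda>x. ind {x \<in> N_1n. x \<in> S} (conj_mat g x))"
    using conj_N_1n_iff[OF g(2)] by (auto simp: ind_def fun_eq_iff)
  then show ?thesis using invariant_distribution_conj[OF T g(1) H_1n_invertible[OF g(2)]] by simp
qed

section \<open>Invariant distributions where the last coordinate is nonzero\<close>

lemma disc_eq_iff: "0 \<le> r \<Longrightarrow> disc x r = disc y r \<longleftrightarrow> x \<in> disc y r"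
  using disc_eq disc_self by blast

lemma disc_scale:
  fixes c :: "'f::nonarch_local_field"
  assumes "c \<noteq> 0" shows "{a. c * a \<in> disc x r} = disc (x / c) (r / absv c)"
proof (intro set_eqI)
  fix a
  have "absv (c * a - x) = absv c * absv (a - x / c)"
    using assms by (simp add: absv_mult[symmetric] right_diff_distrib)
  then show "a \<in> {a. c * a \<in> disc x r} \<longleftrightarrow> a \<in> disc (x / c) (r / absv c)"
    using absv_pos[OF assms] by (simp add: disc_def pos_le_divide_eq mult.commute del: absv_pos_iff)
qed

lemma disc_scale_div:
  fixes c :: "'f::nonarch_local_field"
  assumes "c \<noteq> 0" shows "{a. a / c \<in> disc x r} = disc (x * c) (r * absv c)"
proof -
  have "{a. inverse c * a \<in> disc x r} = disc (x / inverse c) (r / absv (inverse c))"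
    using assms by (intro disc_scale) simp
  then show ?thesis using assms by (simp add: absv_inverse divide_inverse mult.commute)
qed

text \<open>The larger disc is a disjoint union of finitely many translates of the smaller one, so
  their values differ by a positive integer factor. Vanishing does not depend on the radius.\<close>

lemma translation_invariant_zero_iff:
  fixes D :: "'f::nonarch_local_field set \<Rightarrow> complex"
  assumes add: "\<And>A B. good_set A \<Longrightarrow> good_set B \<Longrightarrow> A \<inter> B = {} \<Longrightarrow> D (A \<union> B) = D A + D B"
    and trans: "\<And>c r. 0 < r \<Longrightarrow> D (disc c r) = D (disc 0 r)"
    and "0 < r" "0 < s"
  shows "D (disc 0 r) = 0 \<longleftrightarrow> D (disc 0 s) = 0"
proof -
  have *: "D (disc 0 s) = 0 \<longleftrightarrow> D (disc 0 r) = 0" if r: "0 < r" "r \<le> s" for r s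
  proof -
    let ?C = "(\<lambda>x. disc x r) ` disc (0::'f) s"
    have fin: "finite ?C" using r by (intro finite_discs[of _ s]) auto
    have "disc x r \<subseteq> disc x s" for x :: 'f using r by (auto simp: disc_def)
    then have sub: "disc x r \<subseteq> disc 0 s" if "x \<in> disc 0 s" for x :: 'f
      using disc_eq[OF that] by blast
    have un: "\<Union>?C = disc 0 s"
    proof
      show "\<Union>?C \<subseteq> disc 0 s" using sub by (intro UN_least)
      show "disc 0 s \<subseteq> \<Union>?C"
      proof
        fix x :: 'f assume "x \<in> disc 0 s"
        moreover have "x \<in> disc x r" using r by simp
        ultimately show "x \<in> \<Union>?C" by (rule UN_I)
      qed
    qed
    have "D (\<Union>?C) = (\<Sum>C\<in>?C. D C)"
      using finite_additive_discs[where S=UNIV and D=D and \<C>="?C", OF add fin _ pairwise_disjnt_discs]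
        good_disc[OF r(1)] by blast
    also have "\<dots> = (\<Sum>C\<in>?C. D (disc 0 r))"
      by (intro sum.cong refl) (use trans[OF r(1)] in blast)
    finally have "D (disc 0 s) = of_nat (card ?C) * D (disc 0 r)" using un by simp
    moreover have "0 \<in> disc (0::'f) s" using r by (intro disc_self) simp
    then have "card ?C \<noteq> 0" using fin by auto
    ultimately show ?thesis by simp
  qed
  show ?thesis using *[of r s] *[of s r] assms(3,4) by linarith
qed

lemma good_family:
  fixes A :: "'i::finite \<Rightarrow> 'f::nonarch_local_field set"
  assumes "\<And>i. good_set (A i)"
  obtains \<rho> R where "\<rho> > 0" "\<forall>i. \<forall>x\<in>A i. disc x \<rho> \<subseteq> A i" "R \<ge> 1" "\<forall>i. A i \<subseteq> disc 0 R"
proof -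
  have "\<forall>i. \<exists>r. r > 0 \<and> (\<forall>x\<in>A i. disc x r \<subseteq> A i)" "\<forall>i. \<exists>R. A i \<subseteq> disc 0 R"
    using assms unfolding good_set_def by blast+
  then obtain r R where r: "\<forall>i. r i > 0 \<and> (\<forall>x\<in>A i. disc x (r i) \<subseteq> A i)" and R: "\<forall>i. A i \<subseteq> disc 0 (R i)"
    by metis
  let ?r = "Min (range r)" and ?R = "max 1 (Max (range R))"
  have "?r > 0" using r by simp
  moreover have "disc x ?r \<subseteq> A i" if "x \<in> A i" for i x
  proof -
    have "?r \<le> r i" by simp
    then have "disc x ?r \<subseteq> disc x (r i)" by (auto simp: disc_def)
    then show ?thesis using r that by blast
  qed
  moreover have "A i \<subseteq> disc 0 ?R" for i
  proof -
    have "R i \<le> ?R" by (simp add: le_max_iff_disj)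
    then have "disc 0 (R i) \<subseteq> disc (0::'f) ?R" by (auto simp: disc_def)
    then show ?thesis using R by blast
  qed
  ultimately show ?thesis using that[of ?r ?R] by simp
qed

text \<open>A product set in the coordinates v_i, w_i / w_n for i strictly between the two ends, and
  w_n. The entry v_n has no factor of its own: where w_n is nonzero, v . w = 0 determines
  it.\<close>

definition cyl :: "('n \<Rightarrow> 'f set) \<Rightarrow> ('n \<Rightarrow> 'f set) \<Rightarrow> 'f set \<Rightarrow>
    ('f::nonarch_local_field, 'n::{finite,linorder}) sqm set" where
  "cyl A B W = {x \<in> N_1n. (\<forall>i. i \<noteq> first_idx \<longrightarrow> i \<noteq> last_idx \<longrightarrow>
      x $ first_idx $ i \<in> A i \<and> x $ i $ first_idx / x $ last_idx $ first_idx \<in> B i) \<and>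
      x $ last_idx $ first_idx \<in> W}"

lemma cyl_cong:
  assumes "\<And>i. i \<noteq> first_idx \<Longrightarrow> i \<noteq> last_idx \<Longrightarrow> A i = A' i"
    "\<And>i. i \<noteq> first_idx \<Longrightarrow> i \<noteq> last_idx \<Longrightarrow> B i = B' i" "W = W'"
  shows "cyl A B W = cyl A' B' W'"
  using assms by (auto simp: cyl_def)

lemma N_1n_pattern: "x \<in> N_1n \<Longrightarrow> (i = first_idx) = (j = first_idx) \<Longrightarrow> x $ i $ j = 0"
  by (auto simp: N_1n_def)

text \<open>The equation v . w = 0 is solved for v_n after division by w_n.\<close>

lemma first_last_entry:
  fixes x :: "('f::nonarch_local_field, 'n::{finite,linorder}) sqm"
  assumes x: "x \<in> N_1n" and ne: "first_idx \<noteq> (last_idx::'n)" and z: "x $ last_idx $ first_idx \<noteq> 0"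
  shows "x $ first_idx $ last_idx =
    - (\<Sum>i\<in>UNIV - {first_idx, last_idx}. x $ first_idx $ i * (x $ i $ first_idx / x $ last_idx $ first_idx))"
proof -
  let ?J = "UNIV - {first_idx, last_idx} :: 'n set"
  have "pair_form x = (\<Sum>i\<in>insert first_idx (insert last_idx ?J). x $ first_idx $ i * x $ i $ first_idx)"
    unfolding pair_form_def by (intro sum.cong) auto
  also have "\<dots> = x $ first_idx $ last_idx * x $ last_idx $ first_idx + (\<Sum>i\<in>?J. x $ first_idx $ i * x $ i $ first_idx)"
    using ne N_1n_pattern[OF x, of first_idx first_idx] by simp
  finally have "x $ first_idx $ last_idx * x $ last_idx $ first_idx = - (\<Sum>i\<in>?J. x $ first_idx $ i * x $ i $ first_idx)"
    using x by (simp add: N_1n_eq eq_neg_iff_add_eq_0)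
  then have "x $ first_idx $ last_idx = - (\<Sum>i\<in>?J. x $ first_idx $ i * x $ i $ first_idx) / x $ last_idx $ first_idx"
    using z by (metis nonzero_mult_div_cancel_right)
  then show ?thesis by (simp add: sum_divide_distrib)
qed

text \<open>Write y/w - x/z as ((y - x) - (x/z)(w - z)) / w. The bound r < \<delta> forces w and z
  to have the same absolute value, at least \<delta>.\<close>

lemma absv_ratio_diff_le:
  fixes x y z w :: "'f::nonarch_local_field"
  assumes "absv (y - x) \<le> r" "absv (w - z) \<le> r" "\<delta> \<le> absv z" "r < \<delta>" "0 < \<delta>" "absv (x / z) \<le> R" "1 \<le> R" "0 \<le> r"
  shows "absv (y / w - x / z) \<le> R * r / \<delta>" "absv w = absv z"
proof -
  show wz: "absv w = absv z" using assms by (intro absv_eqI) linarith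
  have z: "z \<noteq> 0" "0 < absv z" using assms absv_pos by fastforce+
  then have w: "w \<noteq> 0" using wz by auto
  have "y / w - x / z = ((y - x) - x / z * (w - z)) / w"
    using z(1) w by (simp add: field_simps)
  then have "absv (y / w - x / z) = absv ((y - x) - x / z * (w - z)) / absv z" by (simp add: absv_divide wz)
  also have "absv ((y - x) - x / z * (w - z)) \<le> R * r"
  proof (rule absv_diff_le)
    show "absv (y - x) \<le> R * r"
      using assms(1) mult_right_mono[OF assms(7,8)] by simp
    show "absv (x / z * (w - z)) \<le> R * r"
      unfolding absv_mult using assms by (intro mult_mono) auto
  qed
  then have "absv ((y - x) - x / z * (w - z)) / absv z \<le> R * r / \<delta>"
    using assms z by (intro frac_le) auto
  finally show "absv (y / w - x / z) \<le> R * r / \<delta>" .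
qed

lemma nice_cyl:
  fixes A B :: "'n::{finite,linorder} \<Rightarrow> 'f::nonarch_local_field set"
  assumes ne: "first_idx \<noteq> (last_idx::'n)"
    and A: "\<And>i. good_set (A i)" and B: "\<And>i. good_set (B i)" and W: "good_set W"
    and \<delta>: "0 < \<delta>" "W \<subseteq> {y. \<delta> \<le> absv y}"
  shows "nice (cyl A B W)"
proof -
  obtain a RA where a: "a > 0" "\<forall>i. \<forall>x\<in>A i. disc x a \<subseteq> A i" "RA \<ge> 1" "\<forall>i. A i \<subseteq> disc 0 RA"
    using A by (rule good_family)
  obtain b RB where b: "b > 0" "\<forall>i. \<forall>x\<in>B i. disc x b \<subseteq> B i" "RB \<ge> 1" "\<forall>i. B i \<subseteq> disc 0 RB"
    using B by (rule good_family)
  obtain w RW' where w: "w > 0" "\<forall>x\<in>W. disc x w \<subseteq> W" "W \<subseteq> disc 0 RW'" using W unfolding good_set_def by blast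
  define RW where "RW = max 1 RW'"
  have RW: "RW \<ge> 1" "W \<subseteq> disc 0 RW" using w(3) by (auto simp: RW_def disc_def)
  \<comment> \<open>One bound for all entries: RA for the middle of the row, RB RW for the middle of
    the column, RW for w_n, and RA RB for v_n by \<open>first_last_entry\<close>. All three factors
    are at least 1.\<close>
  define R where "R = RA * RB * RW"
  have R: "RA \<le> R" "RB * RW \<le> R" "RA * RB \<le> R" "RW \<le> R" "0 \<le> R"
  proof -
    have p: "1 \<le> RA * RB" "1 \<le> RB * RW" "RA * RB \<ge> 0"
      using mult_mono[OF a(3) b(3)] mult_mono[OF b(3) RW(1)] a(3) b(3) RW(1) by auto
    show "RA \<le> R" using mult_left_mono[OF p(2), of RA] a(3) by (simp add: R_def mult_ac)
    show "RB * RW \<le> R" using mult_right_mono[OF a(3), of "RB * RW"] p by (simp add: R_def mult_ac)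
    show "RA * RB \<le> R" using mult_left_mono[OF RW(1) p(3)] by (simp add: R_def)
    show "RW \<le> R" using mult_right_mono[OF p(1), of RW] RW by (simp add: R_def)
    then show "0 \<le> R" using RW by simp
  qed
  \<comment> \<open>The four terms, in order, keep the absolute value of w_n, the row factors, the
    range W, and the quotient factors; the last uses the estimate RB r / \<delta> of
    \<open>absv_ratio_diff_le\<close>.\<close>
  define r where "r = Min {\<delta> / 2, a, w, b * \<delta> / RB}"
  have r: "r > 0" "r < \<delta>" "r \<le> a" "r \<le> w" "RB * r / \<delta> \<le> b"
  proof -
    have l: "r \<le> \<delta> / 2" "r \<le> a" "r \<le> w" "r \<le> b * \<delta> / RB" unfolding r_def by (intro Min_le; simp)+
    then show "r \<le> a" "r \<le> w" "r < \<delta>" using \<delta> by auto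
    show "r > 0" unfolding r_def using \<delta> a b w by simp
    have "RB * r \<le> b * \<delta>" using l(4) b(3) by (simp add: pos_le_divide_eq mult.commute)
    then show "RB * r / \<delta> \<le> b" using \<delta>(1) by (simp add: pos_divide_le_eq)
  qed
  show ?thesis
  proof (rule niceI[of _ r R])
    fix x y :: "('f,'n) sqm" assume x: "x \<in> cyl A B W" and y: "y \<in> N_1n" and xy: "entries_le r (y - x)"
    have d: "absv (y $ i $ j - x $ i $ j) \<le> r" for i j using xy by (simp add: entries_le_def)
    have z: "x $ last_idx $ first_idx \<in> W" using x by (simp add: cyl_def)
    have "y $ first_idx $ i \<in> A i \<and> y $ i $ first_idx / y $ last_idx $ first_idx \<in> B i"
      if i: "i \<noteq> first_idx" "i \<noteq> last_idx" for i :: 'n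
    proof
      have xi: "x $ first_idx $ i \<in> A i" "x $ i $ first_idx / x $ last_idx $ first_idx \<in> B i"
        using x i by (auto simp: cyl_def)
      have "y $ first_idx $ i \<in> disc (x $ first_idx $ i) a" using d[of first_idx i] r(3) by (simp add: disc_def)
      then show "y $ first_idx $ i \<in> A i" using a(2) xi(1) by blast
      have "absv (y $ i $ first_idx / y $ last_idx $ first_idx - x $ i $ first_idx / x $ last_idx $ first_idx) \<le> RB * r / \<delta>"
      proof (rule absv_ratio_diff_le(1))
        show "\<delta> \<le> absv (x $ last_idx $ first_idx)" using \<delta> z by blast
        have "x $ i $ first_idx / x $ last_idx $ first_idx \<in> disc 0 RB" using xi(2) b(4) by blast
        then show "absv (x $ i $ first_idx / x $ last_idx $ first_idx) \<le> RB" by (simp add: disc_def)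
      qed (use d r \<delta> b in auto)
      then have "y $ i $ first_idx / y $ last_idx $ first_idx \<in> disc (x $ i $ first_idx / x $ last_idx $ first_idx) b"
        using r(5) by (simp add: disc_def)
      then show "y $ i $ first_idx / y $ last_idx $ first_idx \<in> B i" using b(2) xi(2) by blast
    qed
    moreover have "y $ last_idx $ first_idx \<in> disc (x $ last_idx $ first_idx) w"
      using d[of last_idx first_idx] r(4) by (simp add: disc_def)
    then have "y $ last_idx $ first_idx \<in> W" using w(2) z by blast
    ultimately show "y \<in> cyl A B W" using y by (simp add: cyl_def)
  next
    fix x :: "('f,'n) sqm" assume x: "x \<in> cyl A B W"
    then have xN: "x \<in> N_1n" and z: "x $ last_idx $ first_idx \<in> W" by (auto simp: cyl_def)
    have zW: "absv (x $ last_idx $ first_idx) \<le> RW" "\<delta> \<le> absv (x $ last_idx $ first_idx)"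
      using z RW \<delta> by (auto simp: disc_def)
    then have z0: "x $ last_idx $ first_idx \<noteq> 0" using \<delta> by auto
    have v: "absv (x $ first_idx $ i) \<le> RA" and u: "absv (x $ i $ first_idx / x $ last_idx $ first_idx) \<le> RB"
      if "i \<noteq> first_idx" "i \<noteq> last_idx" for i :: 'n
    proof -
      have "x $ first_idx $ i \<in> disc 0 RA" "x $ i $ first_idx / x $ last_idx $ first_idx \<in> disc 0 RB"
        using x a(4) b(4) that unfolding cyl_def by blast+
      then show "absv (x $ first_idx $ i) \<le> RA" "absv (x $ i $ first_idx / x $ last_idx $ first_idx) \<le> RB"
        by (auto simp: disc_def)
    qed
    show "entries_le R x"
      unfolding entries_le_def
    proof (intro allI)
      fix i j :: 'n
      consider "(i = first_idx) = (j = first_idx)" | "i = first_idx" "j \<noteq> first_idx" "j \<noteq> last_idx"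
        | "i = first_idx" "j = last_idx" | "i = last_idx" "j = first_idx"
        | "i \<noteq> first_idx" "i \<noteq> last_idx" "j = first_idx" by blast
      then show "absv (x $ i $ j) \<le> R"
      proof cases
        case 1
        then show ?thesis using N_1n_pattern[OF xN] R by simp
      next
        case 2
        then show ?thesis using v[of j] R by simp
      next
        case 3
        have "absv (\<Sum>i\<in>UNIV - {first_idx, last_idx}. x $ first_idx $ i * (x $ i $ first_idx / x $ last_idx $ first_idx)) \<le> RA * RB"
        proof (rule absv_sum_le)
          fix i :: 'n assume "i \<in> UNIV - {first_idx, last_idx}"
          then show "absv (x $ first_idx $ i * (x $ i $ first_idx / x $ last_idx $ first_idx)) \<le> RA * RB"
            unfolding absv_mult using v[of i] u[of i] a(3) by (intro mult_mono) auto
        qed (use a b in auto)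
        then show ?thesis using 3 first_last_entry[OF xN ne z0] R by simp
      next
        case 4
        then show ?thesis using zW R by simp
      next
        case 5
        have "absv (x $ i $ first_idx / x $ last_idx $ first_idx) * absv (x $ last_idx $ first_idx) \<le> RB * RW"
          using u[of i] 5 zW b(3) by (intro mult_mono) auto
        then show ?thesis using 5 z0 R by (simp add: absv_mult[symmetric])
      qed
    qed
  qed (use r in \<open>auto simp: cyl_def\<close>)
qed

lemma diagm_in_P_1n:
  fixes d :: "'n::{finite,linorder} \<Rightarrow> 'f::field"
  assumes "\<And>i. d i \<noteq> 0" "d last_idx = 1"
  shows "diagm d \<in> P_1n"
  using invertible_diagm[of d] assms
  by (auto simp: P_1n_def H_1n_def GL_def mirabolic_def diagm_def)

lemma P_1n_subset_H_1n: "P_1n \<subseteq> H_1n"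
  by (simp add: P_1n_def)

text \<open>The compact open subsets of the punctured line, the ranges allowed for w_n.\<close>

definition ok_range :: "'f::nonarch_local_field set \<Rightarrow> bool" where
  "ok_range W \<longleftrightarrow> good_set W \<and> (\<exists>\<delta>>0. W \<subseteq> {y. \<delta> \<le> absv y})"

context
  fixes T :: "(('f::nonarch_local_field, 'n::{finite,linorder}) sqm \<Rightarrow> complex) \<Rightarrow> complex"
  assumes T: "T \<in> invariant_distributions P_1n N_1n" and ne: "first_idx \<noteq> (last_idx::'n)"
begin

lemma T_dist: "T \<in> distributions N_1n"
  using T by (simp add: invariant_distributions_def)

text \<open>Since the last diagonal entry is 1, \<open>diagm d\<close> multiplies v_i by d_1 / d_i,
  the quotient w_i / w_n by d_i, and w_n by 1 / d_1. The sets on the left are the preimages under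
  these scalings.\<close>

lemma cyl_torus:
  assumes d: "\<And>i. d i \<noteq> 0" "d last_idx = 1"
    and A: "\<And>i. i \<noteq> first_idx \<Longrightarrow> i \<noteq> last_idx \<Longrightarrow> A' i = {a. d first_idx * a / d i \<in> A i}"
    and B: "\<And>i. i \<noteq> first_idx \<Longrightarrow> i \<noteq> last_idx \<Longrightarrow> B' i = {u. d i * u \<in> B i}"
    and W: "W' = {z. z / d first_idx \<in> W}"
  shows "T (ind (cyl A' B' W')) = T (ind (cyl A B W))"
proof -
  have "cyl A' B' W' = {x \<in> N_1n. conj_mat (diagm d) x \<in> cyl A B W}"
    unfolding cyl_def
    using A B W d conj_N_1n_iff[OF subsetD[OF P_1n_subset_H_1n diagm_in_P_1n[of d]]]
    by (auto simp: conj_diagm_nth[of d])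
  moreover have "{x \<in> N_1n. x \<in> cyl A B W} = cyl A B W" by (auto simp: cyl_def)
  moreover have "diagm d \<in> P_1n" using d by (rule diagm_in_P_1n)
  ultimately show ?thesis
    using invariant_distribution_ind[OF T _ subsetD[OF P_1n_subset_H_1n], of "diagm d" "cyl A B W"] by simp
qed

text \<open>E carries b in its last column. The two vanishing conditions on b put 1 + E in
  \<open>P_1n\<close> and give E E = 0, so conjugation sends w to w + w_n b and changes only v_n in
  the row.\<close>

lemma unipotent_conj:
  assumes b: "b first_idx = 0" "b last_idx = 0"
  defines "E \<equiv> (\<chi> i j. if j = last_idx then b i else 0) :: ('f,'n) sqm"
  shows "mat 1 + E \<in> P_1n"
    and "conj_mat (mat 1 + E) x $ first_idx $ j =
      x $ first_idx $ j - (if j = last_idx then \<Sum>k\<in>UNIV. x $ first_idx $ k * b k else 0)"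
    and "conj_mat (mat 1 + E) x $ i $ first_idx = x $ i $ first_idx + b i * x $ last_idx $ first_idx"
proof -
  have E1: "(E ** y) $ i $ j = b i * y $ last_idx $ j" for y :: "('f,'n) sqm" and i j
    by (simp add: E_def matrix_mult_nth if_distrib[of "\<lambda>a. a * _"] cong: if_cong)
  have E2: "(y ** E) $ i $ j = (if j = last_idx then \<Sum>k\<in>UNIV. y $ i $ k * b k else 0)" for y :: "('f,'n) sqm" and i j
    by (simp add: E_def matrix_mult_nth)
  have "E ** E = 0" by (simp add: vec_eq_iff E1) (simp add: E_def b)
  note c = conj_unipotent[OF this, of x] and inv = matrix_inv_eqI(1)[OF unipotent_inverse[OF this]]
  show "mat 1 + E \<in> P_1n"
    using inv ne b by (auto simp: P_1n_def H_1n_def GL_def mirabolic_def mat_def E_def)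
  show "conj_mat (mat 1 + E) x $ first_idx $ j =
      x $ first_idx $ j - (if j = last_idx then \<Sum>k\<in>UNIV. x $ first_idx $ k * b k else 0)"
    by (simp add: c E1 E2 b)
  show "conj_mat (mat 1 + E) x $ i $ first_idx = x $ i $ first_idx + b i * x $ last_idx $ first_idx"
    using ne by (simp add: c E1 E2)
qed

text \<open>In cylinder coordinates the unipotent translates w_i / w_n by b_i and fixes w_n and the
  middle v_i. The range W excludes 0, so the convention for division by zero never matters.\<close>

lemma cyl_translate:
  assumes b: "b first_idx = 0" "b last_idx = 0" and W: "0 \<notin> W"
    and B: "\<And>i. i \<noteq> first_idx \<Longrightarrow> i \<noteq> last_idx \<Longrightarrow> B' i = {u. u + b i \<in> B i}"
  shows "T (ind (cyl A B' W)) = T (ind (cyl A B W))"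
proof -
  let ?g = "mat 1 + (\<chi> i j. if j = last_idx then b i else 0) :: ('f,'n) sqm"
  have g: "?g \<in> P_1n" "?g \<in> H_1n" using unipotent_conj(1)[of b, OF b] P_1n_subset_H_1n by auto
  have "x \<in> cyl A B' W \<longleftrightarrow> x \<in> N_1n \<and> conj_mat ?g x \<in> cyl A B W" for x
  proof (cases "x $ last_idx $ first_idx = 0")
    case True
    then show ?thesis using W by (simp add: cyl_def unipotent_conj(3)[of b, OF b])
  next
    case False
    then show ?thesis
      using B b by (auto simp: cyl_def unipotent_conj(2,3)[of b, OF b] conj_N_1n_iff[OF g(2)] add_divide_distrib)
  qed
  then have "cyl A B' W = {x \<in> N_1n. conj_mat ?g x \<in> cyl A B W}" by blast
  moreover have "{x \<in> N_1n. x \<in> cyl A B W} = cyl A B W" by (auto simp: cyl_def)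
  ultimately show ?thesis using invariant_distribution_ind[OF T g, of "cyl A B W"] by simp
qed

lemma cyl_additive:
  assumes A: "\<And>i. good_set (A i)" and B: "\<And>i. good_set (B i)" and W: "ok_range W"
    and V: "good_set V" "good_set V'" "V \<inter> V' = {}" and i: "i \<noteq> first_idx" "i \<noteq> last_idx"
  shows "T (ind (cyl (A(i := V \<union> V')) B W)) = T (ind (cyl (A(i := V)) B W)) + T (ind (cyl (A(i := V')) B W))"
    and "T (ind (cyl A (B(i := V \<union> V')) W)) = T (ind (cyl A (B(i := V)) W)) + T (ind (cyl A (B(i := V')) W))"
proof -
  obtain \<delta> where w: "good_set W" "\<delta> > 0" "W \<subseteq> {y. \<delta> \<le> absv y}" using W by (auto simp: ok_range_def)
  \<comment> \<open>Opening slot i to \<open>UNIV\<close> exhibits V as a plain intersection, so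
    unions and disjointness pass through.\<close>
  have slot: "cyl (A(i := V)) B W = cyl (A(i := UNIV)) B W \<inter> {x. x $ first_idx $ i \<in> V}"
    "cyl A (B(i := V)) W = cyl A (B(i := UNIV)) W \<inter> {x. x $ i $ first_idx / x $ last_idx $ first_idx \<in> V}" for V
    using i by (auto simp: cyl_def fun_upd_def)
  have un: "cyl (A(i := V \<union> V')) B W = cyl (A(i := V)) B W \<union> cyl (A(i := V')) B W"
    "cyl A (B(i := V \<union> V')) W = cyl A (B(i := V)) W \<union> cyl A (B(i := V')) W"
    unfolding slot[of "V \<union> V'"] slot[of V] slot[of V'] by blast+
  have dj: "cyl (A(i := V)) B W \<inter> cyl (A(i := V')) B W = {}" "cyl A (B(i := V)) W \<inter> cyl A (B(i := V')) W = {}"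
    unfolding slot[of V] slot[of V'] using V(3) by blast+
  show "T (ind (cyl (A(i := V \<union> V')) B W)) = T (ind (cyl (A(i := V)) B W)) + T (ind (cyl (A(i := V')) B W))"
    unfolding un using A B V w by (intro dist_ind_Un[OF T_dist] dj nice_cyl[OF ne _ _ w]) auto
  show "T (ind (cyl A (B(i := V \<union> V')) W)) = T (ind (cyl A (B(i := V)) W)) + T (ind (cyl A (B(i := V')) W))"
    unfolding un using A B V w by (intro dist_ind_Un[OF T_dist] dj nice_cyl[OF ne _ _ w]) auto
qed

lemma ok_range_disc: "0 < r \<Longrightarrow> r < absv c \<Longrightarrow> ok_range (disc c r)"
  unfolding ok_range_def
proof (intro conjI exI[of _ "absv c"] subsetI CollectI)
  fix x assume "0 < r" "r < absv c" "x \<in> disc c r"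
  then have "absv x = absv c" by (intro absv_eqI) (simp add: disc_def)
  then show "absv c \<le> absv x" by simp
qed (auto intro: good_disc)

abbreviation "O1 \<equiv> (\<lambda>_::'n. disc (0::'f) 1)"

text \<open>A diagonal entry b at position i divides v_i by b and multiplies w_i / w_n by b, so a
  row disc about 0 can be traded for a quotient disc about 0. Translation invariance makes vanishing
  of the latter independent of its radius. Hence all row discs about 0 have value zero, and
  \<open>vanishes_on_disc\<close> treats other centres. The induction frees one row slot at a
  time.\<close>

lemma cyl_zero_rows:
  assumes W: "ok_range W" and zero: "T (ind (cyl O1 O1 W)) = 0"
    and S: "finite S" "S \<subseteq> UNIV - {first_idx, last_idx}"
    and A: "\<forall>i\<in>S. \<exists>c (a::'f). a \<noteq> 0 \<and> A i = disc c (absv a)" "\<forall>i. i \<notin> S \<longrightarrow> A i = disc 0 1"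
  shows "T (ind (cyl A O1 W)) = 0"
  using S A
proof (induction S arbitrary: A)
  case empty
  then have "A = O1" by auto
  then show ?case using zero by simp
next
  case (insert i S)
  have i: "i \<noteq> first_idx" "i \<noteq> last_idx" using insert.prems by auto
  have goodA: "good_set (A k)" for k
    using insert.prems(2,3) good_disc by (metis absv_pos zero_less_one)
  have goodO: "good_set (O1 k)" for k by (simp add: good_disc)
  have W0: "0 \<notin> W" using W by (auto simp: ok_range_def)
  let ?A0 = "A(i := disc 0 1)"
  have goodA0: "good_set (?A0 k)" for k using goodA goodO by simp
  have IH: "T (ind (cyl ?A0 O1 W)) = 0"
    using insert.prems insert.hyps by (intro insert.IH) auto
  define D where "D V = T (ind (cyl (A(i := V)) O1 W))" for V
  \<comment> \<open>The trade: scaling the row disc in slot i by b appears as radius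
    \<open>absv b\<close> in the quotient slot i.\<close>
  have tor: "T (ind (cyl (A(i := disc (c * b) (r * absv b))) O1 W)) =
      T (ind (cyl (A(i := disc c r)) (O1(i := disc 0 (absv b))) W))" if b: "b \<noteq> 0" for b c r
  proof (rule cyl_torus[where d="\<lambda>k. if k = i then b else 1"])
    fix k :: 'n
    show "O1 k = {u. (if k = i then b else 1) * u \<in> (O1(i := disc 0 (absv b))) k}"
      using b disc_scale[OF b, of 0 "absv b"] by simp
    show "(A(i := disc (c * b) (r * absv b))) k =
      {a. (if first_idx = i then b else 1) * a / (if k = i then b else 1) \<in> (A(i := disc c r)) k}"
      using i disc_scale_div[OF b, of c r] by simp
  qed (use i b in auto)
  \<comment> \<open>D2 varies the quotient slot instead and is translation invariant, so its value
    zero at radius 1 spreads to all radii and returns to D through \<open>tor\<close>.\<close>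
  have const: "D (disc 0 (absv b)) = 0" if b: "b \<noteq> 0" for b :: 'f
  proof -
    define D2 where "D2 V = T (ind (cyl ?A0 (O1(i := V)) W))" for V
    have "D2 (disc c r) = D2 (disc 0 r)" for c r
      unfolding D2_def
    proof (rule cyl_translate[where b="\<lambda>k. if k = i then - c else 0"])
      fix k show "(O1(i := disc c r)) k = {u. u + (if k = i then - c else 0) \<in> (O1(i := disc 0 r)) k}"
        by (auto simp: disc_def)
    qed (use i W0 in auto)
    moreover have "D2 (V \<union> V') = D2 V + D2 V'" if "good_set V" "good_set V'" "V \<inter> V' = {}" for V V'
      unfolding D2_def by (rule cyl_additive(2)[OF goodA0 goodO W that i])
    moreover have "D2 (disc 0 1) = 0" using IH by (simp add: D2_def fun_upd_idem)
    ultimately have "D2 (disc 0 (absv b)) = 0"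
      using translation_invariant_zero_iff[of D2 "absv b" 1] b by simp
    then show ?thesis using tor[OF b, of 0 1] by (simp add: D_def D2_def)
  qed
  obtain c and a :: 'f where a: "a \<noteq> 0" "A i = disc c (absv a)" using insert.prems(2) by auto
  have "D (disc c (absv a)) = 0"
  proof (cases "absv c \<le> absv a")
    case True
    then have "c \<in> disc 0 (absv a)" by (simp add: disc_def)
    then have "disc c (absv a) = disc 0 (absv a)" by (rule disc_eq)
    then show ?thesis using const[OF a(1)] by simp
  next
    case False
    show ?thesis
    proof (rule vanishes_on_disc)
      show "D (V \<union> V') = D V + D V'" if "good_set V" "good_set V'" "V \<inter> V' = {}" for V V'
        unfolding D_def by (rule cyl_additive(1)[OF goodA goodO W that i])
      show "D (disc (u * c) r) = D (disc c r)" if u: "absv u = 1" for u c r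
      proof -
        have "u \<noteq> 0" using u by auto
        from tor[OF this, of c r] show ?thesis by (simp add: D_def u mult.commute fun_upd_idem)
      qed
    qed (use const a False in auto)
  qed
  then show ?case using a(2) by (simp add: D_def fun_upd_idem)
qed

text \<open>A unit in the first diagonal position rotates w_n and preserves the unit discs in the
  row, so the shell argument applies to the range of w_n. A scalar that is not a unit would change
  those row discs.\<close>

lemma cyl_zero_units:
  assumes zero: "T (ind (cyl O1 O1 {z. absv z = 1})) = 0" and r: "0 < r" "r < 1"
  shows "T (ind (cyl O1 O1 (disc 1 r))) = 0"
proof -
  have goodO: "good_set (O1 k)" for k by (simp add: good_disc)
  have "T (ind (cyl O1 O1 (disc (1::'f) r))) = 0"
  proof (rule vanishes_on_disc_of_shell[where D="\<lambda>V. T (ind (cyl O1 O1 V))"])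
    fix V V' :: "'f set"
    assume V: "good_set V" "good_set V'" "V \<subseteq> {x. absv x = absv 1}" "V' \<subseteq> {x. absv x = absv 1}" "V \<inter> V' = {}"
    have "cyl O1 O1 (V \<union> V') = cyl O1 O1 V \<union> cyl O1 O1 V'" by (auto simp: cyl_def)
    moreover have "cyl O1 O1 V \<inter> cyl O1 O1 V' = {}" using V(5) by (auto simp: cyl_def)
    moreover have "nice (cyl O1 O1 V)" "nice (cyl O1 O1 V')"
      using V by (auto intro!: nice_cyl[OF ne goodO goodO, of _ 1])
    ultimately show "T (ind (cyl O1 O1 (V \<union> V'))) = T (ind (cyl O1 O1 V)) + T (ind (cyl O1 O1 V'))"
      using dist_ind_Un[OF T_dist] by simp
  next
    fix u c :: 'f and r assume u: "absv u = 1"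
    then have u0: "u \<noteq> 0" by auto
    show "T (ind (cyl O1 O1 (disc (u * c) r))) = T (ind (cyl O1 O1 (disc c r)))"
    proof (rule cyl_torus[where d="\<lambda>k. if k = first_idx then u else 1"])
      fix k :: 'n assume k: "k \<noteq> first_idx"
      show "disc 0 1 = {a. (if first_idx = first_idx then u else 1) * a / (if k = first_idx then u else 1) \<in> disc 0 1}"
        using k disc_scale[OF u0, of 0 1] u by simp
      show "disc 0 1 = {ua. (if k = first_idx then u else 1) * ua \<in> disc 0 1}" using k by simp
    next
      show "disc (u * c) r = {z. z / (if first_idx = first_idx then u else 1) \<in> disc c r}"
        using disc_scale_div[OF u0, of c r] u by (simp add: mult.commute)
    qed (use u0 ne in auto)
  qed (use zero r in auto)
  then show ?thesis .
qed

text \<open>Every small product box is moved to one with quotient discs \<open>disc 0 1\<close> and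
  with w_n near 1: a translation centres the quotients at 0, the middle diagonal entries rescale
  them, and the first diagonal entry normalises w_n. The distortion of the row discs is tolerated
  because \<open>cyl_zero_rows\<close> allows any centres and radii there.\<close>

lemma cyl_zero:
  fixes a c :: 'f
  assumes zero: "T (ind (cyl O1 O1 {z. absv z = 1})) = 0"
    and a: "a \<noteq> 0" "absv a < absv c"
  shows "T (ind (cyl (\<lambda>i. disc (p i) (absv a)) (\<lambda>i. disc (q i) (absv a)) (disc c (absv a)))) = 0"
proof -
  have c0: "c \<noteq> 0" "0 < absv c" using a absv_nonneg[of a] absv_pos by fastforce+
  have 1: "T (ind (cyl (\<lambda>i. disc (p i) (absv b)) O1 (disc 1 (absv a / absv c)))) = 0" if b: "b \<noteq> 0" for p and b :: 'f
  proof -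
    let ?J = "UNIV - {first_idx, last_idx} :: 'n set"
    let ?A = "\<lambda>i. if i \<in> ?J then disc (p i) (absv b) else disc 0 1"
    have r: "0 < absv a / absv c" "absv a / absv c < 1" using a c0 by auto
    have "T (ind (cyl ?A O1 (disc 1 (absv a / absv c)))) = 0"
    proof (rule cyl_zero_rows[where S="?J"])
      show "ok_range (disc 1 (absv a / absv c) :: 'f set)" using r by (intro ok_range_disc) simp_all
      show "T (ind (cyl O1 O1 (disc 1 (absv a / absv c)))) = 0" by (rule cyl_zero_units[OF zero r])
      show "\<forall>i\<in>?J. \<exists>c (a::'f). a \<noteq> 0 \<and> ?A i = disc c (absv a)"
      proof
        fix i assume "i \<in> ?J"
        then show "\<exists>c (a::'f). a \<noteq> 0 \<and> ?A i = disc c (absv a)"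
          using b by (intro exI[of _ "p i"] exI[of _ b]) simp
      qed
    qed simp_all
    moreover have "cyl ?A O1 (disc 1 (absv a / absv c)) = cyl (\<lambda>i. disc (p i) (absv b)) O1 (disc 1 (absv a / absv c))"
      by (rule cyl_cong) auto
    ultimately show ?thesis by simp
  qed
  \<comment> \<open>The first diagonal entry c divides w_n by c and multiplies the rows by
    c.\<close>
  have 2: "T (ind (cyl (\<lambda>i. disc (p i) (absv b)) O1 (disc c (absv a)))) = 0" if b: "b \<noteq> 0" for p and b :: 'f
  proof -
    have "T (ind (cyl (\<lambda>i. disc (p i) (absv b)) O1 (disc c (absv a)))) =
       T (ind (cyl (\<lambda>i. disc (c * p i) (absv (c * b))) O1 (disc 1 (absv a / absv c))))"
    proof (rule cyl_torus[where d="\<lambda>k. if k = first_idx then c else 1"])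
      fix k :: 'n assume k: "k \<noteq> first_idx"
      show "disc (p k) (absv b) = {a. (if first_idx = first_idx then c else 1) * a / (if k = first_idx then c else 1)
          \<in> disc (c * p k) (absv (c * b))}"
        using k disc_scale[OF c0(1), of "c * p k" "absv (c * b)"] c0 by (simp add: absv_mult)
      show "disc 0 1 = {u. (if k = first_idx then c else 1) * u \<in> disc 0 1}" using k by simp
    next
      show "disc c (absv a) = {z. z / (if first_idx = first_idx then c else 1) \<in> disc 1 (absv a / absv c)}"
        using disc_scale_div[OF c0(1), of 1 "absv a / absv c"] c0 by simp
    qed (use c0 ne in auto)
    then show ?thesis using 1[of "c * b" "\<lambda>i. c * p i"] b c0 by simp
  qed
  have "T (ind (cyl (\<lambda>i. disc (p i) (absv a)) (\<lambda>i. disc (q i) (absv a)) (disc c (absv a)))) =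
        T (ind (cyl (\<lambda>i. disc (p i) (absv a)) (\<lambda>i. disc 0 (absv a)) (disc c (absv a))))"
  proof (rule cyl_translate[where b="\<lambda>k. if k = first_idx \<or> k = last_idx then 0 else - q k"])
    show "0 \<notin> disc c (absv a)" using a by (simp add: disc_def)
  qed (auto simp: disc_def)
  also have "\<dots> = T (ind (cyl (\<lambda>i. disc (a * p i) (absv (a * a))) O1 (disc c (absv a))))"
  proof (rule cyl_torus[where d="\<lambda>k. if k = first_idx \<or> k = last_idx then 1 else inverse a"])
    fix k :: 'n assume k: "k \<noteq> first_idx" "k \<noteq> last_idx"
    have ia: "inverse a \<noteq> 0" using a by simp
    show "disc 0 (absv a) = {u. (if k = first_idx \<or> k = last_idx then 1 else inverse a) * u \<in> disc 0 1}"
      using k disc_scale[OF ia, of 0 1] by (simp add: absv_inverse divide_inverse)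
    show "disc (p k) (absv a) = {x. (if first_idx = first_idx \<or> first_idx = last_idx then 1 else inverse a) * x /
        (if k = first_idx \<or> k = last_idx then 1 else inverse a) \<in> disc (a * p k) (absv (a * a))}"
    proof -
      have "{x. a * x \<in> disc (a * p k) (absv (a * a))} = disc (p k) (absv a)"
        using disc_scale[OF a(1), of "a * p k" "absv (a * a)"] a(1) by (simp add: absv_mult)
      moreover have "1 * x / inverse a = a * x" for x by (simp add: divide_inverse mult.commute)
      ultimately show ?thesis using k by simp
    qed
  qed (use a in auto)
  also have "\<dots> = 0" using 2[of "a * a" "\<lambda>i. a * p i"] a(1) by simp
  finally show ?thesis .
qed

end

section \<open>Descent to the origin\<close>

definition zero_at :: "('n \<times> 'n) set \<Rightarrow> ('f::nonarch_local_field, 'n::{finite,linorder}) sqm \<Rightarrow> bool" where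
  "zero_at E x \<longleftrightarrow> (\<forall>(i, j)\<in>E. x $ i $ j = 0)"

text \<open>The balls of radius r about the zeros of f on the cone miss the support, so removing
  them from a compact piece of the cone leaves exactly the support.\<close>

lemma compact_schwartz_support:
  fixes f :: "('f::nonarch_local_field, 'n::{finite,linorder}) sqm \<Rightarrow> complex"
  assumes f: "f \<in> schwartz N_1n"
  shows "compact {x. f x \<noteq> 0}"
proof -
  obtain r R where f': "r > 0" "\<forall>x\<in>N_1n. \<forall>y\<in>N_1n. entries_le r (y - x) \<longrightarrow> f y = f x"
    "\<forall>x. f x \<noteq> 0 \<longrightarrow> entries_le R x" using f by (rule schwartz_N_1nE)
  let ?K = "{x. f x \<noteq> 0}"
  have sub: "?K \<subseteq> {x \<in> N_1n. entries_le R x}" using f'(3) schwartz_N_1n_nonzero[OF f] by blast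
  have "open (\<Union>x\<in>{x \<in> N_1n. f x = 0}. ball x r)" by (intro open_UN ballI open_ball)
  then have "compact ({x \<in> N_1n. entries_le R x} - (\<Union>x\<in>{x \<in> N_1n. f x = 0}. ball x r))"
    by (rule compact_diff[OF compact_N_1n_bounded])
  moreover have "{x \<in> N_1n. entries_le R x} - (\<Union>x\<in>{x \<in> N_1n. f x = 0}. ball x r) = ?K"
  proof
    show "?K \<subseteq> {x \<in> N_1n. entries_le R x} - (\<Union>x\<in>{x \<in> N_1n. f x = 0}. ball x r)"
    proof
      fix y assume y: "y \<in> ?K"
      have "y \<notin> ball x r" if "x \<in> N_1n" "f x = 0" for x
      proof
        assume "y \<in> ball x r"
        then have "entries_le r (y - x)" by (intro dist_le_imp_entries_le) (simp add: dist_commute)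
        then have "f y = f x" using f'(2) that(1) sub y by blast
        then show False using y that(2) by simp
      qed
      then show "y \<in> {x \<in> N_1n. entries_le R x} - (\<Union>x\<in>{x \<in> N_1n. f x = 0}. ball x r)"
        using sub y by blast
    qed
    show "{x \<in> N_1n. entries_le R x} - (\<Union>x\<in>{x \<in> N_1n. f x = 0}. ball x r) \<subseteq> ?K"
      using f'(1) by auto
  qed
  ultimately show ?thesis by simp
qed

text \<open>The sum of the absolute values of the entries in E is continuous and positive on the
  compact support. Some entry reaches the minimum of this sum divided by the number of
  entries.\<close>

lemma support_bounded_below:
  fixes f :: "('f::nonarch_local_field, 'n::{finite,linorder}) sqm \<Rightarrow> complex"
  assumes f: "f \<in> schwartz N_1n" and E: "\<forall>x\<in>N_1n. zero_at E x \<longrightarrow> f x = 0"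
  obtains \<delta> where "\<delta> > 0" "\<forall>x. f x \<noteq> 0 \<longrightarrow> (\<exists>(i, j)\<in>E. \<delta> \<le> absv (x $ i $ j))"
proof (cases "\<exists>x. f x \<noteq> 0")
  case False
  then show ?thesis using that[of 1] by simp
next
  case True
  let ?K = "{x. f x \<noteq> 0}"
  let ?\<phi> = "\<lambda>x::('f,'n) sqm. \<Sum>(i, j)\<in>E. absv (x $ i $ j)"
  note K = compact_schwartz_support[OF f]
  have cont: "continuous_on ?K ?\<phi>"
    by (intro continuous_on_sum) (auto simp: case_prod_unfold intro!: continuous_on_absv_comp continuous_on_component continuous_on_id)
  obtain x0 where x0: "x0 \<in> ?K" "\<forall>x\<in>?K. ?\<phi> x0 \<le> ?\<phi> x"
    using continuous_attains_inf[OF K _ cont] True by blast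
  have "\<not> zero_at E x0" using E x0(1) schwartz_N_1n_nonzero[OF f, of x0] by auto
  then obtain k l where kl: "(k, l) \<in> E" "x0 $ k $ l \<noteq> 0" by (auto simp: zero_at_def)
  have fin: "finite E" by (rule finite_subset[of _ UNIV]) auto
  have "0 < absv (x0 $ k $ l)" using kl by simp
  also have "\<dots> \<le> ?\<phi> x0"
    using member_le_sum[of "(k, l)" E "\<lambda>(i, j). absv (x0 $ i $ j)"] kl fin by auto
  finally have m: "0 < ?\<phi> x0" .
  have cE: "0 < real (card E)" using kl fin by (auto simp: card_gt_0_iff)
  define \<delta> where "\<delta> = ?\<phi> x0 / real (card E)"
  have "\<exists>(i, j)\<in>E. \<delta> \<le> absv (x $ i $ j)" if "f x \<noteq> 0" for x
  proof (rule ccontr)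
    assume "\<not> ?thesis"
    then have "?\<phi> x < (\<Sum>(i, j)\<in>E. \<delta>)" using kl(1) fin by (intro sum_strict_mono) auto
    also have "\<dots> = ?\<phi> x0" using cE by (simp add: \<delta>_def case_prod_unfold)
    finally show False using x0(2) that by force
  qed
  moreover have "\<delta> > 0" using m cE by (simp add: \<delta>_def)
  ultimately show ?thesis using that by blast
qed

text \<open>T is supported on the closed part of the cone where the entries in E vanish. Stated with
  test functions, it says that T sees only the restriction to that part, as
  \<open>vanishes_outside_cong\<close> makes explicit.\<close>

definition vanishes_outside :: "((('f::nonarch_local_field, 'n::{finite,linorder}) sqm \<Rightarrow> complex) \<Rightarrow> complex) \<Rightarrow>
    ('n \<times> 'n) set \<Rightarrow> bool" where
  "vanishes_outside T E \<longleftrightarrow> (\<forall>f\<in>schwartz N_1n. (\<forall>x\<in>N_1n. zero_at E x \<longrightarrow> f x = 0) \<longrightarrow> T f = 0)"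

lemma schwartz_restrict:
  fixes f :: "('f::nonarch_local_field, 'n::{finite,linorder}) sqm \<Rightarrow> complex"
  assumes f: "f \<in> schwartz N_1n" and s: "s > 0" and Q: "\<And>x y. entries_le s (y - x) \<Longrightarrow> Q x \<Longrightarrow> Q y"
  shows "(\<lambda>x. if Q x then f x else 0) \<in> schwartz N_1n"
proof -
  obtain r R where f': "r > 0" "\<forall>x\<in>N_1n. \<forall>y\<in>N_1n. entries_le r (y - x) \<longrightarrow> f y = f x"
    "\<forall>x. f x \<noteq> 0 \<longrightarrow> entries_le R x" using f by (rule schwartz_N_1nE)
  show ?thesis
  proof (rule schwartz_N_1nI[of _ "min r s" R])
    fix x y :: "('f,'n) sqm" assume a: "x \<in> N_1n" "y \<in> N_1n" "entries_le (min r s) (y - x)"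
    have "entries_le s (y - x)" "entries_le r (y - x)" using entries_le_mono[OF a(3)] by auto
    moreover then have "entries_le s (x - y)" using entries_le_commute by blast
    ultimately have "Q x \<longleftrightarrow> Q y" "f y = f x" using Q f'(2) a by blast+
    then show "(if Q y then f y else 0) = (if Q x then f x else 0)" by simp
  qed (use f'(1,3) s schwartz_N_1n_nonzero[OF f] in \<open>auto split: if_splits\<close>)
qed

lemma absv_ge_stable:
  fixes x y :: "'f::nonarch_local_field"
  shows "absv (y - x) < \<delta> \<Longrightarrow> \<delta> \<le> absv x \<Longrightarrow> \<delta> \<le> absv y"
  using absv_eqI[of y x] by simp

context
  fixes T :: "(('f::nonarch_local_field, 'n::{finite,linorder}) sqm \<Rightarrow> complex) \<Rightarrow> complex"
  assumes T: "T \<in> invariant_distributions P_1n N_1n" and ne: "first_idx \<noteq> (last_idx::'n)"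
begin

lemma vanishes_outside_cong:
  assumes "vanishes_outside T E" "f \<in> schwartz N_1n" "g \<in> schwartz N_1n"
    "\<And>x. x \<in> N_1n \<Longrightarrow> zero_at E x \<Longrightarrow> f x = g x"
  shows "T f = T g"
proof -
  have g: "(\<lambda>x. -1 * g x) \<in> schwartz N_1n" by (rule schwartz_cmult[OF assms(3)])
  have "(\<lambda>x. f x + -1 * g x) \<in> schwartz N_1n" by (rule schwartz_add[OF assms(2) g])
  then have "T (\<lambda>x. f x + -1 * g x) = 0" using assms(1,4) unfolding vanishes_outside_def by simp
  then show ?thesis using dist_add[OF T_dist[OF T ne] assms(2) g] dist_cmult[OF T_dist[OF T ne] assms(3), of "-1"] by simp
qed

text \<open>The fibres fed to \<open>dist_zero_by_classes\<close> are the small product boxes in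
  cylinder coordinates, which \<open>cyl_zero\<close> kills. What remains is to compare the scale of
  these coordinates with that of the matrix entries.\<close>

lemma vanishes_where_last_nonzero:
  assumes zero: "T (ind (cyl (\<lambda>_. disc 0 1) (\<lambda>_. disc 0 1) {z. absv z = 1})) = 0"
    and f: "f \<in> schwartz N_1n" and \<delta>: "\<delta> > 0" "\<And>x. f x \<noteq> 0 \<Longrightarrow> \<delta> \<le> absv (x $ last_idx $ first_idx)"
  shows "T f = 0"
proof -
  obtain r R0 where f': "r > 0" "\<forall>x\<in>N_1n. \<forall>y\<in>N_1n. entries_le r (y - x) \<longrightarrow> f y = f x"
    "\<forall>x. f x \<noteq> 0 \<longrightarrow> entries_le R0 x" using f by (rule schwartz_N_1nE)
  define R where "R = max 1 (max R0 (R0 / \<delta>))"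
  have R: "1 \<le> R" "R0 \<le> R" "R0 / \<delta> \<le> R" by (auto simp: R_def)
  \<comment> \<open>The class radius is below \<delta> so that w_n keeps its size, below 1 so that
    the quotients stay bounded by R, and below r / R so that f is constant on a class.\<close>
  define e where "e = Min {\<delta>, 1, r / R}"
  have "e > 0" using \<delta>(1) R(1) f'(1) by (simp add: e_def)
  then obtain a :: 'f where a: "a \<noteq> 0" "absv a < e" using ex_absv_lt by blast
  have "e \<le> \<delta>" "e \<le> 1" "e \<le> r / R" unfolding e_def by (intro Min_le; simp)+
  moreover from this have "R * e \<le> r" using R(1) by (simp add: pos_le_divide_eq mult.commute)
  moreover have "R * absv a \<le> R * e" using a R(1) by (intro mult_left_mono) auto
  ultimately have a': "absv a < \<delta>" "absv a \<le> 1" "R * absv a \<le> r" "0 < absv a"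
    using a by auto
  \<comment> \<open>Entries that agree up to \<rho> give cylinder coordinates that agree up to
    \<open>absv a\<close>; the last term pays for the quotients.\<close>
  define \<rho> where "\<rho> = Min {\<delta> / 2, absv a, absv a * \<delta> / R}"
  have "0 < absv a * \<delta> / R" using \<delta>(1) R(1) a'(4) by (intro divide_pos_pos mult_pos_pos) auto
  then have \<rho>: "\<rho> > 0" using \<delta>(1) a'(4) by (simp add: \<rho>_def)
  have "\<rho> \<le> \<delta> / 2" "\<rho> \<le> absv a" "\<rho> \<le> absv a * \<delta> / R" unfolding \<rho>_def by (intro Min_le; simp)+
  then have \<rho>': "\<rho> < \<delta>" "\<rho> \<le> absv a" "R * \<rho> / \<delta> \<le> absv a"
    using \<delta>(1) R(1) by (auto simp: pos_le_divide_eq pos_divide_le_eq mult.commute)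
  let ?z = "\<lambda>x::('f,'n) sqm. x $ last_idx $ first_idx"
  let ?u = "\<lambda>(x::('f,'n) sqm) i. x $ i $ first_idx / ?z x"
  let ?j = "\<lambda>i::'n. i = first_idx \<or> i = last_idx"
  \<comment> \<open>At the two end indices a constant dummy set stands in, so that equality of
    \<kappa> compares only the middle coordinates and w_n.\<close>
  let ?\<kappa> = "\<lambda>x::('f,'n) sqm. ((\<lambda>i. if ?j i then {} else disc (x $ first_idx $ i) (absv a)),
      (\<lambda>i. if ?j i then {} else disc (?u x i) (absv a)), disc (?z x) (absv a))"
  have \<kappa>: "?\<kappa> y = ?\<kappa> x \<longleftrightarrow> (\<forall>i. \<not> ?j i \<longrightarrow> y $ first_idx $ i \<in> disc (x $ first_idx $ i) (absv a) \<and>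
      ?u y i \<in> disc (?u x i) (absv a)) \<and> ?z y \<in> disc (?z x) (absv a)" for x y
    by (auto simp: fun_eq_iff disc_eq_iff)
  have supp: "entries_le R0 x" "\<delta> \<le> absv (?z x)" "x \<in> N_1n" if "f x \<noteq> 0" for x
    using f'(3) \<delta>(2) schwartz_N_1n_nonzero[OF f] that by auto
  have ub: "absv (?u x i) \<le> R" if "f x \<noteq> 0" for x i
  proof -
    have "absv (x $ i $ first_idx) \<le> R0" using supp(1)[OF that] by (simp add: entries_le_def)
    then have "absv (x $ i $ first_idx) / absv (?z x) \<le> R0 / \<delta>"
      using supp(2)[OF that] \<delta>(1) absv_nonneg order_trans by (intro frac_le) blast+
    then show ?thesis using R(3) by (simp add: absv_divide)
  qed
  show ?thesis
  proof (rule dist_zero_by_classes[OF T_dist[OF T ne] f \<rho>, of ?\<kappa>])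
    fix x y assume x: "f x \<noteq> 0" and y: "y \<in> N_1n" and xy: "entries_le \<rho> (y - x)"
    have d: "absv (y $ i $ j - x $ i $ j) \<le> \<rho>" for i j using xy by (simp add: entries_le_def)
    show "?\<kappa> y = ?\<kappa> x"
      unfolding \<kappa>
    proof (intro conjI allI impI)
      fix i
      show "y $ first_idx $ i \<in> disc (x $ first_idx $ i) (absv a)"
        using d[of first_idx i] \<rho>'(2) by (simp add: disc_def)
      have "absv (?u y i - ?u x i) \<le> R * \<rho> / \<delta>"
        by (rule absv_ratio_diff_le(1)[OF d d supp(2)[OF x] \<rho>'(1) \<delta>(1) ub[OF x] R(1)]) (use \<rho> in simp)
      then show "?u y i \<in> disc (?u x i) (absv a)" using \<rho>'(3) by (simp add: disc_def)
    next
      show "?z y \<in> disc (?z x) (absv a)"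
        using d[of last_idx first_idx] \<rho>'(2) by (simp add: disc_def)
    qed
  next
    fix x y assume x: "f x \<noteq> 0" and y: "y \<in> N_1n" and xy: "?\<kappa> y = ?\<kappa> x"
    note xN = supp(3)[OF x]
    have dv: "absv (y $ first_idx $ i - x $ first_idx $ i) \<le> absv a"
      and du: "absv (?u y i - ?u x i) \<le> absv a" if "\<not> ?j i" for i
      using xy that unfolding \<kappa> by (auto simp: disc_def)
    have dz: "absv (?z y - ?z x) \<le> absv a" using xy unfolding \<kappa> by (simp add: disc_def)
    have zx: "?z x \<noteq> 0" using supp(2)[OF x] \<delta>(1) by auto
    have "absv (?z y) = absv (?z x)" using dz a'(1) supp(2)[OF x] by (intro absv_eqI) simp
    then have zy: "?z y \<noteq> 0" using zx by auto
    have uy: "absv (?u y i) \<le> R" if "\<not> ?j i" for i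
      using absv_add_le[of "?u y i - ?u x i" R "?u x i"] du[OF that] ub[OF x, of i] a'(2) R(1) by simp
    have xR: "absv (x $ i $ j) \<le> R" for i j
      using supp(1)[OF x] R(2) order_trans unfolding entries_le_def by blast
    have aR: "absv a \<le> R * absv a" using mult_right_mono[OF R(1) absv_nonneg[of a]] by simp
    have prod: "absv (p' * q' - p * q) \<le> R * absv a"
      if "absv (p' - p) \<le> absv a" "absv (q' - q) \<le> absv a" "absv q' \<le> R" "absv p \<le> R" for p p' q q' :: 'f
    proof -
      have "p' * q' - p * q = (p' - p) * q' + p * (q' - q)" by (simp add: algebra_simps)
      moreover have "absv ((p' - p) * q') \<le> absv a * R" unfolding absv_mult using that by (intro mult_mono) auto
      moreover have "absv (p * (q' - q)) \<le> R * absv a" unfolding absv_mult using that R by (intro mult_mono) auto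
      ultimately show ?thesis by (metis absv_add_le mult.commute)
    qed
    have "entries_le (R * absv a) (y - x)"
      unfolding entries_le_def
    proof (intro allI)
      fix i j :: 'n
      consider "(i = first_idx) = (j = first_idx)" | "i = first_idx" "\<not> ?j j"
        | "i = first_idx" "j = last_idx" | "i = last_idx" "j = first_idx" | "\<not> ?j i" "j = first_idx" by blast
      then show "absv ((y - x) $ i $ j) \<le> R * absv a"
      proof cases
        case 1
        then show ?thesis using N_1n_pattern[OF xN] N_1n_pattern[OF y] R(1) by simp
      next
        case 2
        then show ?thesis using dv[of j] aR by simp
      next
        case 3
        let ?J = "UNIV - {first_idx, last_idx} :: 'n set"
        have "(y - x) $ i $ j = - (\<Sum>k\<in>?J. y $ first_idx $ k * ?u y k - x $ first_idx $ k * ?u x k)"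
          using first_last_entry[OF xN ne zx] first_last_entry[OF y ne zy] 3 by (simp add: sum_subtractf)
        moreover have "absv (\<Sum>k\<in>?J. y $ first_idx $ k * ?u y k - x $ first_idx $ k * ?u x k) \<le> R * absv a"
        proof (rule absv_sum_le)
          fix k assume k: "k \<in> ?J"
          show "absv (y $ first_idx $ k * ?u y k - x $ first_idx $ k * ?u x k) \<le> R * absv a"
            by (rule prod) (use k dv[of k] du[of k] uy[of k] xR in auto)
        qed (use R in simp)
        ultimately show ?thesis by simp
      next
        case 4
        then show ?thesis using dz aR by simp
      next
        case 5
        have "absv (?z y * ?u y i - ?z x * ?u x i) \<le> R * absv a"
          by (rule prod) (use 5 dz du[of i] uy[of i] xR in auto)
        then show ?thesis using 5 zx zy by simp
      qed
    qed
    then have "entries_le r (y - x)" using a'(3) by (rule entries_le_mono)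
    then show "f y = f x" using f'(2) xN y by blast
  next
    fix x assume x: "f x \<noteq> 0"
    have "{y \<in> N_1n. ?\<kappa> y = ?\<kappa> x} = cyl (\<lambda>i. disc (x $ first_idx $ i) (absv a)) (\<lambda>i. disc (?u x i) (absv a)) (disc (?z x) (absv a))"
      unfolding \<kappa> cyl_def by blast
    moreover have "T (ind (cyl (\<lambda>i. disc (x $ first_idx $ i) (absv a)) (\<lambda>i. disc (?u x i) (absv a)) (disc (?z x) (absv a)))) = 0"
      using cyl_zero[OF T ne zero a(1), of "?z x"] supp(2)[OF x] a'(1) by simp
    ultimately show "T (ind {y \<in> N_1n. ?\<kappa> y = ?\<kappa> x}) = 0" by simp
  qed
qed

lemma vanishes_outside_last:
  assumes "T (ind (cyl (\<lambda>_. disc 0 1) (\<lambda>_. disc 0 1) {z. absv z = 1})) = 0"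
  shows "vanishes_outside T {(last_idx, first_idx)}"
  unfolding vanishes_outside_def
proof (intro ballI impI)
  fix f :: "('f,'n) sqm \<Rightarrow> complex" assume f: "f \<in> schwartz N_1n" "\<forall>x\<in>N_1n. zero_at {(last_idx, first_idx)} x \<longrightarrow> f x = 0"
  then obtain \<delta> where "\<delta> > 0" "\<forall>x. f x \<noteq> 0 \<longrightarrow> (\<exists>(i, j)\<in>{(last_idx, first_idx)}. \<delta> \<le> absv (x $ i $ j))"
    by (rule support_bounded_below)
  then show "T f = 0" using vanishes_where_last_nonzero[OF assms f(1), of \<delta>] by simp
qed

text \<open>On the support the entries in E vanish, so d scales the entry (k, l) by s and fixes all
  others. The mass of a box, as a function of the disc for that entry, is scaling invariant and
  therefore zero on discs away from 0.\<close>

lemma vanishes_outside_insert_torus: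
  assumes E: "vanishes_outside T E"
    and d: "\<And>s. s \<noteq> 0 \<Longrightarrow> \<exists>d :: 'n \<Rightarrow> 'f. (\<forall>i. d i \<noteq> 0) \<and> d last_idx = 1 \<and> d k = s * d l \<and>
      (\<forall>i j. (i = first_idx) \<noteq> (j = first_idx) \<longrightarrow> (i, j) \<notin> insert (k, l) E \<longrightarrow> d i = d j)"
  shows "vanishes_outside T (insert (k, l) E)"
  unfolding vanishes_outside_def
proof (intro ballI impI)
  fix f :: "('f,'n) sqm \<Rightarrow> complex" assume f: "f \<in> schwartz N_1n" "\<forall>x\<in>N_1n. zero_at (insert (k, l) E) x \<longrightarrow> f x = 0"
  then obtain \<delta> where \<delta>: "\<delta> > 0" "\<forall>x. f x \<noteq> 0 \<longrightarrow> (\<exists>(i, j)\<in>insert (k, l) E. \<delta> \<le> absv (x $ i $ j))"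
    by (rule support_bounded_below)
  \<comment> \<open>On the support f can be nonzero only where the entry (k, l) has size at least
    \<delta>, so f and its cut-off f1 have the same value under T.\<close>
  define f1 where "f1 x = (if \<delta> \<le> absv (x $ k $ l) then f x else 0)" for x
  have f1: "f1 \<in> schwartz N_1n"
    unfolding f1_def
  proof (rule schwartz_restrict[OF f(1), of "\<delta> / 2"])
    fix x y :: "('f,'n) sqm" assume xy: "entries_le (\<delta> / 2) (y - x)" "\<delta> \<le> absv (x $ k $ l)"
    have "absv (y $ k $ l - x $ k $ l) \<le> \<delta> / 2" using xy(1) by (simp add: entries_le_def)
    then show "\<delta> \<le> absv (y $ k $ l)" using absv_ge_stable[OF _ xy(2)] \<delta>(1) by simp
  qed (use \<delta> in simp)
  have "T f = T f1"
  proof (rule vanishes_outside_cong[OF E f(1) f1])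
    fix x :: "('f,'n) sqm" assume x: "x \<in> N_1n" "zero_at E x"
    show "f x = f1 x"
    proof (cases "f x = 0")
      case False
      then obtain i j where ij: "(i, j) \<in> insert (k, l) E" "\<delta> \<le> absv (x $ i $ j)" using \<delta>(2) by blast
      then have "(i, j) = (k, l)" using x(2) \<delta>(1) by (auto simp: zero_at_def)
      then show ?thesis using ij(2) by (simp add: f1_def)
    qed (simp add: f1_def)
  qed
  also have "T f1 = 0"
  proof (rule dist_zero_by_boxes[OF T_dist[OF T ne] f1 \<delta>(1)])
    fix a :: 'f and x0 assume a: "a \<noteq> 0" "absv a < \<delta>" and x0: "f1 x0 \<noteq> 0"
    have a0: "0 < absv a" using a(1) by simp
    define Q where "Q = {x::('f,'n) sqm. \<forall>i j. (i, j) \<noteq> (k, l) \<longrightarrow> x $ i $ j \<in> disc (x0 $ i $ j) (absv a)}"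
    define S where "S V = {x \<in> N_1n. x $ k $ l \<in> V \<and> x \<in> Q}" for V
    define D where "D V = T (ind (S V))" for V
    have nS: "nice (S V)" if V: "good_set V" for V
    proof -
      obtain v Rv where v: "v > 0" "\<forall>x\<in>V. disc x v \<subseteq> V" "V \<subseteq> disc 0 Rv" using V unfolding good_set_def by blast
      obtain R0 where R0: "R0 > 0" "entries_le R0 x0" using entries_le_ex by blast
      show ?thesis
      proof (rule niceI[of _ "min v (absv a)" "max Rv (max R0 (absv a))"])
        fix x y :: "('f,'n) sqm" assume x: "x \<in> S V" and y: "y \<in> N_1n" "entries_le (min v (absv a)) (y - x)"
        have d: "absv (y $ i $ j - x $ i $ j) \<le> v" "absv (y $ i $ j - x $ i $ j) \<le> absv a" for i j
          using y(2) by (auto simp: entries_le_def)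
        have xs: "x $ k $ l \<in> V" "x \<in> Q" using x by (auto simp: S_def)
        have "y $ k $ l \<in> disc (x $ k $ l) v" using d by (simp add: disc_def)
        then have "y $ k $ l \<in> V" using v(2) xs(1) by blast
        moreover have "y \<in> Q"
          using xs(2) d(2) absv_trans[OF d(2)] unfolding Q_def disc_def by blast
        ultimately show "y \<in> S V" using y(1) by (simp add: S_def)
      next
        fix x :: "('f,'n) sqm" assume x: "x \<in> S V"
        show "entries_le (max Rv (max R0 (absv a))) x"
          unfolding entries_le_def
        proof (intro allI)
          fix i j
          show "absv (x $ i $ j) \<le> max Rv (max R0 (absv a))"
          proof (cases "(i, j) = (k, l)")
            case True
            have "x $ k $ l \<in> disc 0 Rv" using x v(3) by (auto simp: S_def)
            then show ?thesis using True by (simp add: disc_def)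
          next
            case False
            then have "absv (x $ i $ j - x0 $ i $ j) \<le> absv a" using x by (auto simp: S_def Q_def disc_def)
            moreover have "absv (x0 $ i $ j) \<le> R0" using R0(2) by (simp add: entries_le_def)
            ultimately have "absv (x $ i $ j - x0 $ i $ j + x0 $ i $ j) \<le> max R0 (absv a)"
              by (intro absv_add_le) (simp_all add: le_max_iff_disj)
            then show ?thesis by (simp add: le_max_iff_disj)
          qed
        qed
      qed (use v a0 in \<open>auto simp: S_def\<close>)
    qed
    \<comment> \<open>Off the support the diagonal matrix may move other entries too. The two
      indicators are compared only where the entries in E vanish, which is enough for T.\<close>
    have scale: "D {c. s * c \<in> V} = D V" if s: "s \<noteq> 0" and V: "good_set V" and V': "good_set {c. s * c \<in> V}" for s V
    proof -
      obtain d where d: "\<forall>i. d i \<noteq> 0" "d last_idx = 1" "d k = s * d l"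
        "\<forall>i j. (i = first_idx) \<noteq> (j = first_idx) \<longrightarrow> (i, j) \<notin> insert (k, l) E \<longrightarrow> d i = d j"
        using d[OF s] by blast
      have g: "diagm d \<in> P_1n" "diagm d \<in> H_1n" using diagm_in_P_1n[of d] d P_1n_subset_H_1n by auto
      have "T (ind (S {c. s * c \<in> V})) = T (\<lambda>x. ind (S V) (conj_mat (diagm d) x))"
      proof (rule vanishes_outside_cong[OF E ind_schwartz[OF nS[OF V']] schwartz_conj[OF g(2) ind_schwartz[OF nS[OF V]]]])
        fix x :: "('f,'n) sqm" assume x: "x \<in> N_1n" "zero_at E x"
        have c: "conj_mat (diagm d) x $ i $ j = (if (i, j) = (k, l) then s * x $ k $ l else x $ i $ j)" for i j
        proof -
          have *: "conj_mat (diagm d) x $ i $ j = d i * x $ i $ j / d j" by (rule conj_diagm_nth) (use d in simp)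
          consider "(i, j) = (k, l)" | "(i, j) \<noteq> (k, l)" "x $ i $ j = 0" | "(i, j) \<noteq> (k, l)" "d i = d j"
            using x(2) N_1n_pattern[OF x(1), of i j] d(4) unfolding zero_at_def by blast
          then show ?thesis by cases (use * d(1,3) in auto)
        qed
        have "x \<in> S {c. s * c \<in> V} \<longleftrightarrow> conj_mat (diagm d) x \<in> S V"
          by (auto simp: S_def Q_def c conj_N_1n_iff[OF g(2)] x(1))
        then show "ind (S {c. s * c \<in> V}) x = ind (S V) (conj_mat (diagm d) x)" by (simp add: ind_def)
      qed
      also have "\<dots> = T (ind (S V))" by (rule invariant_distribution_conj[OF T g(1) H_1n_invertible[OF g(2)]])
      finally show ?thesis by (simp add: D_def)
    qed
    have "D (disc (x0 $ k $ l) (absv a)) = 0"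
    proof (rule vanishes_on_disc)
      show "D (A \<union> B) = D A + D B" if "good_set A" "good_set B" "A \<inter> B = {}" for A B
      proof -
        have "S (A \<union> B) = S A \<union> S B" "S A \<inter> S B = {}" using that(3) by (auto simp: S_def)
        then show ?thesis unfolding D_def using dist_ind_Un[OF T_dist[OF T ne] nS nS] that by simp
      qed
      show "D (disc (u * c) r) = D (disc c r)" if u: "absv u = 1" "0 < r" for u c r
      proof -
        have "u \<noteq> 0" using u by auto
        then have "D (disc c r) = D (disc (u * c) r)"
          using scale[of u "disc (u * c) r"] disc_scale[of u "u * c" r] u
            good_disc[OF u(2), of c] good_disc[OF u(2), of "u * c"] by simp
        then show ?thesis by simp
      qed
      show "D (disc 0 (absv b)) = D (disc 0 1)" if b: "b \<noteq> 0" for b :: 'f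
        using scale[of b "disc 0 (absv b)"] disc_scale[OF b, of 0 "absv b"] b
          good_disc[of "absv b" "0::'f"] good_disc[of 1 "0::'f"] by simp
      have "f1 x0 \<noteq> 0 \<Longrightarrow> \<delta> \<le> absv (x0 $ k $ l)" by (simp add: f1_def split: if_splits)
      then show "absv a < absv (x0 $ k $ l)" using x0 a(2) by simp
    qed (use a0 in auto)
    moreover have "{y \<in> N_1n. y \<in> mat_box x0 (absv a)} = S (disc (x0 $ k $ l) (absv a))"
      by (auto simp: S_def Q_def mat_box_def entries_le_def disc_def)
    ultimately show "T (ind {y \<in> N_1n. y \<in> mat_box x0 (absv a)}) = 0" by (simp add: D_def)
  qed
  finally show "T f = 0" .
qed

text \<open>On the support v_n = 0, and a unipotent with the single entry t at i sends it to - t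
  v_i. When v_i stays away from 0 and t is large, the image leaves any given bounded box, so the
  transported indicator vanishes on the support.\<close>

lemma vanishes_outside_unipotent:
  assumes E: "vanishes_outside T {(first_idx, last_idx), (last_idx, first_idx)}"
  shows "vanishes_outside T ({(first_idx, last_idx), (last_idx, first_idx)} \<union>
    {(first_idx, i) |i. i \<noteq> first_idx \<and> i \<noteq> last_idx})" (is "vanishes_outside T (?E \<union> ?F)")
  unfolding vanishes_outside_def
proof (intro ballI impI)
  fix f :: "('f,'n) sqm \<Rightarrow> complex" assume f: "f \<in> schwartz N_1n" "\<forall>x\<in>N_1n. zero_at (?E \<union> ?F) x \<longrightarrow> f x = 0"
  then obtain \<delta> where \<delta>: "\<delta> > 0" "\<forall>x. f x \<noteq> 0 \<longrightarrow> (\<exists>(i, j)\<in>?E \<union> ?F. \<delta> \<le> absv (x $ i $ j))"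
    by (rule support_bounded_below)
  let ?Q = "\<lambda>x::('f,'n) sqm. \<exists>i. i \<noteq> first_idx \<and> i \<noteq> last_idx \<and> \<delta> \<le> absv (x $ first_idx $ i)"
  define f1 where "f1 x = (if ?Q x then f x else 0)" for x
  have f1: "f1 \<in> schwartz N_1n"
    unfolding f1_def
  proof (rule schwartz_restrict[OF f(1), of "\<delta> / 2"])
    fix x y :: "('f,'n) sqm" assume xy: "entries_le (\<delta> / 2) (y - x)" "?Q x"
    then obtain i where i: "i \<noteq> first_idx" "i \<noteq> last_idx" "\<delta> \<le> absv (x $ first_idx $ i)" by blast
    have "absv (y $ first_idx $ i - x $ first_idx $ i) \<le> \<delta> / 2" using xy(1) by (simp add: entries_le_def)
    then have "\<delta> \<le> absv (y $ first_idx $ i)" using absv_ge_stable[OF _ i(3)] \<delta>(1) by simp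
    then show "?Q y" using i by blast
  qed (use \<delta> in simp)
  have "T f = T f1"
  proof (rule vanishes_outside_cong[OF E f(1) f1])
    fix x :: "('f,'n) sqm" assume x: "x \<in> N_1n" "zero_at ?E x"
    show "f x = f1 x"
    proof (cases "f x = 0")
      case False
      then obtain i j where ij: "(i, j) \<in> ?E \<union> ?F" "\<delta> \<le> absv (x $ i $ j)" using \<delta>(2) by blast
      then have "(i, j) \<in> ?F" using x(2) \<delta>(1) by (auto simp: zero_at_def)
      then show ?thesis using ij(2) by (auto simp: f1_def)
    qed (simp add: f1_def)
  qed
  also have "T f1 = 0"
  proof (rule dist_zero_by_boxes[OF T_dist[OF T ne] f1 \<delta>(1)])
    fix a :: 'f and x0 assume a: "a \<noteq> 0" "absv a < \<delta>" and x0: "f1 x0 \<noteq> 0"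
      and nice: "nice {y \<in> N_1n. y \<in> mat_box x0 (absv a)}"
    let ?S = "{y \<in> N_1n. y \<in> mat_box x0 (absv a)}"
    have "?Q x0"
    proof (rule ccontr)
      assume "\<not> ?Q x0"
      then have "f1 x0 = 0" unfolding f1_def by (rule if_not_P)
      then show False using x0 by simp
    qed
    then obtain i where i: "i \<noteq> first_idx" "i \<noteq> last_idx" "\<delta> \<le> absv (x0 $ first_idx $ i)" by blast
    \<comment> \<open>The product of \<delta> and the size of t has to exceed every value of v_n in
      the box.\<close>
    obtain t :: 'f where t: "max (absv (x0 $ first_idx $ last_idx)) (absv a) / \<delta> < absv t" using ex_absv_gt by blast
    let ?b = "\<lambda>j. if j = i then t else 0"
    let ?g = "mat 1 + (\<chi> i j. if j = last_idx then ?b i else 0) :: ('f,'n) sqm"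
    have b: "?b first_idx = 0" "?b last_idx = 0" using i by auto
    have g: "?g \<in> P_1n" "?g \<in> H_1n" using unipotent_conj(1)[OF T ne, of ?b, OF b] P_1n_subset_H_1n by auto
    have n: "ind ?S \<in> schwartz N_1n" by (rule ind_schwartz[OF nice])
    have "T (ind ?S) = T (\<lambda>x. ind ?S (conj_mat ?g x))"
      by (rule invariant_distribution_conj[OF T g(1) H_1n_invertible[OF g(2)], symmetric])
    also have "\<dots> = 0"
    proof -
      have "ind ?S (conj_mat ?g y) = 0" if y: "y \<in> N_1n" "zero_at ?E y" for y
      proof -
        have "conj_mat ?g y \<notin> mat_box x0 (absv a)"
        proof
          assume "conj_mat ?g y \<in> mat_box x0 (absv a)"
          then have d: "absv (conj_mat ?g y $ first_idx $ j - x0 $ first_idx $ j) \<le> absv a" for j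
            by (simp add: mat_box_def entries_le_def)
          have "(\<Sum>k\<in>UNIV. y $ first_idx $ k * ?b k) = y $ first_idx $ i * t"
            by (simp add: if_distrib[of "(*) _"] cong: if_cong)
          moreover have "y $ first_idx $ last_idx = 0" using y(2) by (simp add: zero_at_def)
          ultimately have cl: "conj_mat ?g y $ first_idx $ last_idx = - (y $ first_idx $ i * t)"
            using unipotent_conj(2)[OF T ne, of ?b, OF b] by simp
          have ci: "conj_mat ?g y $ first_idx $ i = y $ first_idx $ i"
            using unipotent_conj(2)[OF T ne, of ?b, OF b, of y i] i by simp
          have "\<delta> \<le> absv (y $ first_idx $ i)"
            using d[of i] a(2) by (intro absv_ge_stable[OF _ i(3)]) (simp add: ci)
          then have "\<delta> * absv t \<le> absv (y $ first_idx $ i * t)" by (simp add: absv_mult mult_right_mono)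
          moreover have "absv (conj_mat ?g y $ first_idx $ last_idx) \<le> max (absv (x0 $ first_idx $ last_idx)) (absv a)"
            using absv_add_le[of "conj_mat ?g y $ first_idx $ last_idx - x0 $ first_idx $ last_idx"
              "max (absv (x0 $ first_idx $ last_idx)) (absv a)" "x0 $ first_idx $ last_idx"] d[of last_idx] by simp
          ultimately have "\<delta> * absv t \<le> max (absv (x0 $ first_idx $ last_idx)) (absv a)" by (simp add: cl)
          then show False using t \<delta>(1) by (auto simp: pos_divide_less_eq mult.commute le_max_iff_disj)
        qed
        then show ?thesis by (simp add: ind_def)
      qed
      then show ?thesis
        by (intro E[unfolded vanishes_outside_def, rule_format] schwartz_conj[OF g(2) n])
    qed
    finally show "T (ind ?S) = 0" .
  qed
  finally show "T f = 0" .
qed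

text \<open>With v = 0 on the support, a diagonal entry s at i acts on w_i alone: its only other
  effect is on v_i.\<close>

lemma vanishes_outside_columns:
  assumes E: "vanishes_outside T ({(first_idx, last_idx), (last_idx, first_idx)} \<union>
      {(first_idx, i) |i. i \<noteq> first_idx \<and> i \<noteq> last_idx})" (is "vanishes_outside T ?E")
    and S: "finite S" "S \<subseteq> UNIV - {first_idx, last_idx}"
  shows "vanishes_outside T ((\<lambda>i. (i, first_idx)) ` S \<union> ?E)"
  using S
proof (induction S)
  case empty
  then show ?case using E by simp
next
  case (insert i S)
  have "vanishes_outside T (insert (i, first_idx) ((\<lambda>i. (i, first_idx)) ` S \<union> ?E))"
  proof (rule vanishes_outside_insert_torus)
    show "vanishes_outside T ((\<lambda>i. (i, first_idx)) ` S \<union> ?E)" using insert by simp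
    fix s :: 'f assume "s \<noteq> 0"
    then show "\<exists>d :: 'n \<Rightarrow> 'f. (\<forall>i. d i \<noteq> 0) \<and> d last_idx = 1 \<and> d i = s * d first_idx \<and>
      (\<forall>k j. (k = first_idx) \<noteq> (j = first_idx) \<longrightarrow>
        (k, j) \<notin> insert (i, first_idx) ((\<lambda>i. (i, first_idx)) ` S \<union> ?E) \<longrightarrow> d k = d j)"
      using insert.prems by (intro exI[of _ "\<lambda>j. if j = i then s else 1"]) auto
  qed
  then show ?case by (simp only: image_insert Un_insert_left)
qed

theorem vanishes_away_from_zero:
  assumes zero: "T (ind (cyl (\<lambda>_. disc 0 1) (\<lambda>_. disc 0 1) {z. absv z = 1})) = 0"
    and f: "f \<in> schwartz N_1n" "f 0 = 0"
  shows "T f = 0"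
proof -
  let ?J = "UNIV - {first_idx, last_idx} :: 'n set"
  let ?E = "{(first_idx, last_idx), (last_idx, first_idx)} \<union> {(first_idx, i :: 'n) |i. i \<noteq> first_idx \<and> i \<noteq> last_idx}"
  \<comment> \<open>The diagonal matrix with 1 in the last place and s elsewhere fixes all middle
    entries and scales v_n by s. It also scales w_n, but w_n = 0 on the support.\<close>
  have "vanishes_outside T (insert (first_idx, last_idx) {(last_idx, first_idx)})"
  proof (rule vanishes_outside_insert_torus[OF vanishes_outside_last[OF zero]])
    fix s :: 'f assume "s \<noteq> 0"
    then show "\<exists>d :: 'n \<Rightarrow> 'f. (\<forall>i. d i \<noteq> 0) \<and> d last_idx = 1 \<and> d first_idx = s * d last_idx \<and>
      (\<forall>i j. (i = first_idx) \<noteq> (j = first_idx) \<longrightarrow>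
        (i, j) \<notin> insert (first_idx, last_idx) {(last_idx, first_idx)} \<longrightarrow> d i = d j)"
      using ne by (intro exI[of _ "\<lambda>j. if j = last_idx then 1 else s"]) auto
  qed
  then have "vanishes_outside T ((\<lambda>i. (i, first_idx)) ` ?J \<union> ?E)"
    by (intro vanishes_outside_columns vanishes_outside_unipotent) auto
  moreover have "f x = 0" if x: "x \<in> N_1n" "zero_at ((\<lambda>i. (i, first_idx)) ` ?J \<union> ?E) x" for x
  proof -
    have "x $ i $ j = 0" for i j
    proof (cases "(i = first_idx) = (j = first_idx)")
      case True
      then show ?thesis by (rule N_1n_pattern[OF x(1)])
    next
      case False
      then have "(i, j) \<in> (\<lambda>i. (i, first_idx)) ` ?J \<union> ?E" by auto
      then show ?thesis using x(2) unfolding zero_at_def by blast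
    qed
    then have "x = 0" by (simp add: vec_eq_iff)
    then show ?thesis using f(2) by simp
  qed
  ultimately show ?thesis using f(1) unfolding vanishes_outside_def by blast
qed

end

section \<open>The Haar functional on the off-diagonal block matrices\<close>

text \<open>For positive r these are compact open subgroups of the linear space
  \<open>pattern\<close>. Integration over that space is reduced to counting their cosets.\<close>

definition Lam :: "real \<Rightarrow> ('f::nonarch_local_field, 'n::{finite,linorder}) sqm set" where
  "Lam r = {x \<in> pattern. entries_le r x}"

definition coset :: "real \<Rightarrow> ('f::nonarch_local_field, 'n::{finite,linorder}) sqm \<Rightarrow> ('f, 'n) sqm set" where
  "coset r x = {y. y - x \<in> Lam r}"

lemma pattern_zero [simp]: "0 \<in> pattern"
  by (simp add: pattern_def)

lemma pattern_add: "x \<in> pattern \<Longrightarrow> y \<in> pattern \<Longrightarrow> x + y \<in> pattern"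
  by (simp add: pattern_def)

lemma pattern_diff: "x \<in> pattern \<Longrightarrow> y \<in> pattern \<Longrightarrow> x - y \<in> pattern"
  by (simp add: pattern_def)

lemma Lam_zero [simp]: "0 \<le> r \<Longrightarrow> 0 \<in> Lam r"
  by (simp add: Lam_def)

lemma Lam_add: "x \<in> Lam r \<Longrightarrow> y \<in> Lam r \<Longrightarrow> x + y \<in> Lam r"
  by (simp add: Lam_def pattern_add entries_le_add)

lemma Lam_diff: "x \<in> Lam r \<Longrightarrow> y \<in> Lam r \<Longrightarrow> x - y \<in> Lam r"
  by (simp add: Lam_def pattern_diff entries_le_diff)

lemma Lam_mono: "r \<le> s \<Longrightarrow> x \<in> Lam r \<Longrightarrow> x \<in> Lam s"
  using entries_le_mono by (auto simp: Lam_def)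

lemma Lam_max:
  shows Lam_max1: "x \<in> Lam r \<Longrightarrow> x \<in> Lam (max r s)" and Lam_max2: "x \<in> Lam s \<Longrightarrow> x \<in> Lam (max r s)"
  by (auto intro: Lam_mono[OF max.cobounded1] Lam_mono[OF max.cobounded2])

lemma Lam_pattern: "x \<in> Lam r \<Longrightarrow> x \<in> pattern"
  by (simp add: Lam_def)

lemma ex_Lam: assumes "x \<in> pattern" obtains R where "R > 0" "x \<in> Lam R"
proof -
  obtain R where "R > 0" "entries_le R x" using entries_le_ex by blast
  then show ?thesis using that assms by (simp add: Lam_def)
qed

lemma coset_self [simp]: "0 \<le> r \<Longrightarrow> x \<in> coset r x"
  by (simp add: coset_def)

lemma coset_eq: "y \<in> coset r x \<Longrightarrow> coset r y = coset r x"
  unfolding coset_def using Lam_add[of "_ - y" r "y - x"] Lam_diff[of "_ - x" r "y - x"] by auto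

lemma coset_zero [simp]: "coset r 0 = Lam r"
  by (simp add: coset_def)

lemma coset_translate: "coset r (t + x) = (+) t ` coset r x"
proof
  show "coset r (t + x) \<subseteq> (+) t ` coset r x"
  proof
    fix y assume "y \<in> coset r (t + x)"
    then have "y - t \<in> coset r x" by (simp add: coset_def algebra_simps)
    then show "y \<in> (+) t ` coset r x" by (intro image_eqI[of _ _ "y - t"]) auto
  qed
qed (auto simp: coset_def algebra_simps)

lemma finite_cosets:
  assumes "0 < r" "S \<subseteq> Lam R" shows "finite (coset r ` S)"
proof -
  have "coset r x = mat_box x r \<inter> pattern" if "x \<in> S" for x
  proof -
    have x: "x \<in> pattern" using assms(2) that by (auto simp: Lam_def)
    show ?thesis
      using pattern_diff[OF _ x] pattern_add[OF _ x] by (force simp: coset_def mat_box_def Lam_def)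
  qed
  then have "coset r ` S = (\<lambda>B. B \<inter> pattern) ` (\<lambda>x. mat_box x r) ` S" by (auto simp: image_image)
  moreover have "finite ((\<lambda>x. mat_box x r) ` S)"
    using assms by (intro finite_boxes[of _ R]) (auto simp: Lam_def)
  ultimately show ?thesis by simp
qed

definition inv_on :: "real \<Rightarrow> (('f::nonarch_local_field, 'n::{finite,linorder}) sqm \<Rightarrow> complex) \<Rightarrow> bool" where
  "inv_on r f \<longleftrightarrow> (\<forall>x y. y - x \<in> Lam r \<longrightarrow> f y = f x)"

text \<open>The Schwartz functions on the linear space \<open>pattern\<close>, extended by zero to
  all matrices.\<close>

definition test_fun :: "(('f::nonarch_local_field, 'n::{finite,linorder}) sqm \<Rightarrow> complex) \<Rightarrow> bool" where
  "test_fun f \<longleftrightarrow> (\<exists>r>0. inv_on r f) \<and> (\<exists>R. \<forall>x. f x \<noteq> 0 \<longrightarrow> x \<in> Lam R)"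

lemma inv_onD: "inv_on r f \<Longrightarrow> y - x \<in> Lam r \<Longrightarrow> f y = f x"
  unfolding inv_on_def by blast

lemma inv_on_mono: "inv_on r f \<Longrightarrow> s \<le> r \<Longrightarrow> inv_on s f"
  unfolding inv_on_def using Lam_mono by blast

lemma test_funI: "r > 0 \<Longrightarrow> inv_on r f \<Longrightarrow> (\<And>x. f x \<noteq> 0 \<Longrightarrow> x \<in> Lam R) \<Longrightarrow> test_fun f"
  unfolding test_fun_def by blast

lemma test_funE:
  assumes "test_fun f"
  obtains r R where "0 < r" "r \<le> 1" "inv_on r f" "1 \<le> R" "\<forall>x. f x \<noteq> 0 \<longrightarrow> x \<in> Lam R"
proof -
  obtain r R where rR: "r > 0" "inv_on r f" "\<forall>x. f x \<noteq> 0 \<longrightarrow> x \<in> Lam R"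
    using assms unfolding test_fun_def by blast
  show ?thesis
  proof (rule that[of "min 1 r" "max 1 R"])
    show "inv_on (min 1 r) f" using rR(2) by (rule inv_on_mono) simp
    show "\<forall>x. f x \<noteq> 0 \<longrightarrow> x \<in> Lam (max 1 R)" using rR(3) Lam_max by blast
  qed (use rR in auto)
qed

lemma test_fun_add:
  assumes "test_fun f" "test_fun g" shows "test_fun (\<lambda>x. f x + g x)"
proof -
  obtain r R where f: "0 < r" "inv_on r f" "\<forall>x. f x \<noteq> 0 \<longrightarrow> x \<in> Lam R" using assms(1) by (rule test_funE)
  obtain s S where g: "0 < s" "inv_on s g" "\<forall>x. g x \<noteq> 0 \<longrightarrow> x \<in> Lam S" using assms(2) by (rule test_funE)
  show ?thesis
  proof (rule test_funI[of "min r s" _ "max R S"])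
    show "inv_on (min r s) (\<lambda>x. f x + g x)"
      unfolding inv_on_def
    proof (intro allI impI)
      fix x y :: "('a, 'b) sqm" assume "y - x \<in> Lam (min r s)"
      then have "f y = f x" "g y = g x"
        using inv_onD[OF inv_on_mono[OF f(2), of "min r s"]] inv_onD[OF inv_on_mono[OF g(2), of "min r s"]] by auto
      then show "f y + g y = f x + g x" by simp
    qed
    fix x assume "f x + g x \<noteq> 0"
    then have "f x \<noteq> 0 \<or> g x \<noteq> 0" by auto
    then show "x \<in> Lam (max R S)" using f(3) g(3) Lam_max by blast
  qed (use f g in auto)
qed

lemma test_fun_comp:
  assumes "test_fun f" "c 0 = 0" shows "test_fun (\<lambda>x. c (f x))"
proof -
  obtain r R where f: "0 < r" "inv_on r f" "\<forall>x. f x \<noteq> 0 \<longrightarrow> x \<in> Lam R" using assms(1) by (rule test_funE)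
  show ?thesis
  proof (rule test_funI[of r _ R])
    show "inv_on r (\<lambda>x. c (f x))" using f(2) unfolding inv_on_def by metis
    fix x assume "c (f x) \<noteq> 0"
    then have "f x \<noteq> 0" using assms(2) by auto
    then show "x \<in> Lam R" using f(3) by blast
  qed (use f in auto)
qed

lemma test_fun_cmult: "test_fun f \<Longrightarrow> test_fun (\<lambda>x. c * f x)"
  using test_fun_comp[of f "(*) c"] by simp

lemma test_fun_zero: "test_fun (\<lambda>x. 0)"
  by (rule test_funI[of 1]) (auto simp: inv_on_def)

lemma test_fun_sum:
  assumes "\<And>i. i \<in> A \<Longrightarrow> test_fun (f i)" shows "test_fun (\<lambda>x. \<Sum>i\<in>A. f i x)"
  using assms by (induction A rule: infinite_finite_induct) (auto intro: test_fun_zero test_fun_add)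

lemma test_fun_diff: "test_fun f \<Longrightarrow> test_fun g \<Longrightarrow> test_fun (\<lambda>x. f x - g x)"
  using test_fun_add[of f "\<lambda>x. -1 * g x"] test_fun_cmult[of g "-1"] by simp

lemma test_fun_ind_coset:
  assumes "0 < r" "x \<in> pattern" shows "test_fun (ind (coset r x))"
proof -
  obtain R where R: "R > 0" "x \<in> Lam R" using assms(2) by (rule ex_Lam)
  show ?thesis
  proof (rule test_funI[of r _ "max r R"])
    have "y \<in> coset r x \<longleftrightarrow> z \<in> coset r x" if "y - z \<in> Lam r" for y z
      using Lam_add[of "y - z" r "z - x"] Lam_diff[of "y - x" r "y - z"] that by (auto simp: coset_def)
    then show "inv_on r (ind (coset r x))" unfolding inv_on_def ind_def by presburger
  next
    fix y assume "ind (coset r x) y \<noteq> 0"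
    then have "y - x \<in> Lam r" by (simp add: ind_def coset_def split: if_splits)
    then have "y - x \<in> Lam (max r R)" "x \<in> Lam (max r R)" using Lam_max R(2) by auto
    then show "y \<in> Lam (max r R)" using Lam_add[of "y - x" "max r R" x] by simp
  qed (use assms in auto)
qed

lemma test_fun_ind_Lam: "0 < r \<Longrightarrow> test_fun (ind (Lam r))"
  using test_fun_ind_coset[of r 0] by simp

lemma test_fun_translate:
  assumes "test_fun f" "t \<in> pattern" shows "test_fun (\<lambda>x. f (x + t))"
proof -
  obtain r R where f: "0 < r" "inv_on r f" "\<forall>x. f x \<noteq> 0 \<longrightarrow> x \<in> Lam R" using assms(1) by (rule test_funE)
  obtain S where S: "S > 0" "t \<in> Lam S" using assms(2) by (rule ex_Lam)
  show ?thesis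
  proof (rule test_funI[of r _ "max R S"])
    show "inv_on r (\<lambda>x. f (x + t))"
      unfolding inv_on_def by (intro allI impI inv_onD[OF f(2)]) simp
    fix x assume "f (x + t) \<noteq> 0"
    then have "x + t \<in> Lam R" using f(3) by blast
    then have "x + t \<in> Lam (max R S)" "t \<in> Lam (max R S)" using Lam_max S(2) by auto
    then show "x \<in> Lam (max R S)" using Lam_diff[of "x + t" "max R S" t] by simp
  qed (use f in auto)
qed

section \<open>Haar integration by counting cosets\<close>

definition coset_val :: "(('f::nonarch_local_field, 'n::{finite,linorder}) sqm \<Rightarrow> complex) \<Rightarrow> ('f, 'n) sqm set \<Rightarrow> complex" where
  "coset_val f C = f (SOME x. x \<in> C)"

text \<open>For f invariant under \<open>Lam r\<close>, this is the integral normalised so that each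
  coset of \<open>Lam r\<close> has mass 1.\<close>

definition hsum :: "real \<Rightarrow> (('f::nonarch_local_field, 'n::{finite,linorder}) sqm \<Rightarrow> complex) \<Rightarrow> complex" where
  "hsum r f = (\<Sum>C\<in>coset r ` {x. f x \<noteq> 0}. coset_val f C)"

lemma coset_val_coset: assumes "inv_on r f" "0 \<le> r" shows "coset_val f (coset r x) = f x"
proof -
  have "(SOME y. y \<in> coset r x) \<in> coset r x" using coset_self[OF assms(2)] by (rule someI)
  then show ?thesis unfolding coset_val_def by (intro inv_onD[OF assms(1)]) (simp add: coset_def)
qed

lemma hsum_superset:
  assumes f: "inv_on r f" "0 < r" and S: "finite (coset r ` S)" "{x. f x \<noteq> 0} \<subseteq> S"
  shows "hsum r f = (\<Sum>C\<in>coset r ` S. coset_val f C)"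
  unfolding hsum_def
proof (rule sum.mono_neutral_left)
  show "\<forall>C\<in>coset r ` S - coset r ` {x. f x \<noteq> 0}. coset_val f C = 0"
    using coset_val_coset[OF f(1)] f(2) by fastforce
qed (use S in auto)

lemma inj_image_translate: "inj ((`) ((+) (t::'g::group_add)))"
  by (intro injI) (simp add: inj_image_eq_iff)

lemma hsum_translate:
  assumes f: "inv_on r f" "0 < r"
  shows "hsum r (\<lambda>x. f (x + t)) = hsum r f"
proof -
  let ?h = "(`) ((+) t)"
  have inv: "inv_on r (\<lambda>x. f (x + t))"
    unfolding inv_on_def by (intro allI impI inv_onD[OF f(1)]) simp
  have "{x. f x \<noteq> 0} = (+) t ` {x. f (x + t) \<noteq> 0}"
  proof
    show "{x. f x \<noteq> 0} \<subseteq> (+) t ` {x. f (x + t) \<noteq> 0}"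
    proof
      fix x assume "x \<in> {x. f x \<noteq> 0}"
      then show "x \<in> (+) t ` {x. f (x + t) \<noteq> 0}" by (intro image_eqI[of _ _ "x - t"]) auto
    qed
  qed (auto simp: add.commute)
  then have "coset r ` {x. f x \<noteq> 0} = ?h ` coset r ` {x. f (x + t) \<noteq> 0}"
    by (simp add: image_image coset_translate)
  then have "hsum r f = (\<Sum>C\<in>coset r ` {x. f (x + t) \<noteq> 0}. coset_val f (?h C))"
    unfolding hsum_def using inj_image_translate[of t] by (simp add: sum.reindex inj_on_subset[of _ UNIV] o_def)
  also have "\<dots> = hsum r (\<lambda>x. f (x + t))"
    unfolding hsum_def
  proof (intro sum.cong refl)
    fix C assume "C \<in> coset r ` {x. f (x + t) \<noteq> 0}"
    then obtain x where x: "C = coset r x" by blast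
    have "coset_val f (?h C) = f (t + x)"
      using coset_val_coset[OF f(1), of "t + x"] f(2) by (simp add: x coset_translate)
    then show "coset_val f (?h C) = coset_val (\<lambda>x. f (x + t)) C"
      using coset_val_coset[OF inv, of x] f(2) by (simp add: x add.commute)
  qed
  finally show ?thesis by simp
qed

text \<open>All cosets of the coarse lattice are translates of it, so each splits into the same
  number of fine cosets, and f is constant on each coarse one.\<close>

lemma hsum_refine:
  fixes f :: "('f::nonarch_local_field, 'n::{finite,linorder}) sqm \<Rightarrow> complex"
  assumes f: "inv_on r f" and r: "0 < s" "s \<le> r" and R: "\<forall>x. f x \<noteq> 0 \<longrightarrow> x \<in> Lam R"
  shows "hsum s f = of_nat (card (coset s ` (Lam r :: ('f, 'n) sqm set))) * hsum r f"
    (is "_ = of_nat ?n * _")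
proof -
  let ?S = "{x::('f,'n) sqm. f x \<noteq> 0}"
  have r0: "0 < r" using r by simp
  have sub: "C \<subseteq> ?S" if C: "C \<in> coset r ` ?S" for C
  proof
    fix y assume "y \<in> C"
    moreover obtain x where "x \<in> ?S" "C = coset r x" using C by blast
    ultimately show "y \<in> ?S" using inv_onD[OF f, of y x] by (simp add: coset_def)
  qed
  have un: "coset s ` ?S = (\<Union>C\<in>coset r ` ?S. coset s ` C)"
  proof
    show "coset s ` ?S \<subseteq> (\<Union>C\<in>coset r ` ?S. coset s ` C)"
    proof
      fix D assume "D \<in> coset s ` ?S"
      then obtain x where "x \<in> ?S" "D = coset s x" by blast
      moreover have "x \<in> coset r x" using r0 by simp
      ultimately show "D \<in> (\<Union>C\<in>coset r ` ?S. coset s ` C)" by blast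
    qed
    show "(\<Union>C\<in>coset r ` ?S. coset s ` C) \<subseteq> coset s ` ?S" using sub by blast
  qed
  have SR: "?S \<subseteq> Lam R" using R by blast
  have dj: "coset s ` C \<inter> coset s ` C' = {}"
    if C: "C \<in> coset r ` ?S" "C' \<in> coset r ` ?S" "C \<noteq> C'" for C C'
  proof (rule ccontr)
    assume "coset s ` C \<inter> coset s ` C' \<noteq> {}"
    then obtain y z where yz: "y \<in> C" "z \<in> C'" "coset s y = coset s z" by blast
    have "y \<in> coset s z" using coset_self[of s y] yz(3) r by simp
    then have "y \<in> coset r z" using Lam_mono[OF r(2)] by (simp add: coset_def)
    then have "coset r y = coset r z" by (rule coset_eq)
    moreover have "coset r y = C" "coset r z = C'" using C yz coset_eq by blast+
    ultimately show False using C(3) by simp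
  qed
  have "hsum s f = (\<Sum>C\<in>coset r ` ?S. \<Sum>D\<in>coset s ` C. coset_val f D)"
    unfolding hsum_def un
  proof (rule sum.UNION_disjoint)
    show "finite (coset r ` ?S)" using finite_cosets[OF r0 SR] .
    show "\<forall>C\<in>coset r ` ?S. finite (coset s ` C)" using finite_cosets[OF r(1)] sub SR by blast
    show "\<forall>C\<in>coset r ` ?S. \<forall>C'\<in>coset r ` ?S. C \<noteq> C' \<longrightarrow> coset s ` C \<inter> coset s ` C' = {}"
      using dj by blast
  qed
  also have "\<dots> = (\<Sum>C\<in>coset r ` ?S. of_nat ?n * coset_val f C)"
  proof (intro sum.cong refl)
    fix C assume C: "C \<in> coset r ` ?S"
    then obtain x where x: "x \<in> ?S" "C = coset r x" by blast
    have "(\<Sum>D\<in>coset s ` C. coset_val f D) = (\<Sum>D\<in>coset s ` C. f x)"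
    proof (intro sum.cong refl)
      fix D assume "D \<in> coset s ` C"
      then obtain y where y: "y \<in> C" "D = coset s y" by blast
      then have "coset_val f D = f y" using coset_val_coset[OF inv_on_mono[OF f r(2)]] r(1) by simp
      also have "f y = f x" using y x(2) by (intro inv_onD[OF f]) (simp add: coset_def)
      finally show "coset_val f D = f x" .
    qed
    moreover have "coset s ` C = (`) ((+) x) ` coset s ` Lam r"
    proof -
      have "C = (+) x ` Lam r" using x coset_translate[of r x 0] by simp
      then show ?thesis by (simp add: image_image coset_translate)
    qed
    then have "card (coset s ` C) = ?n"
      using card_image[OF inj_on_subset[OF inj_image_translate[of x]], of "coset s ` Lam r"] by simp
    ultimately show "(\<Sum>D\<in>coset s ` C. coset_val f D) = of_nat ?n * coset_val f C"
      using coset_val_coset[OF f, of x] r0 x(2) by simp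
  qed
  finally show ?thesis by (simp add: hsum_def sum_distrib_left)
qed

text \<open>The index of \<open>Lam r\<close> in \<open>Lam 1\<close> when r is at most 1. The type
  argument carries the field and the matrix size, which r does not determine.\<close>

definition lat_index :: "('f::nonarch_local_field, 'n::{finite,linorder}) sqm itself \<Rightarrow> real \<Rightarrow> nat" where
  "lat_index _ r = card (coset r ` (Lam 1 :: ('f, 'n) sqm set))"

text \<open>The Haar integral giving \<open>Lam 1\<close> mass 1, computed at some admissible level
  r; \<open>haar_eq\<close> shows that the level does not matter.\<close>

definition haar :: "(('f::nonarch_local_field, 'n::{finite,linorder}) sqm \<Rightarrow> complex) \<Rightarrow> complex" where
  "haar f = (let r = (SOME r. 0 < r \<and> r \<le> 1 \<and> inv_on r f)
     in hsum r f / of_nat (lat_index TYPE(('f, 'n) sqm) r))"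

lemma lat_index_pos: assumes "0 < r" shows "0 < lat_index TYPE(('f::nonarch_local_field, 'n::{finite,linorder}) sqm) r"
proof -
  have "finite (coset r ` (Lam 1 :: ('f, 'n) sqm set))" by (rule finite_cosets[OF assms, of _ 1]) simp
  moreover have "(0 :: ('f, 'n) sqm) \<in> Lam 1" by simp
  ultimately show ?thesis unfolding lat_index_def card_gt_0_iff by blast
qed

lemma inv_on_ind_Lam:
  assumes "s \<le> r" shows "inv_on s (ind (Lam r))"
  unfolding inv_on_def
proof (intro allI impI)
  fix x y :: "('a, 'b) sqm" assume "y - x \<in> Lam s"
  then have "y - x \<in> Lam r" using Lam_mono[OF assms] by blast
  then have "x \<in> Lam r \<longleftrightarrow> y \<in> Lam r" using Lam_add[of "y - x" r x] Lam_diff[of y r "y - x"] by auto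
  then show "ind (Lam r) y = ind (Lam r) x" by (simp add: ind_def)
qed

lemma hsum_ind_Lam:
  assumes "0 < r" "r \<le> 1"
  shows "hsum r (ind (Lam 1 :: ('f::nonarch_local_field, 'n::{finite,linorder}) sqm set)) =
    of_nat (lat_index TYPE(('f, 'n) sqm) r)"
proof -
  have "{x. ind (Lam 1 :: ('f, 'n) sqm set) x \<noteq> 0} = Lam 1" by (auto simp: ind_def)
  then have "hsum r (ind (Lam 1 :: ('f, 'n) sqm set)) = (\<Sum>C\<in>coset r ` (Lam 1 :: ('f, 'n) sqm set). 1)"
    unfolding hsum_def
  proof (intro sum.cong)
    fix C assume "C \<in> coset r ` (Lam 1 :: ('f, 'n) sqm set)"
    then obtain x :: "('f, 'n) sqm" where x: "x \<in> Lam 1" "C = coset r x" by blast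
    then show "coset_val (ind (Lam 1)) C = 1"
      using coset_val_coset[OF inv_on_ind_Lam[OF assms(2)], of x] assms(1) by (simp add: ind_def)
  qed simp
  then show ?thesis by (simp add: lat_index_def)
qed

text \<open>Refining the level multiplies numerator and denominator by the same integer, so any two
  levels agree with the finer of them.\<close>

lemma haar_eq:
  fixes f :: "('f::nonarch_local_field, 'n::{finite,linorder}) sqm \<Rightarrow> complex"
  assumes "0 < r" "r \<le> 1" "inv_on r f" and R: "\<forall>x. f x \<noteq> 0 \<longrightarrow> x \<in> Lam R"
  shows "haar f = hsum r f / of_nat (lat_index TYPE(('f, 'n) sqm) r)"
proof -
  have *: "hsum s f / of_nat (lat_index TYPE(('f, 'n) sqm) s) = hsum r f / of_nat (lat_index TYPE(('f, 'n) sqm) r)"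
    if s: "0 < s" "s \<le> r" "r \<le> 1" "inv_on r f" for r s
  proof -
    let ?n = "card (coset s ` (Lam r :: ('f, 'n) sqm set))"
    have "hsum s f = of_nat ?n * hsum r f" by (rule hsum_refine[OF s(4,1,2) R])
    \<comment> \<open>The index is itself an \<open>hsum\<close>, that of the indicator of
      \<open>Lam 1\<close>, so \<open>hsum_refine\<close> also describes how it grows.\<close>
    moreover have "complex_of_nat (lat_index TYPE(('f, 'n) sqm) s) = of_nat ?n * of_nat (lat_index TYPE(('f, 'n) sqm) r)"
    proof -
      have "hsum s (ind (Lam 1 :: ('f, 'n) sqm set)) = of_nat ?n * hsum r (ind (Lam 1 :: ('f, 'n) sqm set))"
        by (rule hsum_refine[where R=1, OF inv_on_ind_Lam[OF s(3)] s(1,2)]) (simp add: ind_def)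
      then show ?thesis using hsum_ind_Lam[of s, where 'f='f and 'n='n] hsum_ind_Lam[of r, where 'f='f and 'n='n] s by simp
    qed
    moreover have "?n \<noteq> 0"
    proof -
      have "finite (coset s ` (Lam r :: ('f, 'n) sqm set))" by (rule finite_cosets[OF s(1), of _ r]) simp
      moreover have "(0 :: ('f, 'n) sqm) \<in> Lam r" using s by simp
      ultimately show ?thesis by auto
    qed
    ultimately show ?thesis by simp
  qed
  let ?r = "SOME r. 0 < r \<and> r \<le> 1 \<and> inv_on r f"
  have q: "0 < ?r \<and> ?r \<le> 1 \<and> inv_on ?r f" by (rule someI[of _ r]) (use assms in simp)
  have "haar f = hsum ?r f / of_nat (lat_index TYPE(('f, 'n) sqm) ?r)" by (simp add: haar_def Let_def)
  also have "\<dots> = hsum (min ?r r) f / of_nat (lat_index TYPE(('f, 'n) sqm) (min ?r r))"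
    by (rule *[symmetric]) (use q assms in auto)
  also have "\<dots> = hsum r f / of_nat (lat_index TYPE(('f, 'n) sqm) r)"
    by (rule *) (use q assms in auto)
  finally show ?thesis .
qed

lemma haar_add:
  fixes f g :: "('f::nonarch_local_field, 'n::{finite,linorder}) sqm \<Rightarrow> complex"
  assumes "test_fun f" "test_fun g" shows "haar (\<lambda>x. f x + g x) = haar f + haar g"
proof -
  obtain r R where f: "0 < r" "r \<le> 1" "inv_on r f" "1 \<le> R" "\<forall>x. f x \<noteq> 0 \<longrightarrow> x \<in> Lam R" using assms(1) by (rule test_funE)
  obtain s S where g: "0 < s" "s \<le> 1" "inv_on s g" "1 \<le> S" "\<forall>x. g x \<noteq> 0 \<longrightarrow> x \<in> Lam S" using assms(2) by (rule test_funE)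
  let ?r = "min r s" and ?L = "Lam (max R S) :: ('f, 'n) sqm set"
  have r: "0 < ?r" "?r \<le> 1" using f g by auto
  have i: "inv_on ?r f" "inv_on ?r g" by (rule inv_on_mono[OF f(3)], simp, rule inv_on_mono[OF g(3)], simp)
  have ifg: "inv_on ?r (\<lambda>x. f x + g x)" using i unfolding inv_on_def by metis
  have b: "\<forall>x. f x \<noteq> 0 \<longrightarrow> x \<in> ?L" "\<forall>x. g x \<noteq> 0 \<longrightarrow> x \<in> ?L"
    using f(5) g(5) Lam_max by blast+
  have bfg: "\<forall>x. f x + g x \<noteq> 0 \<longrightarrow> x \<in> ?L"
  proof (intro allI impI)
    fix x assume "f x + g x \<noteq> 0"
    then have "f x \<noteq> 0 \<or> g x \<noteq> 0" by auto
    then show "x \<in> ?L" using b by blast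
  qed
  have fin: "finite (coset ?r ` ?L)" by (rule finite_cosets[OF r(1) order_refl])
  have "hsum ?r (\<lambda>x. f x + g x) = (\<Sum>C\<in>coset ?r ` ?L. coset_val (\<lambda>x. f x + g x) C)"
    using bfg by (intro hsum_superset ifg r fin) auto
  also have "\<dots> = (\<Sum>C\<in>coset ?r ` ?L. coset_val f C) + (\<Sum>C\<in>coset ?r ` ?L. coset_val g C)"
    by (simp add: coset_val_def sum.distrib)
  also have "\<dots> = hsum ?r f + hsum ?r g"
    using b by (intro arg_cong2[of _ _ _ _ "(+)"] hsum_superset[symmetric] i r fin) auto
  finally show ?thesis
    using haar_eq[OF r i(1) b(1)] haar_eq[OF r i(2) b(2)] haar_eq[OF r ifg bfg] by (simp add: add_divide_distrib)
qed

lemma haar_cmult: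
  fixes f :: "('f::nonarch_local_field, 'n::{finite,linorder}) sqm \<Rightarrow> complex"
  assumes "test_fun f" shows "haar (\<lambda>x. c * f x) = c * haar f"
proof -
  obtain r R where f: "0 < r" "r \<le> 1" "inv_on r f" "1 \<le> R" "\<forall>x. f x \<noteq> 0 \<longrightarrow> x \<in> Lam R" using assms by (rule test_funE)
  have i: "inv_on r (\<lambda>x. c * f x)" using f(3) unfolding inv_on_def by metis
  have b: "\<forall>x. c * f x \<noteq> 0 \<longrightarrow> x \<in> Lam R" using f(5) by auto
  have "hsum r (\<lambda>x. c * f x) = (\<Sum>C\<in>coset r ` {x. f x \<noteq> 0}. coset_val (\<lambda>x. c * f x) C)"
    using f(5) by (intro hsum_superset i f(1) finite_cosets[of r _ R]) auto
  also have "\<dots> = c * hsum r f" by (simp add: hsum_def coset_val_def sum_distrib_left)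
  finally show ?thesis using haar_eq[OF f(1,2,3,5)] haar_eq[OF f(1,2) i b] by simp
qed

lemma haar_zero: "haar (\<lambda>x. 0) = 0"
  using haar_cmult[OF test_fun_zero, of 0] by simp

lemma haar_sum:
  assumes "\<And>i. i \<in> A \<Longrightarrow> test_fun (f i)" shows "haar (\<lambda>x. \<Sum>i\<in>A. f i x) = (\<Sum>i\<in>A. haar (f i))"
  using assms by (induction A rule: infinite_finite_induct) (auto simp: haar_zero haar_add test_fun_sum)

lemma haar_diff: "test_fun f \<Longrightarrow> test_fun g \<Longrightarrow> haar (\<lambda>x. f x - g x) = haar f - haar g"
  using haar_add[of f "\<lambda>x. -1 * g x"] haar_cmult[of g "-1"] test_fun_cmult[of g "-1"] by simp

lemma haar_translate:
  assumes f: "test_fun f" and t: "t \<in> pattern" shows "haar (\<lambda>x. f (x + t)) = haar f"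
proof -
  obtain r R where r: "0 < r" "r \<le> 1" "inv_on r f" "1 \<le> R" "\<forall>x. f x \<noteq> 0 \<longrightarrow> x \<in> Lam R" using f by (rule test_funE)
  obtain S where S: "\<forall>x. f (x + t) \<noteq> 0 \<longrightarrow> x \<in> Lam S" using test_fun_translate[OF f t] by (rule test_funE)
  have i: "inv_on r (\<lambda>x. f (x + t))" unfolding inv_on_def by (intro allI impI inv_onD[OF r(3)]) simp
  show ?thesis using haar_eq[OF r(1,2,3,5)] haar_eq[OF r(1,2) i S] hsum_translate[OF r(3,1)] by simp
qed

lemma haar_nonneg:
  assumes f: "test_fun f" and p: "\<And>x. f x \<in> \<real>" "\<And>x. 0 \<le> Re (f x)"
  shows "haar f \<in> \<real>" "0 \<le> Re (haar f)"
proof -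
  obtain r R where r: "0 < r" "r \<le> 1" "inv_on r f" "1 \<le> R" "\<forall>x. f x \<noteq> 0 \<longrightarrow> x \<in> Lam R" using f by (rule test_funE)
  have "hsum r f \<in> \<real>" unfolding hsum_def coset_val_def using p by (intro sum_in_Reals) auto
  moreover have "0 \<le> Re (hsum r f)" unfolding hsum_def coset_val_def Re_sum using p by (intro sum_nonneg) auto
  ultimately show "haar f \<in> \<real>" "0 \<le> Re (haar f)"
    unfolding haar_eq[OF r(1,2,3,5)] by (simp_all add: Re_divide_of_nat)
qed

lemma haar_ind_coset:
  assumes "0 < r" "r \<le> 1" "(x :: ('f::nonarch_local_field, 'n::{finite,linorder}) sqm) \<in> pattern"
  shows "haar (ind (coset r x)) = 1 / of_nat (lat_index TYPE(('f, 'n) sqm) r)"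
proof -
  have "haar (ind (coset r x)) = haar (\<lambda>y. ind (coset r x) (y + x))"
    by (rule haar_translate[symmetric]) (use assms in \<open>auto intro: test_fun_ind_coset\<close>)
  also have "(\<lambda>y. ind (coset r x) (y + x)) = ind (Lam r)" by (auto simp: fun_eq_iff ind_def coset_def)
  also have "haar (ind (Lam r :: ('f, 'n) sqm set)) = hsum r (ind (Lam r :: ('f, 'n) sqm set)) / of_nat (lat_index TYPE(('f, 'n) sqm) r)"
    using assms by (intro haar_eq[where R=r] inv_on_ind_Lam) (auto simp: ind_def)
  also have "hsum r (ind (Lam r :: ('f, 'n) sqm set)) = 1"
  proof -
    have "{x. ind (Lam r :: ('f, 'n) sqm set) x \<noteq> 0} = Lam r" by (auto simp: ind_def)
    moreover have "coset r ` (Lam r :: ('f, 'n) sqm set) = {coset r 0}"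
    proof
      show "coset r ` (Lam r :: ('f, 'n) sqm set) \<subseteq> {coset r 0}"
        using coset_eq[of _ r 0] by auto
      show "{coset r 0} \<subseteq> coset r ` (Lam r :: ('f, 'n) sqm set)"
        using assms(1) by (auto intro!: image_eqI[of _ _ 0] simp del: coset_zero)
    qed
    ultimately have "hsum r (ind (Lam r :: ('f, 'n) sqm set)) = coset_val (ind (Lam r)) (coset r (0 :: ('f, 'n) sqm))"
      unfolding hsum_def by simp
    also have "\<dots> = 1" using coset_val_coset[OF inv_on_ind_Lam[OF order_refl], of r 0] assms(1) by (simp add: ind_def)
    finally show ?thesis .
  qed
  finally show ?thesis .
qed

lemma haar_ind_Lam_1: "haar (ind (Lam 1 :: ('f::nonarch_local_field, 'n::{finite,linorder}) sqm set)) = 1"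
proof -
  have "haar (ind (Lam 1 :: ('f, 'n) sqm set)) =
      hsum 1 (ind (Lam 1 :: ('f, 'n) sqm set)) / of_nat (lat_index TYPE(('f, 'n) sqm) 1)"
    by (intro haar_eq[where R=1] inv_on_ind_Lam) (auto simp: ind_def)
  then show ?thesis using hsum_ind_Lam[of 1, where 'f='f and 'n='n] lat_index_pos[of 1, where 'f='f and 'n='n] by simp
qed

lemma test_fun_decompose:
  assumes f: "inv_on r f" "0 < r" "\<forall>x. f x \<noteq> 0 \<longrightarrow> x \<in> Lam R"
  shows "f x = (\<Sum>C\<in>coset r ` {x. f x \<noteq> 0}. coset_val f C * ind C x)"
proof -
  let ?S = "{x. f x \<noteq> 0}"
  have fin: "finite (coset r ` ?S)" using f by (intro finite_cosets[of r _ R]) auto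
  have mem: "C = coset r x" if "C \<in> coset r ` ?S" "x \<in> C" for C using that coset_eq by blast
  show ?thesis
  proof (cases "f x = 0")
    case True
    have "coset_val f C * ind C x = 0" if C: "C \<in> coset r ` ?S" for C
    proof (cases "x \<in> C")
      case t: True
      then show ?thesis using mem[OF C t] coset_val_coset[OF f(1), of x] f(2) True by simp
    qed (simp add: ind_def)
    then have "(\<Sum>C\<in>coset r ` ?S. coset_val f C * ind C x) = 0" by (intro sum.neutral) blast
    then show ?thesis using True by simp
  next
    case False
    have "(\<Sum>C\<in>coset r ` ?S. coset_val f C * ind C x) = (\<Sum>C\<in>{coset r x}. coset_val f C * ind C x)"
      using False fin mem by (intro sum.mono_neutral_right) (auto simp: ind_def)
    also have "\<dots> = f x" using coset_val_coset[OF f(1), of x] f(2) by (simp add: ind_def)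
    finally show ?thesis by simp
  qed
qed

text \<open>Translation gives J one value on all cosets of a level. That value is fixed by J on
  \<open>Lam 1\<close>, a disjoint union of \<open>lat_index\<close> many such cosets.\<close>

lemma haar_unique:
  fixes J :: "(('f::nonarch_local_field, 'n::{finite,linorder}) sqm \<Rightarrow> complex) \<Rightarrow> complex"
  assumes add: "\<And>f g. test_fun f \<Longrightarrow> test_fun g \<Longrightarrow> J (\<lambda>x. f x + g x) = J f + J g"
    and cmult: "\<And>c f. test_fun f \<Longrightarrow> J (\<lambda>x. c * f x) = c * J f"
    and trans: "\<And>f t. test_fun f \<Longrightarrow> t \<in> pattern \<Longrightarrow> J (\<lambda>x. f (x + t)) = J f"
    and f: "test_fun f"
  shows "J f = J (ind (Lam 1)) * haar f"
proof -
  have J0: "J (\<lambda>x. 0) = 0" using cmult[OF test_fun_zero, of 0] by simp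
  have Jsum: "J (\<lambda>x. \<Sum>i\<in>A. h i x) = (\<Sum>i\<in>A. J (h i))" if "\<And>i. i \<in> A \<Longrightarrow> test_fun (h i)"
    for A :: "('f, 'n) sqm set set" and h
    using that by (induction A rule: infinite_finite_induct) (auto simp: J0 add test_fun_sum)
  have J: "J g = hsum r g * J (ind (Lam r))"
    if r: "0 < r" "r \<le> 1" "inv_on r g" and R: "\<forall>x. g x \<noteq> 0 \<longrightarrow> x \<in> Lam R" for g r R
  proof -
    let ?C = "coset r ` {x. g x \<noteq> 0}"
    have C: "test_fun (ind C)" "J (ind C) = J (ind (Lam r))" if C: "C \<in> ?C" for C
    proof -
      obtain x where x: "g x \<noteq> 0" "C = coset r x" using C by blast
      have xp: "x \<in> pattern" using R x(1) Lam_pattern by blast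
      show "test_fun (ind C)" using test_fun_ind_coset[OF r(1) xp] x(2) by simp
      have "J (ind C) = J (\<lambda>y. ind C (y + x))" using trans[OF \<open>test_fun (ind C)\<close> xp] by simp
      also have "(\<lambda>y. ind C (y + x)) = ind (Lam r)" by (auto simp: fun_eq_iff ind_def coset_def x(2))
      finally show "J (ind C) = J (ind (Lam r))" .
    qed
    have "g = (\<lambda>x. \<Sum>C\<in>?C. coset_val g C * ind C x)" by (rule ext) (rule test_fun_decompose[OF r(3,1) R])
    then have "J g = J (\<lambda>x. \<Sum>C\<in>?C. coset_val g C * ind C x)" by (rule arg_cong)
    also have "\<dots> = (\<Sum>C\<in>?C. J (\<lambda>x. coset_val g C * ind C x))" by (intro Jsum test_fun_cmult C)
    also have "\<dots> = (\<Sum>C\<in>?C. coset_val g C * J (ind (Lam r)))"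
      by (intro sum.cong refl) (simp add: cmult C)
    finally show ?thesis by (simp add: hsum_def sum_distrib_right)
  qed
  obtain r R where r: "0 < r" "r \<le> 1" "inv_on r f" "1 \<le> R" "\<forall>x. f x \<noteq> 0 \<longrightarrow> x \<in> Lam R" using f by (rule test_funE)
  have "J (ind (Lam 1)) = hsum r (ind (Lam 1 :: ('f, 'n) sqm set)) * J (ind (Lam r))"
    by (rule J[where R=1]) (use r in \<open>auto simp: ind_def intro: inv_on_ind_Lam\<close>)
  then have "J (ind (Lam 1)) = of_nat (lat_index TYPE(('f, 'n) sqm) r) * J (ind (Lam r))"
    using hsum_ind_Lam[OF r(1,2), where 'f='f and 'n='n] by simp
  then show ?thesis
    using J[OF r(1,2,3,5)] haar_eq[OF r(1,2,3,5)] lat_index_pos[OF r(1), where 'f='f and 'n='n] by simp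
qed

section \<open>Invariance of the Haar functional under conjugation\<close>

text \<open>Additivity and this bound cover conjugations, transposition and homotheties; for a map
  with an inverse of the same kind they make precomposition preserve test functions.\<close>

definition lat_hom :: "(('f::nonarch_local_field, 'n::{finite,linorder}) sqm \<Rightarrow> ('f, 'n) sqm) \<Rightarrow> bool" where
  "lat_hom \<phi> \<longleftrightarrow> (\<forall>x y. \<phi> (x + y) = \<phi> x + \<phi> y) \<and> (\<exists>C>0. \<forall>r\<ge>0. \<forall>x\<in>Lam r. \<phi> x \<in> Lam (C * r))"

definition lat_auto :: "(('f::nonarch_local_field, 'n::{finite,linorder}) sqm \<Rightarrow> ('f, 'n) sqm) \<Rightarrow>
    (('f, 'n) sqm \<Rightarrow> ('f, 'n) sqm) \<Rightarrow> bool" where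
  "lat_auto \<phi> \<psi> \<longleftrightarrow> lat_hom \<phi> \<and> lat_hom \<psi> \<and> (\<forall>x. \<phi> (\<psi> x) = x) \<and> (\<forall>x. \<psi> (\<phi> x) = x)"

text \<open>The mass of the preimage of \<open>Lam 1\<close>, that is, the factor by which
  precomposition with \<phi> changes the Haar functional.\<close>

definition modulus :: "(('f::nonarch_local_field, 'n::{finite,linorder}) sqm \<Rightarrow> ('f, 'n) sqm) \<Rightarrow> complex" where
  "modulus \<phi> = haar (\<lambda>x. ind (Lam 1) (\<phi> x))"

lemma lat_hom_diff: assumes "lat_hom \<phi>" shows "\<phi> (x - y) = \<phi> x - \<phi> y"
proof -
  have "\<phi> (x - y + y) = \<phi> (x - y) + \<phi> y" using assms unfolding lat_hom_def by blast
  then show ?thesis by simp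
qed

lemma lat_hom_pattern: assumes "lat_hom \<phi>" "x \<in> pattern" shows "\<phi> x \<in> pattern"
proof -
  obtain R where R: "R > 0" "x \<in> Lam R" using assms(2) by (rule ex_Lam)
  obtain C where "\<forall>r\<ge>0. \<forall>x\<in>Lam r. \<phi> x \<in> Lam (C * r)" using assms(1) unfolding lat_hom_def by blast
  then have "\<phi> x \<in> Lam (C * R)" using R by simp
  then show ?thesis by (rule Lam_pattern)
qed

lemma test_fun_lat_auto:
  assumes \<phi>: "lat_auto \<phi> \<psi>" and f: "test_fun f" shows "test_fun (\<lambda>x. f (\<phi> x))"
proof -
  obtain r R where r: "0 < r" "r \<le> 1" "inv_on r f" "1 \<le> R" "\<forall>x. f x \<noteq> 0 \<longrightarrow> x \<in> Lam R" using f by (rule test_funE)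
  have hom: "lat_hom \<phi>" "lat_hom \<psi>" using \<phi> by (auto simp: lat_auto_def)
  obtain C where C: "C > 0" "\<forall>r\<ge>0. \<forall>x\<in>Lam r. \<phi> x \<in> Lam (C * r)" using hom(1) unfolding lat_hom_def by blast
  obtain D where D: "D > 0" "\<forall>r\<ge>0. \<forall>x\<in>Lam r. \<psi> x \<in> Lam (D * r)" using hom(2) unfolding lat_hom_def by blast
  show ?thesis
  proof (rule test_funI[of "r / C" _ "D * R"])
    show "inv_on (r / C) (\<lambda>x. f (\<phi> x))"
      unfolding inv_on_def
    proof (intro allI impI)
      fix x y :: "('a, 'b) sqm" assume "y - x \<in> Lam (r / C)"
      moreover have "0 \<le> r / C" using r C by simp
      ultimately have "\<phi> (y - x) \<in> Lam (C * (r / C))" using C(2) by blast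
      then have "\<phi> y - \<phi> x \<in> Lam r" using C(1) by (simp add: lat_hom_diff[OF hom(1)])
      then show "f (\<phi> y) = f (\<phi> x)" by (rule inv_onD[OF r(3)])
    qed
    fix x assume "f (\<phi> x) \<noteq> 0"
    then have "\<phi> x \<in> Lam R" using r(5) by blast
    then have "\<psi> (\<phi> x) \<in> Lam (D * R)" using D(2) r(4) by simp
    then show "x \<in> Lam (D * R)" using \<phi> by (simp add: lat_auto_def)
  qed (use r C in simp)
qed

text \<open>Precomposing with \<phi> leaves the functional translation invariant, because shifting
  by t after \<phi> is shifting by \<psi> t before it. Uniqueness then gives a scalar.\<close>

lemma haar_lat_auto:
  assumes \<phi>: "lat_auto \<phi> \<psi>" and f: "test_fun f"
  shows "haar (\<lambda>x. f (\<phi> x)) = modulus \<phi> * haar f"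
  unfolding modulus_def
proof (rule haar_unique[OF _ _ _ f, of "\<lambda>f. haar (\<lambda>x. f (\<phi> x))"])
  fix f g :: "('a, 'b) sqm \<Rightarrow> complex" assume "test_fun f" "test_fun g"
  then show "haar (\<lambda>x. f (\<phi> x) + g (\<phi> x)) = haar (\<lambda>x. f (\<phi> x)) + haar (\<lambda>x. g (\<phi> x))"
    by (intro haar_add test_fun_lat_auto[OF \<phi>])
next
  fix c and f :: "('a, 'b) sqm \<Rightarrow> complex" assume "test_fun f"
  then show "haar (\<lambda>x. c * f (\<phi> x)) = c * haar (\<lambda>x. f (\<phi> x))"
    by (intro haar_cmult test_fun_lat_auto[OF \<phi>])
next
  fix t and f :: "('a, 'b) sqm \<Rightarrow> complex" assume f: "test_fun f" and t: "(t :: ('a, 'b) sqm) \<in> pattern"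
  have hom: "lat_hom \<phi>" "lat_hom \<psi>" "\<phi> (\<psi> t) = t" using \<phi> by (auto simp: lat_auto_def)
  have "\<phi> (x + \<psi> t) = \<phi> x + t" for x using hom unfolding lat_hom_def by metis
  then have "(\<lambda>x. f (\<phi> x + t)) = (\<lambda>x. f (\<phi> (x + \<psi> t)))" by simp
  then show "haar (\<lambda>x. f (\<phi> x + t)) = haar (\<lambda>x. f (\<phi> x))"
    using haar_translate[OF test_fun_lat_auto[OF \<phi> f] lat_hom_pattern[OF hom(2) t]] by simp
qed

lemma modulus_compose:
  assumes "lat_auto \<phi> \<phi>'" "lat_auto \<psi> \<psi>'"
  shows "modulus (\<lambda>x. \<phi> (\<psi> x)) = modulus \<phi> * modulus \<psi>"
  using haar_lat_auto[OF assms(2) test_fun_lat_auto[OF assms(1) test_fun_ind_Lam[of 1]]]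
  by (simp add: modulus_def)

lemma modulus_id: "modulus (\<lambda>x. x) = 1"
  by (simp add: modulus_def haar_ind_Lam_1)

lemma modulus_nonneg:
  assumes "lat_auto \<phi> \<psi>" shows "modulus \<phi> \<in> \<real>" "0 \<le> Re (modulus \<phi>)"
  unfolding modulus_def
  by (rule haar_nonneg[OF test_fun_lat_auto[OF assms test_fun_ind_Lam[of 1]]]; simp add: ind_def)+

lemma modulus_eq_1:
  assumes "lat_auto \<phi> \<psi>" "modulus \<phi> * modulus \<phi> = 1" shows "modulus \<phi> = 1"
proof -
  have "(modulus \<phi> - 1) * (modulus \<phi> + 1) = 0" using assms(2) by (simp add: algebra_simps)
  then have "modulus \<phi> = 1 \<or> modulus \<phi> = - 1" by (auto simp: eq_neg_iff_add_eq_0)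
  then show ?thesis using modulus_nonneg(2)[OF assms(1)] by auto
qed

lemma modulus_nonzero:
  assumes "lat_auto \<phi> \<psi>" shows "modulus \<phi> \<noteq> 0"
proof -
  have \<psi>: "lat_auto \<psi> \<phi>" and eq: "(\<lambda>x. \<phi> (\<psi> x)) = (\<lambda>x. x)" using assms by (auto simp: lat_auto_def)
  have "modulus (\<lambda>x. \<phi> (\<psi> x)) = 1" unfolding eq by (rule modulus_id)
  then show ?thesis using modulus_compose[OF assms \<psi>] by auto
qed

lemma lat_hom_conj: assumes "g \<in> H_1n" shows "lat_hom (conj_mat g)"
proof -
  obtain C where C: "C > 0" "\<forall>r x. 0 \<le> r \<longrightarrow> entries_le r x \<longrightarrow> entries_le (C * r) (conj_mat g x)"
    by (rule conj_mat_bound)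
  then show ?thesis
    unfolding lat_hom_def Lam_def using conj_pattern[OF assms] by (auto simp: conj_mat_add)
qed

lemma lat_auto_conj: assumes "g \<in> H_1n" shows "lat_auto (conj_mat g) (conj_mat (matrix_inv g))"
  using lat_hom_conj[OF assms] lat_hom_conj[OF H_1n_inv[OF assms]] conj_mat_inv[OF H_1n_invertible[OF assms]]
  by (simp add: lat_auto_def)

lemma modulus_conj_mult:
  assumes "g \<in> H_1n" "h \<in> H_1n"
  shows "modulus (conj_mat (g ** h)) = modulus (conj_mat g) * modulus (conj_mat h)"
proof -
  have "conj_mat (g ** h) = (\<lambda>x. conj_mat g (conj_mat h x))"
    using conj_mat_mult[OF H_1n_invertible[OF assms(1)] H_1n_invertible[OF assms(2)]] by (simp add: fun_eq_iff)
  then show ?thesis using modulus_compose[OF lat_auto_conj[OF assms(1)] lat_auto_conj[OF assms(2)]] by simp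
qed

lemma lat_auto_transpose:
  "lat_auto (transpose :: ('f::nonarch_local_field, 'n::{finite,linorder}) sqm \<Rightarrow> _) transpose"
proof -
  have "transpose x \<in> Lam r" if "x \<in> Lam r" for x :: "('f, 'n) sqm" and r
    using that by (auto simp: Lam_def pattern_def entries_le_def transpose_def)
  moreover have "transpose (x + y) = transpose x + transpose y" for x y :: "('f, 'n) sqm"
    by (simp add: transpose_def vec_eq_iff)
  ultimately have "lat_hom (transpose :: ('f, 'n) sqm \<Rightarrow> _)"
    unfolding lat_hom_def by (intro conjI exI[of _ 1]) auto
  then show ?thesis by (simp add: lat_auto_def)
qed

lemma diagm_in_H_1n: "(\<And>i. d i \<noteq> 0) \<Longrightarrow> diagm d \<in> H_1n"
  using invertible_diagm[of d] by (auto simp: H_1n_def GL_def diagm_def)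

text \<open>Transposition preserves the lattices and conjugates \<open>diagm d\<close> into its inverse, so the
  modulus of \<open>diagm d\<close> is its own inverse.\<close>

lemma modulus_diagm:
  fixes d :: "'n::{finite,linorder} \<Rightarrow> 'f::nonarch_local_field"
  assumes d: "\<And>i. d i \<noteq> 0"
  shows "modulus (conj_mat (diagm d)) = 1"
proof -
  let ?d = "conj_mat (diagm d)" and ?e = "conj_mat (diagm (\<lambda>i. inverse (d i)))"
  have H: "diagm d \<in> H_1n" "diagm (\<lambda>i. inverse (d i)) \<in> H_1n" using d by (auto intro: diagm_in_H_1n)
  have de: "lat_auto ?d ?e" "lat_auto ?e ?d"
    using lat_auto_conj[OF H(1)] matrix_inv_diagm[of d] d by (auto simp: lat_auto_def)
  let ?t = "transpose :: ('f, 'n) sqm \<Rightarrow> _"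
  have t: "modulus ?t = 1"
  proof -
    have "(\<lambda>x. ind (Lam 1) (?t x)) = ind (Lam 1)"
      by (auto simp: ind_def fun_eq_iff Lam_def pattern_def entries_le_def transpose_def)
    then show ?thesis by (simp add: modulus_def haar_ind_Lam_1)
  qed
  have "(\<lambda>x. ?d (?t x)) = (\<lambda>x. ?t (?e x))"
    using d by (auto simp: fun_eq_iff vec_eq_iff conj_diagm_nth transpose_def divide_inverse mult_ac)
  then have "modulus ?d = modulus ?e"
    using modulus_compose[OF de(1) lat_auto_transpose] modulus_compose[OF lat_auto_transpose de(2)] t by simp
  moreover have "modulus ?d * modulus ?e = 1"
  proof -
    have eq: "(\<lambda>x. ?d (?e x)) = (\<lambda>x. x)" using de(1) by (auto simp: lat_auto_def)
    have "modulus (\<lambda>x. ?d (?e x)) = 1" unfolding eq by (rule modulus_id)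
    then show ?thesis using modulus_compose[OF de] by simp
  qed
  ultimately show ?thesis using modulus_eq_1[OF de(1)] by simp
qed

text \<open>The hypothesis says that u is conjugate to its square by a diagonal matrix. Its modulus
  m then satisfies m = m^2, and m is nonzero.\<close>

lemma modulus_unipotent:
  fixes d :: "'n::{finite,linorder} \<Rightarrow> 'f::nonarch_local_field"
  assumes d: "\<And>i. d i \<noteq> 0" and u: "u \<in> H_1n" and c: "diagm d ** u = u ** u ** diagm d"
  shows "modulus (conj_mat u) = 1"
proof -
  have H: "diagm d \<in> H_1n" using d by (rule diagm_in_H_1n)
  have "modulus (conj_mat u) = modulus (conj_mat u) * modulus (conj_mat u)"
    using arg_cong[OF c, of "\<lambda>g. modulus (conj_mat g)"] modulus_diagm[of d] d
    by (simp add: modulus_conj_mult H u H_1n_mult)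
  then show ?thesis using modulus_nonzero[OF lat_auto_conj[OF u]] by simp
qed

section \<open>Generation of the block diagonal group by Gaussian elimination\<close>

definition row_type :: "'n::{finite,linorder} \<Rightarrow> ('f::field, 'n) sqm \<Rightarrow> bool" where
  "row_type e E \<longleftrightarrow> e \<noteq> first_idx \<and> (\<forall>i j. E $ i $ j \<noteq> 0 \<longrightarrow> i = e \<and> j \<noteq> e \<and> j \<noteq> first_idx)"

definition col_type :: "'n::{finite,linorder} \<Rightarrow> ('f::field, 'n) sqm \<Rightarrow> bool" where
  "col_type e E \<longleftrightarrow> e \<noteq> first_idx \<and> (\<forall>i j. E $ i $ j \<noteq> 0 \<longrightarrow> j = e \<and> i \<noteq> e \<and> i \<noteq> first_idx)"

text \<open>The entries lie in one row or column of index e while their other index avoids e, so no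
  two of them can be chained. Whole rows and columns are used so that one factor clears an entire
  line.\<close>

lemma row_col_square:
  assumes "row_type e E \<or> col_type e E" shows "E ** E = 0"
proof -
  have "E $ i $ k * E $ k $ j = 0" for i j k using assms unfolding row_type_def col_type_def by auto
  then show ?thesis unfolding vec_eq_iff matrix_mult_nth zero_index by (intro allI sum.neutral) blast
qed

lemma row_col_in_H_1n:
  assumes "row_type e E \<or> col_type e E" shows "mat 1 + E \<in> H_1n"
proof -
  have "E $ i $ j = 0" if "(i = first_idx) \<noteq> (j = first_idx)" for i j
    using assms that unfolding row_type_def col_type_def by blast
  then show ?thesis
    using matrix_inv_eqI(1)[OF unipotent_inverse[OF row_col_square[OF assms]]]
    by (auto simp: H_1n_def GL_def mat_def)
qed

text \<open>Gaussian elimination in the larger block. S holds the indices between which off-diagonal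
  entries may still occur, and clearing one pivot row and column removes its index from S.\<close>

lemma H_1n_induct:
  fixes Q :: "('f::field_char_0, 'n::{finite,linorder}) sqm \<Rightarrow> bool"
  assumes mult: "\<And>g h. g \<in> H_1n \<Longrightarrow> h \<in> H_1n \<Longrightarrow> Q g \<Longrightarrow> Q h \<Longrightarrow> Q (g ** h)"
    and diag: "\<And>d. (\<And>i. d i \<noteq> 0) \<Longrightarrow> Q (diagm d)"
    and unip: "\<And>e E. row_type e E \<or> col_type e E \<Longrightarrow> Q (mat 1 + E)"
    and g: "g \<in> H_1n"
  shows "Q g"
proof -
  \<comment> \<open>The inverse of a generator 1 + E is 1 - E, of the same type, so Q can be pulled
    back through a multiplication by generators on either side.\<close>
  have undo: "Q h" if h: "h \<in> H_1n" and E: "row_type e E \<or> col_type e E" and Q: "Q (h ** (mat 1 + E)) \<or> Q ((mat 1 + E) ** h)"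
    for h e E
  proof -
    have E': "row_type e (- E) \<or> col_type e (- E)" using E by (simp add: row_type_def col_type_def)
    have inv: "(mat 1 + E) ** (mat 1 + - E) = mat 1" "(mat 1 + - E) ** (mat 1 + E) = mat 1"
      using unipotent_inverse[OF row_col_square[OF E]] unipotent_inverse[OF row_col_square[OF E']] by simp_all
    note m = row_col_in_H_1n[OF E] row_col_in_H_1n[OF E']
    show ?thesis using Q
    proof
      assume "Q (h ** (mat 1 + E))"
      then have "Q (h ** (mat 1 + E) ** (mat 1 + - E))" using mult H_1n_mult h m unip[OF E'] by blast
      then show ?thesis by (simp only: matrix_mul_assoc[symmetric] inv matrix_mul_rid)
    next
      assume "Q ((mat 1 + E) ** h)"
      then have "Q ((mat 1 + - E) ** ((mat 1 + E) ** h))" using mult H_1n_mult h m unip[OF E'] by blast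
      then show ?thesis by (simp only: matrix_mul_assoc inv matrix_mul_lid)
    qed
  qed
  have row_nz: "\<exists>j. h $ i $ j \<noteq> 0" if h: "h \<in> H_1n" for h :: "('f, 'n) sqm" and i
  proof (rule ccontr)
    assume "\<not> ?thesis"
    then have "(h ** matrix_inv h) $ i $ i = 0" by (simp add: matrix_mult_nth)
    then show False using matrix_inv_mult(1)[OF H_1n_invertible[OF h]] by (simp add: mat_def)
  qed
  have main: "\<forall>g\<in>H_1n. (\<forall>i j. i \<noteq> j \<longrightarrow> \<not> (i \<in> S \<and> j \<in> S) \<longrightarrow> g $ i $ j = 0) \<longrightarrow> Q g"
    if S: "finite S" "S \<subseteq> UNIV - {first_idx}" for S :: "'n set"
    using S
  proof (induction S)
    case empty
    show ?case
    proof (intro ballI impI)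
      fix g :: "('f, 'n) sqm" assume g: "g \<in> H_1n" "\<forall>i j. i \<noteq> j \<longrightarrow> \<not> (i \<in> {} \<and> j \<in> {}) \<longrightarrow> g $ i $ j = 0"
      then have "g $ i $ i \<noteq> 0" for i using row_nz[OF g(1), of i] by (metis empty_iff)
      then have "Q (diagm (\<lambda>i. g $ i $ i))" by (rule diag)
      moreover have "diagm (\<lambda>i. g $ i $ i) = g" using g(2) by (simp add: vec_eq_iff diagm_def)
      ultimately show "Q g" by simp
    qed
  next
    case (insert e S)
    have e: "e \<noteq> first_idx" using insert.prems by auto
    have IH: "Q h" if "h \<in> H_1n" "\<And>i j. i \<noteq> j \<Longrightarrow> \<not> (i \<in> S \<and> j \<in> S) \<Longrightarrow> h $ i $ j = 0" for h
      using insert.IH insert.prems that by blast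
    have pivot: "Q g" if g: "g \<in> H_1n" and z: "\<And>i j. i \<noteq> j \<Longrightarrow> \<not> (i \<in> insert e S \<and> j \<in> insert e S) \<Longrightarrow> g $ i $ j = 0"
      and ge: "g $ e $ e \<noteq> 0" for g
    proof -
      have gH: "g $ i $ j = 0" if "(i = first_idx) \<noteq> (j = first_idx)" for i j
        using g that by (auto simp: H_1n_def)
      \<comment> \<open>Multiplication on the right by 1 + E clears the pivot row off the diagonal;
        F below does the same for the pivot column from the left.\<close>
      define E :: "('f, 'n) sqm" where "E = (\<chi> i j. if i = e \<and> j \<noteq> e then - (g $ e $ j / g $ e $ e) else 0)"
      have E: "row_type e E" using e gH[of e first_idx] by (auto simp: row_type_def E_def)
      define g1 where "g1 = g ** (mat 1 + E)"
      have g1: "g1 \<in> H_1n" unfolding g1_def using E by (intro H_1n_mult g row_col_in_H_1n) auto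
      have g1n: "g1 $ i $ j = g $ i $ j + (if j = e then 0 else - g $ i $ e * (g $ e $ j / g $ e $ e))" for i j
      proof -
        have "(g ** E) $ i $ j = (\<Sum>k\<in>{e}. g $ i $ k * E $ k $ j)"
          unfolding matrix_mult_nth by (intro sum.mono_neutral_right) (auto simp: E_def)
        then show ?thesis by (simp add: g1_def matrix_add_ldistrib E_def)
      qed
      define F :: "('f, 'n) sqm" where "F = (\<chi> i j. if j = e \<and> i \<noteq> e then - (g $ i $ e / g $ e $ e) else 0)"
      have F: "col_type e F" using e gH[of first_idx e] by (auto simp: col_type_def F_def)
      define g2 where "g2 = (mat 1 + F) ** g1"
      have g2: "g2 \<in> H_1n" unfolding g2_def using F by (intro H_1n_mult g1 row_col_in_H_1n) auto
      have g2n: "g2 $ i $ j = g1 $ i $ j + (if i = e then 0 else - (g $ i $ e / g $ e $ e) * g1 $ e $ j)" for i j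
      proof -
        have "(F ** g1) $ i $ j = (\<Sum>k\<in>{e}. F $ i $ k * g1 $ k $ j)"
          unfolding matrix_mult_nth by (intro sum.mono_neutral_right) (auto simp: F_def)
        then show ?thesis by (simp add: g2_def matrix_add_rdistrib F_def)
      qed
      have "Q g2"
      proof (rule IH[OF g2])
        fix i j assume ij: "i \<noteq> j" "\<not> (i \<in> S \<and> j \<in> S)"
        have g1e: "g1 $ e $ k = 0" if "k \<noteq> e" for k using that ge by (simp add: g1n)
        consider "j = e" | "i = e" | "i \<noteq> e" "j \<noteq> e" by blast
        then show "g2 $ i $ j = 0"
        proof cases
          case 1
          then show ?thesis using ij ge by (simp add: g2n g1n)
        next
          case 2
          then show ?thesis using ij g1e[of j] by (simp add: g2n)
        next
          case 3
          then have "g $ i $ j = 0" using z[OF ij(1)] ij(2) by blast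
          moreover have "g $ i $ e = 0 \<or> g $ e $ j = 0" using z[of i e] z[of e j] 3 ij(2) by blast
          ultimately show ?thesis using 3 g1e[of j] by (auto simp: g2n g1n)
        qed
      qed
      then have "Q g1" using undo[OF g1, of e F] F by (simp add: g2_def)
      then show "Q g" using undo[OF g, of e E] E by (simp add: g1_def)
    qed
    show ?case
    proof (intro ballI impI)
      fix g :: "('f, 'n) sqm"
      assume g: "g \<in> H_1n" "\<forall>i j. i \<noteq> j \<longrightarrow> \<not> (i \<in> insert e S \<and> j \<in> insert e S) \<longrightarrow> g $ i $ j = 0"
      show "Q g"
      proof (cases "g $ e $ e = 0")
        case False
        then show ?thesis using pivot[OF g(1)] g(2) by blast
      next
        case True
        \<comment> \<open>With a zero pivot another entry of row e is nonzero, and adding its column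
          to column e creates a pivot. The zero pattern places k in S, so the new matrix keeps the
          shape required by \<open>pivot\<close>.\<close>
        obtain k where k: "g $ e $ k \<noteq> 0" using row_nz[OF g(1)] by blast
        have "k \<noteq> e" using k True by auto
        moreover from this have "k \<in> insert e S" using g(2)[rule_format, of e k] k by auto
        ultimately have ke: "k \<noteq> e" "k \<in> S" by auto
        define E :: "('f, 'n) sqm" where "E = (\<chi> i j. if i = k \<and> j = e then 1 else 0)"
        have E: "row_type k E" using e ke insert.prems by (auto simp: row_type_def E_def)
        have n: "(g ** (mat 1 + E)) $ i $ j = g $ i $ j + (if j = e then g $ i $ k else 0)" for i j
        proof -
          have "(g ** E) $ i $ j = (\<Sum>l\<in>{k}. g $ i $ l * E $ l $ j)"
            unfolding matrix_mult_nth by (intro sum.mono_neutral_right) (auto simp: E_def)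
          then show ?thesis by (simp add: matrix_add_ldistrib E_def)
        qed
        have "Q (g ** (mat 1 + E))"
        proof (rule pivot)
          show "g ** (mat 1 + E) \<in> H_1n" using E by (intro H_1n_mult g(1) row_col_in_H_1n) auto
          show "(g ** (mat 1 + E)) $ e $ e \<noteq> 0" using k True by (simp add: n)
          fix i j assume ij: "i \<noteq> j" "\<not> (i \<in> insert e S \<and> j \<in> insert e S)"
          have "g $ i $ j = 0" using g(2) ij by blast
          moreover have "g $ i $ k = 0" if "j = e"
          proof -
            have "i \<notin> insert e S" using ij(2) that by blast
            moreover have "i \<noteq> k" using ke(2) calculation by blast
            ultimately show ?thesis using g(2) by blast
          qed
          ultimately show "(g ** (mat 1 + E)) $ i $ j = 0" by (simp add: n)
        qed
        then show ?thesis using undo[OF g(1), of k E] E by simp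
      qed
    qed
  qed
  show ?thesis
    using main[of "UNIV - {first_idx}"] g by (auto simp: H_1n_def)
qed

text \<open>On generators: diagonal matrices are covered by \<open>modulus_diagm\<close>, and 1 + E
  has square 1 + 2 E, to which it is conjugate by a diagonal matrix because 2 is invertible in
  characteristic 0.\<close>

theorem modulus_conj:
  assumes "(g :: ('f::nonarch_local_field, 'n::{finite,linorder}) sqm) \<in> H_1n"
  shows "modulus (conj_mat g) = 1"
proof (rule H_1n_induct[OF _ _ _ assms])
  fix e and E :: "('f, 'n) sqm" assume E: "row_type e E \<or> col_type e E"
  \<comment> \<open>Conjugation by ?d multiplies a row at e by t and a column at e by 1 / t; this
    choice makes the factor 2 in both cases.\<close>
  define t :: "'f" where "t = (if row_type e E then 2 else inverse 2)"
  let ?d = "\<lambda>i. if i = e then t else 1"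
  have t0: "t \<noteq> 0" by (simp add: t_def)
  have sq: "(mat 1 + E) ** (mat 1 + E) = mat 1 + (E + E)"
    by (simp add: matrix_add_ldistrib matrix_add_rdistrib row_col_square[OF E])
  have "?d i * E $ i $ j = (E $ i $ j + E $ i $ j) * ?d j" for i j
  proof (cases "E $ i $ j = 0")
    case nz: False
    show ?thesis
    proof (cases "row_type e E")
      case True
      then have "i = e \<and> j \<noteq> e" using nz unfolding row_type_def by blast
      moreover have "t = 2" using True by (simp add: t_def)
      ultimately show ?thesis by simp
    next
      case False
      then have "j = e \<and> i \<noteq> e" using E nz unfolding col_type_def by blast
      moreover have "(E $ i $ j + E $ i $ j) * t = E $ i $ j" using False by (simp add: t_def)
      ultimately show ?thesis by simp
    qed
  qed simp
  then have "diagm ?d ** E = (E + E) ** diagm ?d"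
    by (simp add: vec_eq_iff diagm_mult_nth mult_diagm_nth)
  then have "diagm ?d ** (mat 1 + E) = (mat 1 + E) ** (mat 1 + E) ** diagm ?d"
    unfolding sq by (simp add: matrix_add_ldistrib matrix_add_rdistrib)
  then show "modulus (conj_mat (mat 1 + E)) = 1"
    using t0 by (intro modulus_unipotent[of ?d] row_col_in_H_1n[OF E]) auto
qed (auto simp: modulus_conj_mult modulus_diagm)

lemma haar_conj:
  assumes "g \<in> H_1n" "test_fun f" shows "haar (\<lambda>x. f (conj_mat g x)) = haar f"
  using haar_lat_auto[OF lat_auto_conj[OF assms(1)] assms(2)] modulus_conj[OF assms(1)] by simp

section \<open>The invariant measure on the cone\<close>

text \<open>One representative for each element of the residue field, so the cardinality is
  q.\<close>

definition res_reps :: "'f::nonarch_local_field set" where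
  "res_reps = (\<lambda>D. SOME x. x \<in> D) ` (\<lambda>x. disc x (absv (unif :: 'f))) ` disc 0 1"

lemma finite_res_reps: "finite (res_reps :: 'f::nonarch_local_field set)"
  unfolding res_reps_def by (intro finite_imageI finite_discs[of _ 1]) auto

lemma res_reps_disc:
  assumes "t \<in> (res_reps :: 'f::nonarch_local_field set)"
  shows "t = (SOME x. x \<in> disc t (absv (unif :: 'f)))" "absv t \<le> 1"
proof -
  obtain y :: 'f where y: "y \<in> disc 0 1" "t = (SOME x. x \<in> disc y (absv (unif :: 'f)))"
    using assms by (auto simp: res_reps_def)
  have "y \<in> disc y (absv (unif :: 'f))" by simp
  then have t: "t \<in> disc y (absv (unif :: 'f))" unfolding y(2) by (rule someI)
  then show "t = (SOME x. x \<in> disc t (absv (unif :: 'f)))" using disc_eq[OF t] y(2) by simp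
  have "absv (t - y) \<le> 1" using t absv_unif_less_1[where 'f='f] by (simp add: disc_def)
  then show "absv t \<le> 1" using absv_add_le[of "t - y" 1 y] y(1) by (simp add: disc_def)
qed

lemma res_reps_ex1:
  assumes "absv (x :: 'f::nonarch_local_field) \<le> 1"
  shows "\<exists>!t. t \<in> res_reps \<and> absv (x - t) \<le> absv (unif :: 'f)"
proof (rule ex_ex1I)
  let ?t = "SOME y. y \<in> disc x (absv (unif :: 'f))"
  have "x \<in> disc x (absv (unif :: 'f))" by simp
  then have "?t \<in> disc x (absv (unif :: 'f))" by (rule someI)
  moreover have "?t \<in> res_reps" unfolding res_reps_def
    by (intro imageI) (simp add: disc_def assms)
  ultimately show "\<exists>t. t \<in> res_reps \<and> absv (x - t) \<le> absv (unif :: 'f)"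
    by (intro exI[of _ ?t]) (simp add: disc_def absv_minus_commute)
next
  fix s t assume s: "s \<in> res_reps \<and> absv (x - s) \<le> absv (unif :: 'f)"
    and t: "t \<in> res_reps \<and> absv (x - t) \<le> absv (unif :: 'f)"
  have "disc x (absv (unif :: 'f)) = disc s (absv (unif :: 'f))" using s by (intro disc_eq) (simp add: disc_def)
  moreover have "disc x (absv (unif :: 'f)) = disc t (absv (unif :: 'f))" using t by (intro disc_eq) (simp add: disc_def)
  ultimately show "s = t" using res_reps_disc(1)[of s] res_reps_disc(1)[of t] s t by simp
qed

lemma card_res_reps: "2 \<le> card (res_reps :: 'f::nonarch_local_field set)"
proof -
  obtain s t :: 'f where s: "s \<in> res_reps" "absv (0 - s) \<le> absv (unif :: 'f)" and t: "t \<in> res_reps" "absv (1 - t) \<le> absv (unif :: 'f)"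
    using res_reps_ex1[of "0 :: 'f"] res_reps_ex1[of "1 :: 'f"] by auto
  have "s \<noteq> t"
  proof
    assume "s = t"
    then have "absv (1 - 0 :: 'f) \<le> absv (unif :: 'f)"
      using absv_trans[of 1 s "absv (unif :: 'f)" 0] s t by (simp add: absv_minus_commute)
    then show False using absv_unif_less_1[where 'f='f] by simp
  qed
  then have "card {s, t} = 2" by simp
  then show ?thesis using card_mono[OF finite_res_reps, of "{s, t}"] s t by simp
qed

definition unit_mat :: "'n \<Rightarrow> 'n \<Rightarrow> 'f \<Rightarrow> ('f::nonarch_local_field, 'n::{finite,linorder}) sqm" where
  "unit_mat k m s = (\<chi> i j. if i = k \<and> j = m then s else 0)"

lemma unit_mat_Lam:
  assumes "(k = first_idx) \<noteq> (m = first_idx)" "absv s \<le> r" shows "unit_mat k m s \<in> Lam r"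
proof -
  have "0 \<le> r" using absv_nonneg[of s] assms(2) by linarith
  then show ?thesis using assms by (auto simp: unit_mat_def Lam_def pattern_def entries_le_def)
qed

text \<open>The pairing is affine in each entry, with the transposed entry as slope.\<close>

lemma pair_form_add_unit:
  fixes x :: "('f::nonarch_local_field, 'n::{finite,linorder}) sqm"
  assumes km: "(k = first_idx) \<noteq> (m = first_idx)"
  shows "pair_form (x + unit_mat m k s) = pair_form x + s * x $ k $ m"
proof (cases "k = first_idx")
  case True
  then have "m \<noteq> first_idx" using km by simp
  then have "pair_form (x + unit_mat m k s) =
      (\<Sum>j\<in>UNIV. x $ first_idx $ j * x $ j $ first_idx + (if j = m then x $ first_idx $ j * s else 0))"
    unfolding pair_form_def by (intro sum.cong) (auto simp: unit_mat_def True algebra_simps)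
  then show ?thesis by (simp add: sum.distrib pair_form_def True mult.commute)
next
  case False
  then have "m = first_idx" using km by simp
  then have "pair_form (x + unit_mat m k s) =
      (\<Sum>j\<in>UNIV. x $ first_idx $ j * x $ j $ first_idx + (if j = k then s * x $ j $ first_idx else 0))"
    unfolding pair_form_def using False by (intro sum.cong) (auto simp: unit_mat_def algebra_simps)
  then show ?thesis using \<open>m = first_idx\<close> by (simp add: sum.distrib pair_form_def)
qed

definition cutoff :: "nat \<Rightarrow> (('f::nonarch_local_field, 'n::{finite,linorder}) sqm \<Rightarrow> complex) \<Rightarrow> ('f, 'n) sqm \<Rightarrow> complex" where
  "cutoff j F x = (if absv (pair_form x) \<le> absv (unif :: 'f) ^ j then F x else 0)"

text \<open>The power of q is the reciprocal of the mass of the disc of radius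
  \<open>absv unif ^ j\<close> in the field, so that the limit integrates F along the fibre v . w =
  0.\<close>

definition approx :: "nat \<Rightarrow> (('f::nonarch_local_field, 'n::{finite,linorder}) sqm \<Rightarrow> complex) \<Rightarrow> complex" where
  "approx j F = of_nat (card (res_reps :: 'f set)) ^ j * haar (cutoff j F)"

lemma test_fun_cutoff:
  fixes F :: "('f::nonarch_local_field, 'n::{finite,linorder}) sqm \<Rightarrow> complex"
  assumes "test_fun F" shows "test_fun (cutoff j F)"
proof -
  obtain r R where r: "0 < r" "r \<le> 1" "inv_on r F" "1 \<le> R" "\<forall>x. F x \<noteq> 0 \<longrightarrow> x \<in> Lam R" using assms by (rule test_funE)
  let ?p = "absv (unif :: 'f) ^ j"
  have p: "0 < ?p" by simp
  \<comment> \<open>By \<open>pair_form_diff\<close> a move of size s changes the pairing by at most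
    the threshold itself, which cannot cross it in an ultrametric.\<close>
  define s where "s = min r (?p / R)"
  have s: "0 < s" "s \<le> r" "R * s \<le> ?p" "s \<le> R"
  proof -
    show "0 < s" using r p unfolding s_def by (intro min_less_iff_conj[THEN iffD2] conjI divide_pos_pos) auto
    show "s \<le> r" by (simp add: s_def)
    then show "s \<le> R" using r by simp
    have "s \<le> ?p / R" by (simp add: s_def)
    then show "R * s \<le> ?p" using r by (simp add: pos_le_divide_eq mult.commute)
  qed
  show ?thesis
  proof (rule test_funI[OF s(1), of _ R])
    show "inv_on s (cutoff j F)"
      unfolding inv_on_def
    proof (intro allI impI)
      fix x y :: "('f, 'n) sqm" assume xy: "y - x \<in> Lam s"
      then have Fxy: "F y = F x" using inv_onD[OF inv_on_mono[OF r(3) s(2)]] by blast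
      show "cutoff j F y = cutoff j F x"
      proof (cases "F x = 0")
        case False
        then have "entries_le R x" using r(5) by (auto simp: Lam_def)
        then have "absv (pair_form y - pair_form x) \<le> R * s"
          using xy s by (intro pair_form_diff) (auto simp: Lam_def)
        then have d: "absv (pair_form y - pair_form x) \<le> ?p" using s(3) by simp
        have "absv (pair_form y) \<le> ?p \<longleftrightarrow> absv (pair_form x) \<le> ?p"
          using absv_add_le[OF d, of "pair_form x"] absv_diff_le[OF _ d, of "pair_form y"] by auto
        then show ?thesis using Fxy by (simp add: cutoff_def)
      qed (simp add: cutoff_def Fxy)
    qed
    fix x assume "cutoff j F x \<noteq> 0"
    then show "x \<in> Lam R" using r(5) by (auto simp: cutoff_def split: if_splits)
  qed
qed

lemma approx_add:
  assumes "test_fun F" "test_fun G" shows "approx j (\<lambda>x. F x + G x) = approx j F + approx j G"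
proof -
  have "cutoff j (\<lambda>x. F x + G x) = (\<lambda>x. cutoff j F x + cutoff j G x)" by (simp add: cutoff_def fun_eq_iff)
  then show ?thesis using haar_add[OF test_fun_cutoff[OF assms(1)] test_fun_cutoff[OF assms(2)]]
    by (simp add: approx_def distrib_left)
qed

lemma approx_cmult:
  assumes "test_fun F" shows "approx j (\<lambda>x. c * F x) = c * approx j F"
proof -
  have "cutoff j (\<lambda>x. c * F x) = (\<lambda>x. c * cutoff j F x)" by (simp add: cutoff_def fun_eq_iff)
  then show ?thesis using haar_cmult[OF test_fun_cutoff[OF assms]] by (simp add: approx_def)
qed

lemma approx_diff: "test_fun F \<Longrightarrow> test_fun G \<Longrightarrow> approx j (\<lambda>x. F x - G x) = approx j F - approx j G"
  using approx_add[of F "\<lambda>x. -1 * G x"] approx_cmult[of G _ "-1"] test_fun_cmult[of G "-1"] by simp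

lemma approx_zero: "approx j (\<lambda>x. 0) = 0"
  using approx_cmult[OF test_fun_zero, of j 0] by simp

lemma approx_sum:
  assumes "\<And>i. i \<in> A \<Longrightarrow> test_fun (F i)" shows "approx j (\<lambda>x. \<Sum>i\<in>A. F i x) = (\<Sum>i\<in>A. approx j (F i))"
  using assms by (induction A rule: infinite_finite_induct) (auto simp: approx_zero approx_add test_fun_sum)

lemma unif_power_le: "i \<le> j \<Longrightarrow> absv (unif :: 'f::nonarch_local_field) ^ j \<le> absv (unif :: 'f) ^ i"
  using absv_unif_less_1[where 'f='f] by (intro power_decreasing) auto

text \<open>Off the origin the quadratic form is a submersion: moving the entry paired with a nonzero one
  permutes the residue classes of its values.\<close>

lemma approx_coset:
  fixes x0 :: "('f::nonarch_local_field, 'n::{finite,linorder}) sqm"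
  assumes km: "(k = first_idx) \<noteq> (m = first_idx)" and x0: "x0 \<in> pattern"
    and r: "0 < r" "r < absv (x0 $ k $ m)" and j: "absv (unif :: 'f) ^ j \<le> r * r"
  shows "approx (Suc j) (ind (coset r x0)) = approx j (ind (coset r x0))"
proof -
  let ?w = "unif :: 'f" and ?C = "coset r x0" and ?a = "x0 $ k $ m"
  \<comment> \<open>Moving the entry paired with x_km by t \<pi>^j / a changes the form by t
    \<pi>^j, up to an error of relative size \<open>absv unif\<close>, since x_km / a is close to 1.
    The condition on j keeps the move inside \<open>Lam r\<close>.\<close>
  let ?sh = "\<lambda>t. unit_mat m k (t * ?w ^ j / ?a) :: ('f, 'n) sqm"
  have a0: "?a \<noteq> 0" "0 < absv ?a" using r by auto
  have C: "test_fun (ind ?C)" by (rule test_fun_ind_coset[OF r(1) x0])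
  have shL: "?sh t \<in> Lam r" if t: "t \<in> res_reps" for t
  proof (rule unit_mat_Lam)
    have "absv t * absv ?w ^ j \<le> 1 * (r * r)" using res_reps_disc(2)[OF t] j by (intro mult_mono) auto
    also have "\<dots> \<le> r * absv ?a" using r by simp
    finally show "absv (t * ?w ^ j / ?a) \<le> r"
      using a0 by (simp add: absv_divide absv_mult absv_power pos_divide_le_eq)
  qed (use km in blast)
  \<comment> \<open>The shell of level j is tiled by q translates of the one of level j + 1, one per
    residue; Haar invariance turns this into the factor q.\<close>
  have "cutoff j (ind ?C) x = (\<Sum>t\<in>res_reps. cutoff (Suc j) (ind ?C) (x + ?sh t))" for x
  proof (cases "x \<in> ?C")
    case False
    have "x + ?sh t \<notin> ?C" if "t \<in> res_reps" for t
      using False Lam_diff[OF _ shL[OF that], of "x + ?sh t - x0"] by (auto simp: coset_def algebra_simps)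
    then have "(\<Sum>t\<in>res_reps. cutoff (Suc j) (ind ?C) (x + ?sh t)) = 0"
      by (intro sum.neutral) (auto simp: cutoff_def ind_def)
    then show ?thesis using False by (simp add: cutoff_def ind_def)
  next
    case True
    have xC: "x + ?sh t \<in> ?C" if "t \<in> res_reps" for t
      using True Lam_add[OF _ shL[OF that], of "x - x0"] by (auto simp: coset_def algebra_simps)
    have "absv (x $ k $ m - ?a) \<le> r" using True by (auto simp: coset_def Lam_def entries_le_def)
    then have "absv ((x $ k $ m - ?a) / ?a) < 1" using r a0 by (simp add: absv_divide)
    then have e: "absv ((x $ k $ m - ?a) / ?a) \<le> absv ?w" by (rule absv_le_unif)
    have pf: "absv (pair_form (x + ?sh t)) \<le> absv ?w ^ Suc j \<longleftrightarrow>
        absv (pair_form x + t * ?w ^ j) \<le> absv ?w ^ Suc j" if t: "t \<in> res_reps" for t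
    proof -
      have "pair_form (x + ?sh t) - (pair_form x + t * ?w ^ j) = t * ?w ^ j * ((x $ k $ m - ?a) / ?a)"
        using a0 by (simp add: pair_form_add_unit[OF km] field_simps)
      also have "absv \<dots> \<le> 1 * absv ?w ^ j * absv ?w"
        unfolding absv_mult absv_power using e res_reps_disc(2)[OF t] by (intro mult_mono) auto
      finally have d: "absv (pair_form (x + ?sh t) - (pair_form x + t * ?w ^ j)) \<le> absv ?w ^ Suc j"
        by (simp add: mult.commute)
      show ?thesis
        using absv_add_le[OF d, of "pair_form x + t * ?w ^ j"] absv_diff_le[OF _ d, of "pair_form (x + ?sh t)"] by auto
    qed
    have "(\<Sum>t\<in>res_reps. cutoff (Suc j) (ind ?C) (x + ?sh t)) =
        (\<Sum>t\<in>res_reps. if absv (pair_form x + t * ?w ^ j) \<le> absv ?w ^ Suc j then 1 else 0)"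
      using xC pf by (intro sum.cong refl) (simp add: cutoff_def ind_def)
    also have "\<dots> = (if absv (pair_form x) \<le> absv ?w ^ j then 1 else 0)"
    proof (cases "absv (pair_form x) \<le> absv ?w ^ j")
      case True
      have "absv (- (pair_form x / ?w ^ j)) \<le> 1"
        using True by (simp add: absv_divide absv_power pos_divide_le_eq)
      \<comment> \<open>The only residue that pushes the form into the next level is that of - (v .
        w) / \<pi>^j.\<close>
      then obtain t0 where t0: "t0 \<in> res_reps" "absv (- (pair_form x / ?w ^ j) - t0) \<le> absv ?w"
        "\<And>t. t \<in> res_reps \<Longrightarrow> absv (- (pair_form x / ?w ^ j) - t) \<le> absv ?w \<Longrightarrow> t = t0"
        using res_reps_ex1 by blast
      have eq: "absv (pair_form x + t * ?w ^ j) \<le> absv ?w ^ Suc j \<longleftrightarrow> absv (- (pair_form x / ?w ^ j) - t) \<le> absv ?w" for t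
      proof -
        have "pair_form x + t * ?w ^ j = - (?w ^ j * (- (pair_form x / ?w ^ j) - t))" by (simp add: algebra_simps)
        then have "absv (pair_form x + t * ?w ^ j) = absv ?w ^ j * absv (- (pair_form x / ?w ^ j) - t)"
          by (simp only: absv_minus absv_mult absv_power)
        then show ?thesis by (simp add: mult.commute[of "absv ?w"])
      qed
      have iff: "absv (pair_form x + t * ?w ^ j) \<le> absv ?w ^ Suc j \<longleftrightarrow> t = t0" if "t \<in> res_reps" for t
        unfolding eq using t0(2) t0(3)[OF that] by blast
      have "(\<Sum>t\<in>res_reps. if absv (pair_form x + t * ?w ^ j) \<le> absv ?w ^ Suc j then 1 else 0) =
          (\<Sum>t\<in>res_reps. if t = t0 then 1 else (0::complex))"
        by (intro sum.cong refl if_cong iff)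
      also have "\<dots> = 1" using t0(1) by (simp add: finite_res_reps)
      finally show ?thesis using True by simp
    next
      case False
      have "\<not> absv (pair_form x + t * ?w ^ j) \<le> absv ?w ^ Suc j" if t: "t \<in> res_reps" for t
      proof
        assume "absv (pair_form x + t * ?w ^ j) \<le> absv ?w ^ Suc j"
        then have "absv (pair_form x + t * ?w ^ j) \<le> absv ?w ^ j"
          by (rule order_trans) (rule unif_power_le, simp)
        moreover have "absv (t * ?w ^ j) \<le> absv ?w ^ j"
          using res_reps_disc(2)[OF t] by (simp add: absv_mult absv_power mult_left_le_one_le)
        ultimately show False using False absv_diff_le[of "pair_form x + t * ?w ^ j" "absv ?w ^ j" "t * ?w ^ j"] by simp
      qed
      then show ?thesis using False by simp
    qed
    finally show ?thesis using True by (simp add: cutoff_def ind_def)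
  qed
  then have "cutoff j (ind ?C) = (\<lambda>x. \<Sum>t\<in>res_reps. cutoff (Suc j) (ind ?C) (x + ?sh t))" by (rule ext)
  then have "haar (cutoff j (ind ?C)) = haar (\<lambda>x. \<Sum>t\<in>res_reps. cutoff (Suc j) (ind ?C) (x + ?sh t))" by (rule arg_cong)
  also have "\<dots> = (\<Sum>t\<in>res_reps. haar (\<lambda>x. cutoff (Suc j) (ind ?C) (x + ?sh t)))"
    using Lam_pattern[OF shL] by (intro haar_sum test_fun_translate test_fun_cutoff C)
  also have "\<dots> = (\<Sum>t\<in>(res_reps :: 'f set). haar (cutoff (Suc j) (ind ?C)))"
    by (rule sum.cong[OF refl]) (rule haar_translate[OF test_fun_cutoff[OF C] Lam_pattern[OF shL]])
  finally show ?thesis by (simp add: approx_def)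
qed

lemma not_Lam_entry:
  assumes "x \<in> pattern" "x \<notin> Lam r" "0 \<le> r"
  obtains k m where "(k = first_idx) \<noteq> (m = first_idx)" "r < absv (x $ k $ m)"
proof -
  obtain k m where "\<not> absv (x $ k $ m) \<le> r" using assms by (auto simp: Lam_def entries_le_def)
  moreover have "(k = first_idx) \<noteq> (m = first_idx)"
  proof (rule ccontr)
    assume "\<not> ?thesis"
    then have "x $ k $ m = 0" using assms(1) unfolding pattern_def by blast
    then show False using calculation assms(3) by simp
  qed
  ultimately show ?thesis using that[of k m] by simp
qed

lemma ex_unif_power_le: assumes "0 < e" shows "\<exists>J. \<forall>j\<ge>J. absv (unif :: 'f::nonarch_local_field) ^ j \<le> e"
proof -
  obtain J where "absv (unif :: 'f) ^ J < e" using real_arch_pow_inv[OF assms absv_unif_less_1] by blast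
  then show ?thesis using unif_power_le[where 'f='f] by (meson less_imp_le order_trans)
qed

text \<open>F is a combination of cosets avoiding \<open>Lam r\<close>. Each has a centre with some
  entry larger than r, so \<open>approx_coset\<close> applies to all of them from the same J
  on.\<close>

lemma approx_stable:
  fixes F :: "('f::nonarch_local_field, 'n::{finite,linorder}) sqm \<Rightarrow> complex"
  assumes F: "test_fun F" "inv_on r F" "0 < r" and z: "\<And>x. x \<in> Lam r \<Longrightarrow> F x = 0"
    and J: "\<forall>j\<ge>J. absv (unif :: 'f) ^ j \<le> r * r" and j: "j \<ge> J"
  shows "approx j F = approx J F"
proof -
  obtain R where R: "\<forall>x. F x \<noteq> 0 \<longrightarrow> x \<in> Lam R" using F(1) by (rule test_funE)
  let ?C = "coset r ` {x. F x \<noteq> 0}"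
  have mem: "test_fun (ind C)" "i \<ge> J \<Longrightarrow> approx (Suc i) (ind C) = approx i (ind C)" if C: "C \<in> ?C" for C i
  proof -
    obtain x where x: "F x \<noteq> 0" "C = coset r x" using C by blast
    have xp: "x \<in> pattern" using R x(1) Lam_pattern by blast
    show "test_fun (ind C)" using test_fun_ind_coset[OF F(3) xp] x(2) by simp
    have "x \<notin> Lam r" using z x(1) by blast
    then obtain k m where km: "(k = first_idx) \<noteq> (m = first_idx)" "r < absv (x $ k $ m)"
      using not_Lam_entry[OF xp _ less_imp_le[OF F(3)]] by metis
    assume "i \<ge> J"
    then show "approx (Suc i) (ind C) = approx i (ind C)"
      unfolding x(2) using J by (intro approx_coset[OF km(1) xp F(3) km(2)]) blast
  qed
  have dec: "F = (\<lambda>x. \<Sum>C\<in>?C. coset_val F C * ind C x)"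
    by (rule ext) (rule test_fun_decompose[OF F(2,3) R])
  have ap: "approx i F = (\<Sum>C\<in>?C. coset_val F C * approx i (ind C))" for i
  proof -
    have "approx i F = approx i (\<lambda>x. \<Sum>C\<in>?C. coset_val F C * ind C x)" using dec by (rule arg_cong)
    also have "\<dots> = (\<Sum>C\<in>?C. approx i (\<lambda>x. coset_val F C * ind C x))"
      by (intro approx_sum test_fun_cmult mem)
    also have "\<dots> = (\<Sum>C\<in>?C. coset_val F C * approx i (ind C))"
      by (intro sum.cong refl approx_cmult mem)
    finally show ?thesis .
  qed
  show ?thesis using j
  proof (induction rule: dec_induct)
    case (step i)
    have "approx (Suc i) F = approx i F"
      unfolding ap using mem(2)[OF _ step(1)] by (intro sum.cong refl) simp
    then show ?case using step by simp
  qed simp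
qed

section \<open>Convergence of the approximations at the origin\<close>

lemma card_res_reps_cube_le:
  assumes "CARD('n::{finite,linorder}) \<ge> 3"
  shows "card (res_reps :: 'f::nonarch_local_field set) ^ 3 \<le> lat_index TYPE(('f, 'n) sqm) (absv (unif :: 'f))"
proof -
  let ?R = "res_reps :: 'f set" and ?p = "absv (unif :: 'f)"
  have "2 \<le> card (UNIV - {first_idx} :: 'n set)" using assms by simp
  then obtain T where T: "T \<subseteq> UNIV - {first_idx :: 'n}" "card T = 2" by (meson obtain_subset_with_card_n)
  then obtain m m' where m: "m \<noteq> first_idx" "m' \<noteq> first_idx" "m \<noteq> (m' :: 'n)" by (auto simp: card_2_iff)
  define v :: "'f \<times> 'f \<times> 'f \<Rightarrow> ('f, 'n) sqm"
    where "v = (\<lambda>(a, b, c). unit_mat first_idx m a + unit_mat first_idx m' b + unit_mat m first_idx c)"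
  have v: "v (a, b, c) $ first_idx $ m = a" "v (a, b, c) $ first_idx $ m' = b" "v (a, b, c) $ m $ first_idx = c" for a b c
    using m by (auto simp: v_def unit_mat_def)
  have vL: "v x \<in> Lam 1" if "x \<in> ?R \<times> ?R \<times> ?R" for x
    using that m res_reps_disc(2) by (auto simp: v_def intro!: Lam_add unit_mat_Lam)
  have uniq: "a = b" if "a \<in> ?R" "b \<in> ?R" "absv (a - b) \<le> ?p" for a b
  proof -
    have "disc a ?p = disc b ?p" using that(3) by (intro disc_eq) (simp add: disc_def)
    then show ?thesis using res_reps_disc(1)[OF that(1)] res_reps_disc(1)[OF that(2)] by simp
  qed
  have inj: "inj_on (\<lambda>x. coset ?p (v x)) (?R \<times> ?R \<times> ?R)"
  proof (rule inj_onI)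
    fix x y assume x: "x \<in> ?R \<times> ?R \<times> ?R" and y: "y \<in> ?R \<times> ?R \<times> ?R" and xy: "coset ?p (v x) = coset ?p (v y)"
    obtain a b c where x': "x = (a, b, c)" by (cases x)
    obtain a' b' c' where y': "y = (a', b', c')" by (cases y)
    have "v x \<in> coset ?p (v y)" using coset_self[of ?p "v x"] xy by simp
    then have d: "absv (v x $ i $ l - v y $ i $ l) \<le> ?p" for i l by (simp add: coset_def Lam_def entries_le_def)
    have "a = a'" "b = b'" "c = c'"
      using uniq[of a a'] uniq[of b b'] uniq[of c c'] d[of first_idx m] d[of first_idx m'] d[of m first_idx] x y
      by (auto simp: x' y' v)
    then show "x = y" by (simp add: x' y')
  qed
  have "card (?R \<times> ?R \<times> ?R) = card ((\<lambda>x. coset ?p (v x)) ` (?R \<times> ?R \<times> ?R))" using card_image[OF inj] by simp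
  also have "\<dots> \<le> card (coset ?p ` (Lam 1 :: ('f, 'n) sqm set))"
    using vL by (intro card_mono finite_cosets[of _ _ 1]) auto
  finally show ?thesis by (simp add: lat_index_def card_cartesian_product power3_eq_cube)
qed

lemma lat_auto_scale:
  fixes s :: "'f::nonarch_local_field"
  assumes "s \<noteq> 0"
  shows "lat_auto (\<lambda>x :: ('f, 'n::{finite,linorder}) sqm. \<chi> i j. s * x $ i $ j) (\<lambda>x. \<chi> i j. inverse s * x $ i $ j)"
proof -
  have "lat_hom (\<lambda>x :: ('f, 'n) sqm. \<chi> i j. t * x $ i $ j)" if "t \<noteq> 0" for t :: 'f
    unfolding lat_hom_def
  proof (intro conjI exI[of _ "absv t"] allI impI ballI)
    fix r and x :: "('f, 'n) sqm" assume "0 \<le> r" "x \<in> Lam r"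
    then show "(\<chi> i j. t * x $ i $ j) \<in> Lam (absv t * r)"
      by (auto simp: Lam_def pattern_def entries_le_def absv_mult intro!: mult_left_mono)
  qed (use that in \<open>auto simp: vec_eq_iff distrib_left\<close>)
  then show ?thesis using assms by (simp add: lat_auto_def vec_eq_iff)
qed

text \<open>Division by \<pi> divides the form by \<pi>^2, which shifts the level by 2 and accounts
  for q^2. It carries \<open>Lam (absv unif)\<close> onto \<open>Lam 1\<close>, which accounts for
  the index in the denominator.\<close>

lemma approx_scale:
  "approx (j + 2) (ind (Lam (absv (unif :: 'f::nonarch_local_field)) :: ('f, 'n::{finite,linorder}) sqm set)) =
    of_nat (card (res_reps :: 'f set)) ^ 2 / of_nat (lat_index TYPE(('f, 'n) sqm) (absv (unif :: 'f))) *
    approx j (ind (Lam 1 :: ('f, 'n) sqm set))"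
proof -
  let ?w = "unif :: 'f" and ?L = "\<lambda>r. Lam r :: ('f, 'n) sqm set"
  let ?s = "\<lambda>x :: ('f, 'n) sqm. \<chi> i j. inverse ?w * x $ i $ j"
  have auto: "lat_auto ?s (\<lambda>x. \<chi> i j. inverse (inverse ?w) * x $ i $ j)" by (rule lat_auto_scale) simp
  have L: "?s x \<in> ?L 1 \<longleftrightarrow> x \<in> ?L (absv ?w)" for x
  proof -
    have "absv (inverse ?w * x $ i $ j) \<le> 1 \<longleftrightarrow> absv (x $ i $ j) \<le> absv ?w" for i j
      unfolding absv_mult absv_inverse by (simp add: field_simps)
    then show ?thesis by (auto simp: Lam_def pattern_def entries_le_def)
  qed
  have pf: "absv (pair_form (?s x)) \<le> absv ?w ^ j \<longleftrightarrow> absv (pair_form x) \<le> absv ?w ^ (j + 2)" for x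
  proof -
    have "pair_form (?s x) = inverse ?w ^ 2 * pair_form x"
      by (simp add: pair_form_def sum_distrib_left power2_eq_square mult_ac)
    then have "absv (pair_form (?s x)) = absv (pair_form x) / absv ?w ^ 2"
      by (simp add: absv_mult absv_power absv_inverse divide_inverse power_inverse mult.commute)
    then show ?thesis using absv_pos[OF unif_nonzero[where 'f='f]]
      by (simp add: pos_divide_le_eq power_add power2_eq_square mult_ac del: absv_pos_iff)
  qed
  have "modulus ?s = haar (ind (?L (absv ?w)))"
    unfolding modulus_def by (intro arg_cong[of _ _ haar]) (auto simp: fun_eq_iff ind_def L)
  also have "\<dots> = 1 / of_nat (lat_index TYPE(('f, 'n) sqm) (absv ?w))"
    using haar_ind_coset[of "absv ?w" "0 :: ('f, 'n) sqm"] absv_unif_less_1[where 'f='f] by simp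
  finally have m: "modulus ?s = 1 / of_nat (lat_index TYPE(('f, 'n) sqm) (absv ?w))" .
  have "cutoff (j + 2) (ind (?L (absv ?w))) = (\<lambda>x. cutoff j (ind (?L 1)) (?s x))"
    unfolding cutoff_def fun_eq_iff pf ind_def L by simp
  then have "haar (cutoff (j + 2) (ind (?L (absv ?w)))) = modulus ?s * haar (cutoff j (ind (?L 1)))"
    using haar_lat_auto[OF auto test_fun_cutoff[OF test_fun_ind_Lam[of 1]]] by simp
  then show ?thesis by (simp add: approx_def m power_add power2_eq_square)
qed

text \<open>The distance to the fixed point b = c / (1 - \<rho>) is multiplied by \<rho> every two
  steps, so it is bounded by a multiple of the j-th power of the square root of \<rho>.\<close>

lemma two_step_recurrence_convergent:
  fixes a :: "nat \<Rightarrow> complex"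
  assumes \<rho>: "0 < \<rho>" "\<rho> < 1" and rec: "\<And>j. j \<ge> J \<Longrightarrow> a (j + 2) = of_real \<rho> * a j + c"
  shows "convergent a"
proof -
  define b where "b = c / (1 - of_real \<rho>)"
  have "1 - complex_of_real \<rho> \<noteq> 0" using \<rho> by (metis eq_iff_diff_eq_0 less_irrefl of_real_1 of_real_eq_iff)
  then have "b * (1 - of_real \<rho>) = c" by (simp add: b_def)
  then have b: "c = b - of_real \<rho> * b" by (simp add: algebra_simps)
  define e where "e j = norm (a (J + j) - b)" for j
  have e: "e (j + 2) = \<rho> * e j" for j
  proof -
    have "a (J + j + 2) - b = of_real \<rho> * (a (J + j) - b)" using rec[of "J + j"] b by (simp add: algebra_simps)
    then have "norm (a (J + j + 2) - b) = \<rho> * norm (a (J + j) - b)" using \<rho> by (simp add: norm_mult)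
    then show ?thesis by (simp add: e_def add.assoc)
  qed
  define \<theta> where "\<theta> = sqrt \<rho>"
  have \<theta>: "0 < \<theta>" "\<theta> < 1" "\<theta> * \<theta> = \<rho>" using \<rho> by (auto simp: \<theta>_def)
  \<comment> \<open>A two-step recurrence has two free initial values, and M dominates both.\<close>
  define M where "M = max (e 0) (e 1 / \<theta>)"
  have bound: "e j \<le> M * \<theta> ^ j" for j
  proof (induction j rule: less_induct)
    case (less j)
    consider "j = 0" | "j = 1" | i where "j = i + 2" by (metis One_nat_def add_2_eq_Suc' not0_implies_Suc)
    then show ?case
    proof cases
      case 2
      have "e 1 / \<theta> \<le> M" by (simp add: M_def)
      then show ?thesis using 2 \<theta> by (simp add: pos_divide_le_eq)
    next
      case 3
      have "\<rho> * e i \<le> \<rho> * (M * \<theta> ^ i)" using less[of i] 3 \<rho> by (intro mult_left_mono) auto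
      also have "\<rho> * (M * \<theta> ^ i) = M * \<theta> ^ j" unfolding \<theta>(3)[symmetric] 3 by (simp add: power_add power2_eq_square)
      finally show ?thesis using e[of i] 3 by simp
    qed (simp add: M_def)
  qed
  have "(\<lambda>j. M * \<theta> ^ j) \<longlonglongrightarrow> M * 0" using \<theta> by (intro tendsto_mult tendsto_const LIMSEQ_realpow_zero) auto
  then have "(\<lambda>j. a (J + j) - b) \<longlonglongrightarrow> 0"
    using bound by (intro Lim_null_comparison[of "\<lambda>j. a (J + j) - b" "\<lambda>j. M * \<theta> ^ j"]) (auto simp: e_def)
  then have "(\<lambda>j. a (j + J)) \<longlonglongrightarrow> b" by (simp add: LIM_zero_iff add.commute)
  then have "a \<longlonglongrightarrow> b" by (rule LIMSEQ_offset)
  then show ?thesis by (rule convergentI)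
qed

context
  assumes card3: "CARD('n::{finite,linorder}) \<ge> 3"
begin

text \<open>\<open>Lam 1\<close> is the small lattice plus a part D away from the origin. D
  contributes a constant eventually, and the small lattice is a rescaled copy of
  \<open>Lam 1\<close>. The contraction factor q^2 / index is below 1 because the index is at least
  q^3.\<close>

lemma approx_Lam_convergent:
  "convergent (\<lambda>j. approx j (ind (Lam 1 :: ('f::nonarch_local_field, 'n) sqm set)))"
proof -
  let ?w = "unif :: 'f" and ?L = "\<lambda>r. Lam r :: ('f, 'n) sqm set"
  let ?q = "card (res_reps :: 'f set)" and ?i = "lat_index TYPE(('f, 'n) sqm) (absv ?w)"
  have p: "0 < absv ?w" "absv ?w \<le> 1" using absv_unif_less_1[where 'f='f] by auto
  define D where "D = (\<lambda>x. ind (?L 1) x - ind (?L (absv ?w)) x)"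
  have D: "test_fun D" unfolding D_def using p by (intro test_fun_diff test_fun_ind_Lam) auto
  have Di: "inv_on (absv ?w) D"
    using inv_on_ind_Lam[OF p(2), where 'a='f and 'b='n] inv_on_ind_Lam[OF order_refl, of "absv ?w", where 'a='f and 'b='n]
    unfolding inv_on_def D_def by metis
  have Dz: "D x = 0" if "x \<in> Lam (absv ?w)" for x using that Lam_mono[OF p(2) that] by (simp add: D_def ind_def)
  have "0 < absv ?w * absv ?w" using p by simp
  then obtain J where J: "\<forall>j\<ge>J. absv ?w ^ j \<le> absv ?w * absv ?w" using ex_unif_power_le by blast
  define \<rho> where "\<rho> = real (?q ^ 2) / real ?i"
  have q: "?q \<ge> 2" by (rule card_res_reps)
  have "?q ^ 2 < ?q ^ 3" using q by (intro power_strict_increasing) auto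
  then have i: "?q ^ 2 < ?i" using card_res_reps_cube_le[OF card3, where 'f='f] by (rule less_le_trans)
  have \<rho>: "0 < \<rho>" "\<rho> < 1"
  proof -
    have "0 < real (?q ^ 2)" "real (?q ^ 2) < real ?i" using q i by (simp, linarith)
    then show "0 < \<rho>" "\<rho> < 1" by (auto simp: \<rho>_def)
  qed
  show ?thesis
  proof (rule two_step_recurrence_convergent[OF \<rho>])
    fix j assume j: "j \<ge> J"
    have "approx (j + 2) (ind (?L 1)) = approx (j + 2) (ind (?L (absv ?w))) + approx (j + 2) D"
      unfolding D_def using p by (simp add: approx_diff test_fun_ind_Lam)
    also have "approx (j + 2) D = approx J D"
      by (rule approx_stable[OF D Di p(1) Dz J]) (use j in auto)
    also have "approx (j + 2) (ind (?L (absv ?w))) = of_real \<rho> * approx j (ind (?L 1))"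
      unfolding approx_scale by (simp add: \<rho>_def)
    finally show "approx (j + 2) (ind (?L 1)) = of_real \<rho> * approx j (ind (?L 1)) + approx J D" .
  qed
qed

text \<open>Subtracting F(0) times the indicator of a small lattice leaves a function vanishing near
  0, and this lattice differs from \<open>Lam 1\<close> by another such function. Only the case of
  \<open>Lam 1\<close> is not eventually constant for a trivial reason.\<close>

lemma approx_convergent:
  fixes F :: "('f::nonarch_local_field, 'n) sqm \<Rightarrow> complex"
  assumes F: "test_fun F" shows "convergent (\<lambda>j. approx j F)"
proof -
  obtain r R where r: "0 < r" "r \<le> 1" "inv_on r F" "1 \<le> R" "\<forall>x. F x \<noteq> 0 \<longrightarrow> x \<in> Lam R" using F by (rule test_funE)
  let ?L = "\<lambda>r. Lam r :: ('f, 'n) sqm set"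
  have st: "convergent (\<lambda>j. approx j G)" if G: "test_fun G" "inv_on r G" "\<And>x. x \<in> Lam r \<Longrightarrow> G x = 0" for G :: "('f, 'n) sqm \<Rightarrow> complex"
  proof -
    have "0 < r * r" using r by simp
    then obtain J where J: "\<forall>j\<ge>J. absv (unif :: 'f) ^ j \<le> r * r" using ex_unif_power_le by blast
    have "eventually (\<lambda>j. approx j G = approx J G) sequentially"
      by (rule eventually_sequentiallyI[of J]) (rule approx_stable[OF G(1,2) r(1) G(3) J])
    then show ?thesis by (intro convergentI tendsto_eventually)
  qed
  have ti: "test_fun (ind (?L r))" "test_fun (ind (?L 1))" using r by (auto intro: test_fun_ind_Lam)
  have ii: "inv_on r (ind (?L r))" "inv_on r (ind (?L 1))" using r by (auto intro: inv_on_ind_Lam)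
  define D where "D = (\<lambda>x. ind (?L 1) x - ind (?L r) x)"
  define G where "G = (\<lambda>x. F x - F 0 * ind (?L r) x)"
  have D: "convergent (\<lambda>j. approx j D)"
  proof (rule st)
    show "test_fun D" unfolding D_def by (intro test_fun_diff ti)
    show "inv_on r D"
      unfolding inv_on_def D_def using inv_onD[OF ii(1)] inv_onD[OF ii(2)] by (metis (no_types))
    show "D x = 0" if x: "x \<in> Lam r" for x using x Lam_mono[OF r(2) x] by (simp add: D_def ind_def)
  qed
  have G: "convergent (\<lambda>j. approx j G)"
  proof (rule st)
    show "test_fun G" unfolding G_def by (intro test_fun_diff test_fun_cmult ti F)
    show "inv_on r G"
      unfolding inv_on_def G_def using inv_onD[OF ii(1)] inv_onD[OF r(3)] by (metis (no_types))
    show "G x = 0" if x: "x \<in> Lam r" for x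
    proof -
      have "F x = F 0" by (rule inv_onD[OF r(3)]) (use x in simp)
      then show ?thesis using x by (simp add: G_def ind_def)
    qed
  qed
  have "approx j F = approx j G + F 0 * (approx j (ind (?L 1)) - approx j D)" for j
    unfolding G_def D_def by (simp add: approx_diff approx_cmult test_fun_cmult ti F)
  then show ?thesis
    using convergent_add[OF G] convergent_mult[OF convergent_const convergent_diff[OF approx_Lam_convergent[where 'f='f] D]] by simp
qed

end

section \<open>The invariant distribution of full support\<close>

definition limit_val :: "(('f::nonarch_local_field, 'n::{finite,linorder}) sqm \<Rightarrow> complex) \<Rightarrow> complex" where
  "limit_val F = lim (\<lambda>j. approx j F)"

text \<open>A point of the support has an entry larger than r, since F(0) = 0. If its pairing is
  tiny, adjusting the paired entry by at most r reaches the cone without changing F, where F is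
  zero. So the limit depends only on values on the cone.\<close>

lemma approx_null:
  fixes F :: "('f::nonarch_local_field, 'n::{finite,linorder}) sqm \<Rightarrow> complex"
  assumes F: "test_fun F" and z: "\<And>x. x \<in> N_1n \<Longrightarrow> F x = 0"
  obtains J where "\<And>j. j \<ge> J \<Longrightarrow> approx j F = 0"
proof -
  obtain r R where r: "0 < r" "r \<le> 1" "inv_on r F" "1 \<le> R" "\<forall>x. F x \<noteq> 0 \<longrightarrow> x \<in> Lam R" using F by (rule test_funE)
  have "0 < r * r" using r by simp
  then obtain J where J: "\<forall>j\<ge>J. absv (unif :: 'f) ^ j \<le> r * r" using ex_unif_power_le by blast
  have "cutoff j F x = 0" if j: "j \<ge> J" for j x
  proof (rule ccontr)
    assume nz: "cutoff j F x \<noteq> 0"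
    then have Fx: "F x \<noteq> 0" and p: "absv (pair_form x) \<le> r * r"
      using J j order_trans by (auto simp: cutoff_def split: if_splits)
    have xp: "x \<in> pattern" using r(5) Fx Lam_pattern by blast
    have "x \<notin> Lam r"
    proof
      assume "x \<in> Lam r"
      then have "F x = F 0" by (intro inv_onD[OF r(3)]) simp
      then show False using Fx z[OF zero_in_N_1n] by simp
    qed
    then obtain k m where km: "(k = first_idx) \<noteq> (m = first_idx)" "r < absv (x $ k $ m)"
      using not_Lam_entry[OF xp _ less_imp_le[OF r(1)]] by metis
    \<comment> \<open>Exact solution of an affine equation in one entry, small because the slope
      exceeds r while the pairing is at most r^2.\<close>
    define s where "s = - (pair_form x / x $ k $ m)"
    have a: "0 < absv (x $ k $ m)" "x $ k $ m \<noteq> 0" using km(2) r(1) by auto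
    have "absv (pair_form x) \<le> r * absv (x $ k $ m)" using p km(2) r(1) by (meson less_imp_le mult_left_mono order_trans)
    then have "absv s \<le> r" using a by (simp add: s_def absv_divide pos_divide_le_eq)
    then have L: "unit_mat m k s \<in> Lam r" using km(1) by (intro unit_mat_Lam) auto
    have "pair_form (x + unit_mat m k s) = 0" using a by (simp add: pair_form_add_unit[OF km(1)] s_def)
    then have "x + unit_mat m k s \<in> N_1n" using pattern_add[OF xp Lam_pattern[OF L]] by (simp add: N_1n_eq)
    then have "F (x + unit_mat m k s) = 0" by (rule z)
    moreover have "F (x + unit_mat m k s) = F x" by (rule inv_onD[OF r(3)]) (use L in simp)
    ultimately show False using Fx by simp
  qed
  then have "cutoff j F = (\<lambda>x. 0)" if "j \<ge> J" for j using that by (intro ext)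
  then show ?thesis using that[of J] by (simp add: approx_def haar_zero)
qed

lemma haar_mono:
  assumes "test_fun f" "test_fun g" "\<And>x. f x \<in> \<real>" "\<And>x. g x \<in> \<real>" "\<And>x. Re (f x) \<le> Re (g x)"
  shows "Re (haar f) \<le> Re (haar g)"
  using haar_nonneg(2)[OF test_fun_diff[OF assms(2,1)]] haar_diff[OF assms(2,1)] assms(3-5) by simp

lemma approx_mono:
  assumes "test_fun F" "test_fun G" "\<And>x. F x \<in> \<real>" "\<And>x. G x \<in> \<real>" "\<And>x. Re (F x) \<le> Re (G x)"
  shows "Re (approx j F) \<le> Re (approx j G)"
proof -
  have "Re (haar (cutoff j F)) \<le> Re (haar (cutoff j G))"
    by (rule haar_mono) (use assms in \<open>auto simp: cutoff_def intro: test_fun_cutoff\<close>)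
  moreover have "Re (of_nat n ^ j * z) = real n ^ j * Re z" for n and z :: complex
    by (simp flip: of_nat_power)
  ultimately show ?thesis unfolding approx_def by (simp add: mult_left_mono)
qed

definition restricts_to :: "(('f::nonarch_local_field, 'n::{finite,linorder}) sqm \<Rightarrow> complex) \<Rightarrow>
    (('f, 'n) sqm \<Rightarrow> complex) \<Rightarrow> bool" where
  "restricts_to F f \<longleftrightarrow> test_fun F \<and> (\<forall>x\<in>N_1n. F x = f x)"

text \<open>An arbitrary extension to \<open>pattern\<close> is integrated; by
  \<open>limit_val_cong\<close> the choice has no effect.\<close>

definition cone_dist :: "(('f::nonarch_local_field, 'n::{finite,linorder}) sqm \<Rightarrow> complex) \<Rightarrow> complex" where
  "cone_dist f = (if f \<in> schwartz N_1n then limit_val (SOME F. restricts_to F f) else 0)"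

text \<open>The extension is constant on every coset of \<open>Lam r\<close> that meets the cone,
  which is consistent because f is constant at scale r.\<close>

lemma ex_restricts_to:
  fixes f :: "('f::nonarch_local_field, 'n::{finite,linorder}) sqm \<Rightarrow> complex"
  assumes f: "f \<in> schwartz N_1n" shows "\<exists>F. restricts_to F f"
proof -
  obtain r R where r: "r > 0" "\<forall>x\<in>N_1n. \<forall>y\<in>N_1n. entries_le r (y - x) \<longrightarrow> f y = f x"
    "\<forall>x. f x \<noteq> 0 \<longrightarrow> entries_le R x" using f by (rule schwartz_N_1nE)
  define F where "F x = (if \<exists>y\<in>N_1n. y \<in> coset r x then f (SOME y. y \<in> N_1n \<and> y \<in> coset r x) else 0)" for x
  have some: "(SOME y. y \<in> N_1n \<and> y \<in> coset r x) \<in> N_1n \<and> (SOME y. y \<in> N_1n \<and> y \<in> coset r x) \<in> coset r x"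
    if "\<exists>y\<in>N_1n. y \<in> coset r x" for x
    by (rule someI_ex) (use that in blast)
  have "test_fun F"
  proof (rule test_funI[OF r(1), of _ "max r R"])
    show "inv_on r F"
      unfolding inv_on_def
    proof (intro allI impI)
      fix x y :: "('f, 'n) sqm" assume "y - x \<in> Lam r"
      then have "coset r y = coset r x" by (intro coset_eq) (simp add: coset_def)
      then show "F y = F x" by (simp add: F_def)
    qed
    fix x assume Fx: "F x \<noteq> 0"
    then have ex: "\<exists>y\<in>N_1n. y \<in> coset r x" by (simp add: F_def split: if_splits)
    let ?y = "SOME y. y \<in> N_1n \<and> y \<in> coset r x"
    have "f ?y \<noteq> 0" using Fx ex by (simp add: F_def)
    then have "?y \<in> Lam R" using r(3) some[OF ex] by (simp add: Lam_def N_1n_eq)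
    then have "?y \<in> Lam (max r R)" "?y - x \<in> Lam (max r R)" using Lam_max some[OF ex] by (auto simp: coset_def)
    then show "x \<in> Lam (max r R)" using Lam_diff[of ?y "max r R" "?y - x"] by simp
  qed
  moreover have "F x = f x" if x: "x \<in> N_1n" for x
  proof -
    have "x \<in> coset r x" using r(1) by simp
    then have ex: "\<exists>y\<in>N_1n. y \<in> coset r x" using x by blast
    note s = some[OF ex]
    then have "entries_le r ((SOME y. y \<in> N_1n \<and> y \<in> coset r x) - x)" by (simp add: coset_def Lam_def)
    then have "f (SOME y. y \<in> N_1n \<and> y \<in> coset r x) = f x" using r(2) x s by blast
    then show ?thesis using ex by (simp add: F_def)
  qed
  ultimately show ?thesis unfolding restricts_to_def by blast
qed

lemma schwartz_conj_iff:
  fixes f :: "('f::nonarch_local_field, 'n::{finite,linorder}) sqm \<Rightarrow> complex"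
  assumes "g \<in> H_1n" shows "(\<lambda>x. f (conj_mat g x)) \<in> schwartz N_1n \<longleftrightarrow> f \<in> schwartz N_1n"
  using schwartz_conj[OF assms, of f] schwartz_conj[OF H_1n_inv[OF assms], of "\<lambda>x. f (conj_mat g x)"]
  by (auto simp: conj_mat_inv[OF H_1n_invertible[OF assms]])

lemma act_dist_H_1n:
  assumes "g \<in> H_1n" shows "act_dist g T f = T (\<lambda>x. f (conj_mat g x))"
  by (simp add: act_dist_def act_fun_def matrix_inv_inv[OF H_1n_invertible[OF assms]])

context
  assumes card3: "CARD('n::{finite,linorder}) \<ge> 3"
begin

lemma limit_val_tendsto:
  fixes F :: "('f::nonarch_local_field, 'n) sqm \<Rightarrow> complex"
  assumes "test_fun F" shows "(\<lambda>j. approx j F) \<longlonglongrightarrow> limit_val F"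
  unfolding limit_val_def using approx_convergent[OF card3 assms] by (simp add: convergent_LIMSEQ_iff)

lemma limit_val_eqI:
  fixes F :: "('f::nonarch_local_field, 'n) sqm \<Rightarrow> complex"
  shows "test_fun F \<Longrightarrow> (\<lambda>j. approx j F) \<longlonglongrightarrow> L \<Longrightarrow> limit_val F = L"
  using LIMSEQ_unique limit_val_tendsto by blast

lemma limit_val_add:
  fixes F G :: "('f::nonarch_local_field, 'n) sqm \<Rightarrow> complex"
  assumes "test_fun F" "test_fun G" shows "limit_val (\<lambda>x. F x + G x) = limit_val F + limit_val G"
  using tendsto_add[OF limit_val_tendsto[OF assms(1)] limit_val_tendsto[OF assms(2)]] assms
  by (intro limit_val_eqI test_fun_add) (simp_all add: approx_add)

lemma limit_val_cmult:
  fixes F :: "('f::nonarch_local_field, 'n) sqm \<Rightarrow> complex"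
  assumes "test_fun F" shows "limit_val (\<lambda>x. c * F x) = c * limit_val F"
  using tendsto_mult[OF tendsto_const[of c] limit_val_tendsto[OF assms]] assms
  by (intro limit_val_eqI test_fun_cmult) (simp_all add: approx_cmult)

lemma limit_val_cong:
  fixes F G :: "('f::nonarch_local_field, 'n) sqm \<Rightarrow> complex"
  assumes F: "test_fun F" and G: "test_fun G" and eq: "\<And>x. x \<in> N_1n \<Longrightarrow> F x = G x"
  shows "limit_val F = limit_val G"
proof -
  have D: "test_fun (\<lambda>x. F x - G x)" using F G by (rule test_fun_diff)
  obtain J where J: "\<And>j. j \<ge> J \<Longrightarrow> approx j (\<lambda>x. F x - G x) = 0"
    by (rule approx_null[OF D]) (use eq in auto)
  have "limit_val (\<lambda>x. F x - G x) = 0"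
    by (intro limit_val_eqI D tendsto_eventually eventually_sequentiallyI[of J] J)
  moreover have "limit_val F = limit_val (\<lambda>x. F x - G x) + limit_val G" using limit_val_add[OF D G] by simp
  ultimately show ?thesis by simp
qed

lemma limit_val_conj:
  fixes F :: "('f::nonarch_local_field, 'n) sqm \<Rightarrow> complex"
  assumes F: "test_fun F" and g: "g \<in> H_1n"
  shows "limit_val (\<lambda>x. F (conj_mat g x)) = limit_val F"
proof -
  have t: "test_fun (\<lambda>x. F (conj_mat g x))" by (rule test_fun_lat_auto[OF lat_auto_conj[OF g] F])
  have "cutoff j (\<lambda>x. F (conj_mat g x)) = (\<lambda>x. cutoff j F (conj_mat g x))" for j
    by (simp add: cutoff_def fun_eq_iff pair_form_conj[OF g])
  then have "approx j (\<lambda>x. F (conj_mat g x)) = approx j F" for j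
    using haar_conj[OF g test_fun_cutoff[OF F]] by (simp add: approx_def)
  then show ?thesis using limit_val_tendsto[OF F] by (intro limit_val_eqI t) simp
qed

lemma ex_nonzero_in_N_1n:
  assumes "0 < r"
  obtains x k m where "(x :: ('f::nonarch_local_field, 'n) sqm) \<in> N_1n" "x \<in> Lam r"
    "(k = first_idx) \<noteq> (m = first_idx)" "x $ k $ m \<noteq> 0"
proof -
  have "\<exists>m. m \<noteq> (first_idx :: 'n)"
  proof (rule ccontr)
    assume "\<not> ?thesis"
    then have "(UNIV :: 'n set) = {first_idx}" by auto
    then have "card (UNIV :: 'n set) = 1" by (metis card.empty card.insert empty_iff finite.emptyI One_nat_def)
    then show False using card3 by simp
  qed
  then obtain m where m: "m \<noteq> (first_idx :: 'n)" by blast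
  obtain e :: 'f where e: "e \<noteq> 0" "absv e < r" using ex_absv_lt[OF assms] by blast
  let ?x = "unit_mat first_idx m e :: ('f, 'n) sqm"
  have L: "?x \<in> Lam r" using m e by (intro unit_mat_Lam) auto
  have "pair_form (0 + ?x) = pair_form (0 :: ('f, 'n) sqm) + e * (0 :: ('f, 'n) sqm) $ m $ first_idx"
    using m by (intro pair_form_add_unit) auto
  then have "pair_form ?x = 0" by (simp add: pair_form_def)
  then have "?x \<in> N_1n" using Lam_pattern[OF L] by (simp add: N_1n_eq)
  then show ?thesis using that[of ?x first_idx m] L m e by (simp add: unit_mat_def)
qed

text \<open>The coset contains a nonzero point x1 of the cone. Near x1 the approximations are
  eventually constant, and the constant is positive because a neighbourhood of x1 of positive Haar
  mass satisfies the cut-off. Monotonicity carries this bound to the limit for the whole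
  coset.\<close>

lemma limit_val_ind_coset:
  fixes x0 :: "('f::nonarch_local_field, 'n) sqm"
  assumes r: "0 < r" and x0: "x0 \<in> N_1n"
  shows "limit_val (ind (coset r x0)) \<noteq> 0"
proof -
  have pat: "x \<in> pattern" if "x \<in> N_1n" for x :: "('f, 'n) sqm" using that by (simp add: N_1n_eq)
  obtain x1 k m where x1: "x1 \<in> N_1n" "x1 \<in> coset r x0" and km: "(k = first_idx) \<noteq> (m = first_idx)" "x1 $ k $ m \<noteq> 0"
  proof (cases "x0 = 0")
    case True
    then show ?thesis using ex_nonzero_in_N_1n[OF r, where 'f='f] that by (metis coset_zero)
  next
    case False
    then obtain k m where "x0 $ k $ m \<noteq> 0" by (metis vec_eq_iff zero_index)
    moreover from this have "(k = first_idx) \<noteq> (m = first_idx)" using N_1n_pattern[OF x0] by blast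
    ultimately show ?thesis using that[of x0 k m] x0 r by simp
  qed
  define r1 where "r1 = Min {1, r, absv (x1 $ k $ m) / 2}"
  have a: "0 < absv (x1 $ k $ m)" using km(2) by simp
  have "r1 \<le> 1" "r1 \<le> r" "r1 \<le> absv (x1 $ k $ m) / 2" unfolding r1_def by (intro Min_le; simp)+
  moreover have "0 < r1" unfolding r1_def using r a by simp
  ultimately have r1: "0 < r1" "r1 \<le> 1" "r1 \<le> r" "r1 < absv (x1 $ k $ m)" using a by (auto simp del: absv_pos_iff)
  let ?C = "coset r x0" and ?C1 = "coset r1 x1"
  have sub: "?C1 \<subseteq> ?C"
  proof -
    have "?C1 \<subseteq> coset r x1" using Lam_mono[OF r1(3)] by (auto simp: coset_def)
    then show ?thesis using coset_eq[OF x1(2)] by simp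
  qed
  have "0 < r1 * r1" using r1 by simp
  then obtain J where J: "\<forall>j\<ge>J. absv (unif :: 'f) ^ j \<le> r1 * r1" using ex_unif_power_le by blast
  have st: "approx j (ind ?C1) = approx J (ind ?C1)" if "j \<ge> J" for j
    using that
  proof (induction rule: dec_induct)
    case (step i)
    then show ?case using approx_coset[OF km(1) pat[OF x1(1)] r1(1,4), of i] J by simp
  qed simp
  have tC: "test_fun (ind ?C)" "test_fun (ind ?C1)" using test_fun_ind_coset r r1(1) pat x0 x1(1) by blast+
  obtain R' where R': "R' > 0" "x1 \<in> Lam R'" using pat[OF x1(1)] by (rule ex_Lam)
  define R where "R = max 1 R'"
  have R: "1 \<le> R" "x1 \<in> Lam R" using Lam_max2[OF R'(2)] by (auto simp: R_def)
  define r2 where "r2 = min r1 (absv (unif :: 'f) ^ J / R)"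
  have p: "0 < absv (unif :: 'f) ^ J" by simp
  have "r2 \<le> absv (unif :: 'f) ^ J / R" by (simp add: r2_def)
  then have r2': "R * r2 \<le> absv (unif :: 'f) ^ J" using R(1) by (simp add: pos_le_divide_eq mult.commute)
  have r2: "0 < r2" "r2 \<le> r1" using r1(1) p R(1) divide_pos_pos[OF p, of R] by (auto simp: r2_def)
  have t2: "test_fun (ind (coset r2 x1))" by (rule test_fun_ind_coset[OF r2(1) pat[OF x1(1)]])
  have le: "Re (ind (coset r2 x1) x) \<le> Re (cutoff J (ind ?C1) x)" for x
  proof (cases "x \<in> coset r2 x1")
    case True
    then have xx: "x - x1 \<in> Lam r2" by (simp add: coset_def)
    have "absv (pair_form x - pair_form x1) \<le> R * r2"
      using R(2) xx r2 r1 R(1) by (intro pair_form_diff) (auto simp: Lam_def)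
    then have "absv (pair_form x) \<le> absv (unif :: 'f) ^ J" using r2' x1(1) by (simp add: N_1n_eq)
    moreover have "x \<in> ?C1" using Lam_mono[OF r2(2) xx] by (simp add: coset_def)
    ultimately show ?thesis by (simp add: cutoff_def ind_def)
  qed (simp add: cutoff_def ind_def)
  have "0 < Re (haar (ind (coset r2 x1)))"
    using haar_ind_coset[OF r2(1) _ pat[OF x1(1)]] lat_index_pos[OF r2(1), where 'f='f and 'n='n] r2 r1
    by (simp add: Re_divide_of_nat)
  also have "\<dots> \<le> Re (haar (cutoff J (ind ?C1)))"
    by (rule haar_mono[OF t2 test_fun_cutoff[OF tC(2)] _ _ le]) (auto simp: ind_def cutoff_def)
  finally have h: "0 < Re (haar (cutoff J (ind ?C1)))" .
  have "Re (approx J (ind ?C1)) = real (card (res_reps :: 'f set)) ^ J * Re (haar (cutoff J (ind ?C1)))"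
    by (simp add: approx_def flip: of_nat_power)
  then have pos: "0 < Re (approx J (ind ?C1))" using h card_res_reps[where 'f='f] by simp
  have "Re (approx J (ind ?C1)) \<le> Re (limit_val (ind ?C))"
  proof (rule LIMSEQ_le_const[OF tendsto_Re[OF limit_val_tendsto[OF tC(1)]]])
    have "Re (approx J (ind ?C1)) \<le> Re (approx j (ind ?C))" if "j \<ge> J" for j
      unfolding st[OF that, symmetric] by (rule approx_mono[OF tC(2,1)]) (use sub in \<open>auto simp: ind_def\<close>)
    then show "\<exists>J'. \<forall>j\<ge>J'. Re (approx J (ind ?C1)) \<le> Re (approx j (ind ?C))" by blast
  qed
  then show ?thesis using pos by auto
qed

lemma cone_dist_eq:
  fixes f :: "('f::nonarch_local_field, 'n) sqm \<Rightarrow> complex"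
  assumes "f \<in> schwartz N_1n" "restricts_to F f" shows "cone_dist f = limit_val F"
proof -
  have s: "restricts_to (SOME F. restricts_to F f) f" using someI[of "\<lambda>F. restricts_to F f", OF assms(2)] .
  have "limit_val (SOME F. restricts_to F f) = limit_val F"
    using s assms(2) by (intro limit_val_cong) (auto simp: restricts_to_def)
  then show ?thesis using assms(1) by (simp add: cone_dist_def)
qed

lemma cone_dist_invariant:
  "(cone_dist :: (('f::nonarch_local_field, 'n) sqm \<Rightarrow> complex) \<Rightarrow> complex) \<in> invariant_distributions H_1n N_1n"
  unfolding invariant_distributions_def distributions_def
proof (intro CollectI conjI ballI allI impI)
  fix f h :: "('f, 'n) sqm \<Rightarrow> complex" assume f: "f \<in> schwartz N_1n" and h: "h \<in> schwartz N_1n"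
  obtain F G where F: "restricts_to F f" and G: "restricts_to G h" using ex_restricts_to f h by blast
  have FG: "restricts_to (\<lambda>x. F x + G x) (\<lambda>x. f x + h x)" using F G by (simp add: restricts_to_def test_fun_add)
  show "cone_dist (\<lambda>x. f x + h x) = cone_dist f + cone_dist h"
    using cone_dist_eq[OF schwartz_add[OF f h] FG] cone_dist_eq[OF f F] cone_dist_eq[OF h G] limit_val_add[of F G] F G
    by (simp add: restricts_to_def)
next
  fix c and f :: "('f, 'n) sqm \<Rightarrow> complex" assume f: "f \<in> schwartz N_1n"
  obtain F where F: "restricts_to F f" using ex_restricts_to f by blast
  have cF: "restricts_to (\<lambda>x. c * F x) (\<lambda>x. c * f x)" using F by (simp add: restricts_to_def test_fun_cmult)
  show "cone_dist (\<lambda>x. c * f x) = c * cone_dist f"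
    using cone_dist_eq[OF schwartz_cmult[OF f] cF] cone_dist_eq[OF f F] limit_val_cmult[of F c] F
    by (simp add: restricts_to_def)
next
  fix f :: "('f, 'n) sqm \<Rightarrow> complex" assume "f \<notin> schwartz N_1n"
  then show "cone_dist f = 0" by (simp add: cone_dist_def)
next
  fix g :: "('f, 'n) sqm" assume g: "g \<in> H_1n"
  have "cone_dist (\<lambda>x. f (conj_mat g x)) = cone_dist f" for f :: "('f, 'n) sqm \<Rightarrow> complex"
  proof (cases "f \<in> schwartz N_1n")
    case True
    obtain F where F: "restricts_to F f" using ex_restricts_to True by blast
    have "restricts_to (\<lambda>x. F (conj_mat g x)) (\<lambda>x. f (conj_mat g x))"
      using F test_fun_lat_auto[OF lat_auto_conj[OF g]] conj_N_1n_iff[OF g] by (simp add: restricts_to_def)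
    then show ?thesis
      using cone_dist_eq[OF schwartz_conj[OF g True]] cone_dist_eq[OF True F] limit_val_conj[OF _ g] F
      by (simp add: restricts_to_def)
  qed (simp add: cone_dist_def schwartz_conj_iff[OF g])
  then show "act_dist g cone_dist = (cone_dist :: (('f, 'n) sqm \<Rightarrow> complex) \<Rightarrow> complex)"
    by (simp add: fun_eq_iff act_dist_H_1n[OF g])
qed

text \<open>Any nonempty open part of the cone contains the trace of a coset about one of its
  points, and \<open>limit_val_ind_coset\<close> gives its indicator a nonzero value.\<close>

lemma cone_dist_full_support:
  "dist_support N_1n (cone_dist :: (('f::nonarch_local_field, 'n) sqm \<Rightarrow> complex) \<Rightarrow> complex) = N_1n"
proof -
  have "U = {}" if U: "openin (top_of_set N_1n) U" and z: "\<forall>f\<in>schwartz U. cone_dist f = 0"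
    for U :: "('f, 'n) sqm set"
  proof (rule ccontr)
    assume "U \<noteq> {}"
    then obtain x0 where x0: "x0 \<in> U" by blast
    obtain W where W: "open W" "U = N_1n \<inter> W" using U by (auto simp: openin_open)
    then obtain e where e: "e > 0" "ball x0 e \<subseteq> W" using x0 open_contains_ball by blast
    define r where "r = e / (2 * real (CARD('n) * CARD('n)))"
    have n: "0 < real (CARD('n) * CARD('n))" by simp
    have r: "r > 0" using e n by (simp add: r_def)
    have x0N: "x0 \<in> N_1n" using x0 W by blast
    let ?S = "{x \<in> N_1n. x \<in> coset r x0}"
    have SU: "?S \<subseteq> U"
    proof
      fix x assume x: "x \<in> ?S"
      then have "dist x x0 \<le> real (CARD('n) * CARD('n)) * r"
        by (intro entries_le_imp_dist_le) (simp add: coset_def Lam_def)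
      also have "\<dots> < e" using e n by (simp add: r_def)
      finally have "x \<in> ball x0 e" by (simp add: dist_commute)
      then show "x \<in> U" using e W x by blast
    qed
    obtain R where R: "R > 0" "entries_le R x0" using entries_le_ex by blast
    have "nice ?S"
    proof (rule niceI[OF _ r, of _ "max r R"])
      fix x y :: "('f, 'n) sqm" assume x: "x \<in> ?S" and y: "y \<in> N_1n" "entries_le r (y - x)"
      have "y - x \<in> Lam r" using x y pattern_diff by (auto simp: Lam_def N_1n_eq)
      moreover have "x - x0 \<in> Lam r" using x by (simp add: coset_def)
      ultimately have "y - x0 \<in> Lam r" using Lam_add[of "y - x" r "x - x0"] by simp
      then show "y \<in> ?S" using y by (simp add: coset_def)
    next
      fix x assume "x \<in> ?S"
      then have "entries_le (max r R) (x - x0)" by (auto simp: coset_def Lam_def intro: entries_le_mono[OF _ max.cobounded1])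
      moreover have "entries_le (max r R) x0" by (rule entries_le_mono[OF R(2)]) simp
      ultimately show "entries_le (max r R) x" using entries_le_add[of "max r R" "x - x0" x0] by simp
    qed auto
    then have f: "ind ?S \<in> schwartz N_1n" by (rule ind_schwartz)
    have supp: "{x. ind ?S x \<noteq> 0} = ?S" "{x \<in> U. ind ?S x \<noteq> 0} = ?S" using SU by (auto simp: ind_def)
    have K: "compact ?S" using compact_schwartz_support[OF f] supp(1) by simp
    \<comment> \<open>\<open>dist_support\<close> tests with Schwartz functions of U itself, so
      local constancy and the closure of the support are checked in the topology of U.\<close>
    have "ind ?S \<in> schwartz U"
      unfolding schwartz_def
    proof (intro CollectI conjI allI impI)
      fix x assume "x \<notin> U"
      then show "ind ?S x = 0" using SU by (auto simp: ind_def)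
    next
      show "locally_constant_on U (ind ?S)"
        unfolding locally_constant_on_def
      proof
        fix x assume x: "x \<in> U"
        then have "x \<in> N_1n" using W by blast
        then obtain V where V: "openin (top_of_set N_1n) V" "x \<in> V" "\<forall>y\<in>V. ind ?S y = ind ?S x"
          using f unfolding schwartz_def locally_constant_on_def by blast
        obtain O' where O': "open O'" "V = N_1n \<inter> O'" using V(1) by (auto simp: openin_open)
        then have "openin (top_of_set U) (U \<inter> O')" by auto
        moreover have "x \<in> U \<inter> O'" using x V(2) O'(2) by blast
        moreover have "U \<inter> O' \<subseteq> V" using O'(2) W(2) by blast
        then have "\<forall>y\<in>U \<inter> O'. ind ?S y = ind ?S x" using V(3) by blast
        ultimately show "\<exists>V. openin (top_of_set U) V \<and> x \<in> V \<and> (\<forall>y\<in>V. ind ?S y = ind ?S x)" by blast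
      qed
    next
      have "closedin (top_of_set U) ?S" by (rule closed_subset[OF SU compact_imp_closed[OF K]])
      then have "top_of_set U closure_of ?S = ?S" by (simp add: closure_of_eq)
      then show "compact (top_of_set U closure_of {x \<in> U. ind ?S x \<noteq> 0})" unfolding supp(2) using K by simp
    qed
    then have "cone_dist (ind ?S) = 0" using z by blast
    moreover have "restricts_to (ind (coset r x0)) (ind ?S)"
      using test_fun_ind_coset[OF r, of x0] x0N by (auto simp: restricts_to_def N_1n_eq ind_def)
    then have "cone_dist (ind ?S) = limit_val (ind (coset r x0))" by (rule cone_dist_eq[OF f])
    ultimately show False using limit_val_ind_coset[OF r x0N] by simp
  qed
  then have "\<Union>{U. openin (top_of_set N_1n) U \<and> (\<forall>f\<in>schwartz U. (cone_dist :: (('f, 'n) sqm \<Rightarrow> complex) \<Rightarrow> complex) f = 0)} \<subseteq> {}"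
    by (intro Union_least) (elim CollectE conjE, simp)
  then show ?thesis unfolding dist_support_def by (simp only: subset_empty Diff_empty)
qed

end

section \<open>Assembly: the space of invariant distributions\<close>

lemma invariant_distributions_combine:
  assumes S: "S \<in> invariant_distributions G N_1n" and T: "T \<in> invariant_distributions G N_1n"
  shows "(\<lambda>f. a * S f + b * T f) \<in> invariant_distributions G N_1n"
  unfolding invariant_distributions_def distributions_def
proof (intro CollectI conjI ballI allI impI)
  fix g assume g: "g \<in> G"
  have eq: "act_dist g S = S" "act_dist g T = T" using S T g by (auto simp: invariant_distributions_def)
  have "act_dist g (\<lambda>f. a * S f + b * T f) = (\<lambda>f. a * act_dist g S f + b * act_dist g T f)"
    by (simp add: act_dist_def)
  then show "act_dist g (\<lambda>f. a * S f + b * T f) = (\<lambda>f. a * S f + b * T f)" by (simp only: eq)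
qed (use S T in \<open>auto simp: invariant_distributions_def distributions_def algebra_simps\<close>)

lemma H_invariant_imp_P_invariant: "invariant_distributions H_1n X \<subseteq> invariant_distributions P_1n X"
  using P_1n_subset_H_1n by (auto simp: invariant_distributions_def)

lemma delta_invariant:
  "delta_dist N_1n (0 :: ('f::nonarch_local_field, 'n::{finite,linorder}) sqm) \<in> invariant_distributions H_1n N_1n"
  unfolding invariant_distributions_def distributions_def
proof (intro CollectI conjI ballI allI impI)
  fix g :: "('f, 'n) sqm" assume g: "g \<in> H_1n"
  show "act_dist g (delta_dist N_1n 0) = delta_dist N_1n 0"
    by (simp add: fun_eq_iff act_dist_H_1n[OF g] delta_dist_def schwartz_conj_iff[OF g])
qed (auto simp: delta_dist_def schwartz_add schwartz_cmult)

abbreviation "test_cyl \<equiv> ind (cyl (\<lambda>_. disc 0 1) (\<lambda>_. disc 0 1) {z. absv z = 1})"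

text \<open>Subtract from f its value at 0 times the indicator of a neighbourhood of 0. T kills the
  difference, so T f is f(0) times the value of T on that indicator.\<close>

lemma P_invariant_multiple_delta:
  fixes T :: "(('f::nonarch_local_field, 'n::{finite,linorder}) sqm \<Rightarrow> complex) \<Rightarrow> complex"
  assumes T: "T \<in> invariant_distributions P_1n N_1n" and ne: "first_idx \<noteq> (last_idx :: 'n)"
    and zero: "T test_cyl = 0"
  obtains c where "T = (\<lambda>f. c * delta_dist N_1n 0 f)"
proof -
  let ?S = "{x :: ('f, 'n) sqm. x \<in> N_1n \<and> entries_le 1 x}"
  have T': "T \<in> distributions N_1n" using T by (simp add: invariant_distributions_def)
  have "nice ?S"
  proof (rule niceI[of _ 1 1])
    fix x y :: "('f, 'n) sqm" assume "x \<in> ?S" "y \<in> N_1n" "entries_le 1 (y - x)"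
    then show "y \<in> ?S" using entries_le_add[of 1 "y - x" x] by simp
  qed auto
  then have i: "ind ?S \<in> schwartz N_1n" by (rule ind_schwartz)
  have "T f = T (ind ?S) * delta_dist N_1n 0 f" for f
  proof (cases "f \<in> schwartz N_1n")
    case True
    have c: "(\<lambda>x. - f 0 * ind ?S x) \<in> schwartz N_1n" by (rule schwartz_cmult[OF i])
    have "T (\<lambda>x. f x + - f 0 * ind ?S x) = 0"
    proof (rule vanishes_away_from_zero[OF T ne zero])
      show "(\<lambda>x. f x + - f 0 * ind ?S x) \<in> schwartz N_1n" by (rule schwartz_add[OF True c])
    qed (simp add: ind_def)
    then have "T f + - f 0 * T (ind ?S) = 0" using dist_add[OF T' True c] dist_cmult[OF T' i, of "- f 0"] by simp
    then show ?thesis using True by (simp add: delta_dist_def add_eq_0_iff mult.commute)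
  next
    case False
    then show ?thesis using dist_outside[OF T' False] by (simp add: delta_dist_def)
  qed
  then show ?thesis by (intro that[of "T (ind ?S)"] ext)
qed

theorem theorem4p2:
  fixes N H P :: "('f::nonarch_local_field^'n::{finite,linorder}^'n::{finite,linorder}) set"
    and \<delta>0 :: "('f^'n::{finite,linorder}^'n::{finite,linorder} \<Rightarrow> complex) \<Rightarrow> complex"
  defines "N \<equiv> N_1n" and "H \<equiv> H_1n" and "P \<equiv> P_1n" and "\<delta>0 \<equiv> delta_dist N 0"
  assumes "CARD('n::{finite,linorder}) \<ge> 3"
  shows "\<delta>0 \<in> invariant_distributions H N \<and>
    (\<exists>\<nu>\<in>invariant_distributions H N. dist_support N \<nu> = N) \<and>
    (\<forall>\<nu>\<in>invariant_distributions H N. dist_support N \<nu> = N \<longrightarrow>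
       invariant_distributions P N = {\<lambda>f. a * \<delta>0 f + b * \<nu> f |a b. True}) \<and>
    invariant_distributions P N = invariant_distributions H N"
proof -
  have ne: "first_idx \<noteq> (last_idx :: 'n)" using assms(5) by (intro two_le_card_distinct_ends) simp
  have \<delta>: "\<delta>0 \<in> invariant_distributions H N" unfolding \<delta>0_def H_def N_def by (rule delta_invariant)
  have HP: "invariant_distributions H N \<subseteq> invariant_distributions P N"
    unfolding H_def P_def by (rule H_invariant_imp_P_invariant)
  have span: "invariant_distributions P N = {\<lambda>f. a * \<delta>0 f + b * \<nu> f |a b. True}"
    if \<nu>: "\<nu> \<in> invariant_distributions H N" and supp: "dist_support N \<nu> = N" for \<nu>
  proof
    have \<nu>P: "\<nu> \<in> invariant_distributions P N" and \<delta>P: "\<delta>0 \<in> invariant_distributions P N"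
      using \<nu> \<delta> HP by blast+
    show "{\<lambda>f. a * \<delta>0 f + b * \<nu> f |a b. True} \<subseteq> invariant_distributions P N"
      using invariant_distributions_combine[OF \<delta>P[unfolded N_def] \<nu>P[unfolded N_def]] by (auto simp: N_def)
    \<comment> \<open>Otherwise \<nu> would be a multiple of the delta and supported at most at 0,
      whereas the cone has nonzero points.\<close>
    have nz: "\<nu> test_cyl \<noteq> 0"
    proof
      assume "\<nu> test_cyl = 0"
      then obtain c where c: "\<nu> = (\<lambda>f. c * delta_dist N_1n 0 f)"
        using P_invariant_multiple_delta[OF \<nu>P[unfolded P_def N_def] ne] by blast
      obtain x :: "('f, 'n) sqm" and k m where x: "x \<in> N_1n" "x $ k $ m \<noteq> 0"
        by (rule ex_nonzero_in_N_1n[OF assms(5) zero_less_one])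
      have "openin (top_of_set N) (N \<inter> - {0})" by (intro openin_open_Int open_Compl closed_singleton)
      then have "openin (top_of_set N) (N - {0})" by (simp only: Diff_eq)
      moreover have "\<forall>f\<in>schwartz (N - {0}). \<nu> f = 0" by (auto simp: c delta_dist_def schwartz_def)
      ultimately have "dist_support N \<nu> \<subseteq> N - (N - {0})" unfolding dist_support_def by blast
      then have "x = 0" using supp x(1) by (auto simp: N_def)
      then show False using x(2) by simp
    qed
    show "invariant_distributions P N \<subseteq> {\<lambda>f. a * \<delta>0 f + b * \<nu> f |a b. True}"
    proof
      fix T assume T: "T \<in> invariant_distributions P N"
      \<comment> \<open>This b makes T - b \<nu> vanish on \<open>test_cyl\<close>, hence a multiple
        of the delta.\<close>
      define b where "b = T test_cyl / \<nu> test_cyl"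
      let ?T = "\<lambda>f. 1 * T f + (- b) * \<nu> f"
      have "?T \<in> invariant_distributions P_1n N_1n"
        using invariant_distributions_combine[OF T[unfolded N_def] \<nu>P[unfolded N_def], of 1 "- b"] by (simp add: P_def)
      moreover have "?T test_cyl = 0" using nz by (simp add: b_def)
      ultimately obtain c where c: "?T = (\<lambda>f. c * delta_dist N_1n 0 f)"
        using P_invariant_multiple_delta[OF _ ne] by blast
      have "T f = c * \<delta>0 f + b * \<nu> f" for f
        using fun_cong[OF c, of f] by (simp add: \<delta>0_def N_def algebra_simps)
      then show "T \<in> {\<lambda>f. a * \<delta>0 f + b * \<nu> f |a b. True}" by blast
    qed
  qed
  have cone: "cone_dist \<in> invariant_distributions H N" "dist_support N cone_dist = N"
    unfolding H_def N_def using cone_dist_invariant[OF assms(5)] cone_dist_full_support[OF assms(5)] by auto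
  \<comment> \<open>Existence enters here: taking \<open>cone_dist\<close> for \<nu> writes every
    P-invariant distribution as a combination of two H-invariant ones.\<close>
  have "invariant_distributions P N \<subseteq> invariant_distributions H N"
    unfolding span[OF cone]
    using invariant_distributions_combine[OF \<delta>[unfolded N_def] cone(1)[unfolded N_def]] by (auto simp: N_def)
  then show ?thesis using \<delta> cone span HP by blast
qed

end
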